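(* There is an algorithm which, given a pattern $p=p[1\ldots m]$ and a text $t=t[1\ldots n]$ (sequences of pairwise distinct integers), finds every position $1\le j\le n-m+1$ such that $t[j\ldots j+m-1]\overset{\tau}{\approx}_{CT} p$, using $\mathcal{O}((m^2+n)\log m)$ time in the worst case and $\mathcal{O}(m^2)$ space.
   Context: For a sequence $x$ of pairwise distinct integers of length $m$, its Cartesian tree $C(x)$ is the binary tree defined recursively: empty if $x$ is empty; otherwise, if $x[g]$ is the minimum of $x$, the root is a node labeled $g$, its left subtree is $C(x[1\ldots g-1])$ and its right subtree is the Cartesian tree of $x[g+1\ldots m]$ (with node labels being the positions in $x$). Write $x\approx_{CT} y$ if $C(x)=C(y)$ (as unlabeled binary trees, equivalently the same shape). For $1\le i\le m-1$, the swap $\tau(x,i)$ is the sequence obtained from $x$ by exchanging $x[i]$ and $x[i+1]$. For sequences $x,y$ of length $m$, $x\overset{\tau}{\approx}_{CT} y$ means: either $x\approx_{CT} y$, or there exist sequences $x',y'$ and $i\in\{1,\ldots,m-1\}$ with $x'\approx_{CT} x$, $y'\approx_{CT} y$ and $x'=\tau(y',i)$ (equivalently $y'=\tau(x',i)$). *)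

theory Defs
  imports Complex_Main "HOL-Library.Tree"
begin

section \<open>Cartesian trees and Cartesian tree matching up to one swap\<close>

(* 0-based index of the (leftmost) minimum; only used on nonempty lists. *)
definition argmin :: "int list \<Rightarrow> nat" where
  "argmin xs = (LEAST i. i < length xs \<and> xs ! i = Min (set xs))"

lemma argmin_less:
  assumes "xs \<noteq> []"
  shows "argmin xs < length xs"
proof -
  from assms have "Min (set xs) \<in> set xs" by simp
  then have "\<exists>i. i < length xs \<and> xs ! i = Min (set xs)" by (simp only: in_set_conv_nth)
  then show ?thesis unfolding argmin_def by (rule LeastI2_ex) simp
qed

(* The offset makes node labels positions (counted from 1) in the whole sequence. *)
function cartesian_at :: "nat \<Rightarrow> int list \<Rightarrow> nat tree" where
  "cartesian_at off xs =
     (if xs = [] then Leaf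
      else let g = argmin xs in
        Node (cartesian_at off (take g xs)) (off + g + 1)
             (cartesian_at (off + g + 1) (drop (g + 1) xs)))"
  by pat_completeness auto
termination
  by (relation "measure (\<lambda>(off, xs). length xs)") (auto simp: argmin_less)

declare cartesian_at.simps [simp del]

definition cartesian_tree :: "int list \<Rightarrow> nat tree" where
  "cartesian_tree xs = cartesian_at 0 xs"

definition unlabel :: "'a tree \<Rightarrow> unit tree" where
  "unlabel = map_tree (\<lambda>_. ())"

definition ct_eq :: "int list \<Rightarrow> int list \<Rightarrow> bool"  (infix "\<approx>CT" 50) where
  "x \<approx>CT y \<longleftrightarrow> unlabel (cartesian_tree x) = unlabel (cartesian_tree y)"

(* Positions are counted from 1. *)
definition swap :: "int list \<Rightarrow> nat \<Rightarrow> int list" where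
  "swap x i = x[i - 1 := x ! i, i := x ! (i - 1)]"

(* All sequences have pairwise distinct entries; lengths agree because the
   Cartesian tree of a sequence has as many nodes as the sequence has entries. *)
definition ct_swap_eq :: "int list \<Rightarrow> int list \<Rightarrow> bool"  (infix "\<approx>CTswap" 50) where
  "x \<approx>CTswap y \<longleftrightarrow> x \<approx>CT y \<or>
     (\<exists>x' y' i. distinct x' \<and> distinct y' \<and> i \<in> {1..length x - 1} \<and>
        x' \<approx>CT x \<and> y' \<approx>CT y \<and> x' = swap y' i)"

(* substring t j m = t[j..j+m-1] *)
definition substring :: "'a list \<Rightarrow> nat \<Rightarrow> nat \<Rightarrow> 'a list" where
  "substring t j m = take m (drop (j - 1) t)"

definition occurrences :: "int list \<Rightarrow> int list \<Rightarrow> nat set" where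
  "occurrences p t =
     {j. 1 \<le> j \<and> j + length p \<le> length t + 1 \<and> substring t j (length p) \<approx>CTswap p}"


section \<open>A random access machine with time and space accounting\<close>

text \<open>
  Programs are structured word-RAM programs over a finite set of registers and an
  addressable work memory. Pattern and text are read-only, and the output is write-only;
  as usual, neither counts as work space. Input entries may be arbitrarily large: they are
  read, moved and compared at unit cost, but the result of every arithmetic operation must
  be at most \<open>word_max\<close> in absolute value (in the application polynomial in the input
  lengths, i.e. words of logarithmic length). Violating this bound, or addressing memory,
  pattern or text out of range, has no transition, so that a program with such a fault
  does not terminate in the sense of \<open>exec\<close>.
\<close>

datatype arith_op = Add | Sub | Mul | Div | Mod

datatype (exp_regs: 'r) exp =
    Const int | Reg 'r | Cell "'r exp"
  | PatLen | TxtLen | Pat "'r exp" | Txt "'r exp"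
  | Arith arith_op "'r exp" "'r exp"

datatype (bexp_regs: 'r) bexp =
    Less "'r exp" "'r exp" | Equal "'r exp" "'r exp"
  | Not "'r bexp" | And "'r bexp" "'r bexp"

datatype (regs: 'r) com =
    Skip
  | Assign 'r "'r exp"
  | Store "'r exp" "'r exp"
  | Output "'r exp"
  | Seq "'r com" "'r com"
  | If "'r bexp" "'r com" "'r com"
  | While "'r bexp" "'r com"

record machine =
  pat_in :: "int list"
  txt_in :: "int list"
  word_max :: int
  cells :: nat

record 'r state =
  reg :: "'r \<Rightarrow> int"
  mem :: "nat \<Rightarrow> int"
  outp :: "int list"

fun arith :: "arith_op \<Rightarrow> int \<Rightarrow> int \<Rightarrow> int" where
  "arith Add a b = a + b"
| "arith Sub a b = a - b"
| "arith Mul a b = a * b"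
| "arith Div a b = a div b"
| "arith Mod a b = a mod b"

definition address :: "machine \<Rightarrow> int \<Rightarrow> nat option" where
  "address M a = (if 0 \<le> a \<and> a < int (cells M) then Some (nat a) else None)"

(* Input positions are counted from 1. *)
definition read_input :: "int list \<Rightarrow> int \<Rightarrow> int option" where
  "read_input xs a = (if 1 \<le> a \<and> a \<le> int (length xs) then Some (xs ! nat (a - 1)) else None)"

definition word :: "machine \<Rightarrow> int \<Rightarrow> int option" where
  "word M v = (if \<bar>v\<bar> \<le> word_max M then Some v else None)"

primrec eval :: "machine \<Rightarrow> 'r state \<Rightarrow> 'r exp \<Rightarrow> int option" where
  "eval M s (Const v) = Some v"
| "eval M s (Reg r) = Some (reg s r)"
| "eval M s (Cell e) =
     Option.bind (eval M s e) (\<lambda>a. map_option (mem s) (address M a))"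
| "eval M s PatLen = Some (int (length (pat_in M)))"
| "eval M s TxtLen = Some (int (length (txt_in M)))"
| "eval M s (Pat e) = Option.bind (eval M s e) (read_input (pat_in M))"
| "eval M s (Txt e) = Option.bind (eval M s e) (read_input (txt_in M))"
| "eval M s (Arith f d e) =
     Option.bind (eval M s d) (\<lambda>a. Option.bind (eval M s e) (\<lambda>b. word M (arith f a b)))"

(* Conjunction is short-circuiting. *)
primrec test :: "machine \<Rightarrow> 'r state \<Rightarrow> 'r bexp \<Rightarrow> bool option" where
  "test M s (Less d e) =
     Option.bind (eval M s d) (\<lambda>a. Option.bind (eval M s e) (\<lambda>b. Some (a < b)))"
| "test M s (Equal d e) =
     Option.bind (eval M s d) (\<lambda>a. Option.bind (eval M s e) (\<lambda>b. Some (a = b)))"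
| "test M s (Not b) = map_option (\<lambda>v. \<not> v) (test M s b)"
| "test M s (And b c) =
     Option.bind (test M s b) (\<lambda>v. if v then test M s c else Some False)"

primrec ops :: "'r exp \<Rightarrow> nat" where
  "ops (Const v) = 0"
| "ops (Reg r) = 0"
| "ops (Cell e) = ops e + 1"
| "ops PatLen = 0"
| "ops TxtLen = 0"
| "ops (Pat e) = ops e + 1"
| "ops (Txt e) = ops e + 1"
| "ops (Arith f d e) = ops d + ops e + 1"

primrec test_ops :: "'r bexp \<Rightarrow> nat" where
  "test_ops (Less d e) = ops d + ops e + 1"
| "test_ops (Equal d e) = ops d + ops e + 1"
| "test_ops (Not b) = test_ops b + 1"
| "test_ops (And b c) = test_ops b + test_ops c + 1"

(* exec M c s k s': started in s, the program c terminates in s' after k steps.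
   Each command costs one step plus one step for every operator in the expressions it
   evaluates; a conjunction is charged in full even if its evaluation is cut short. *)
inductive exec :: "machine \<Rightarrow> 'r com \<Rightarrow> 'r state \<Rightarrow> nat \<Rightarrow> 'r state \<Rightarrow> bool"
  for M :: machine where
  Skip: "exec M Skip s 1 s"
| Assign: "eval M s e = Some v \<Longrightarrow>
    exec M (Assign r e) s (1 + ops e) (s\<lparr>reg := (reg s)(r := v)\<rparr>)"
| Store: "eval M s d = Some v \<Longrightarrow> address M v = Some a \<Longrightarrow> eval M s e = Some w \<Longrightarrow>
    exec M (Store d e) s (1 + ops d + ops e) (s\<lparr>mem := (mem s)(a := w)\<rparr>)"
| Output: "eval M s e = Some v \<Longrightarrow>
    exec M (Output e) s (1 + ops e) (s\<lparr>outp := outp s @ [v]\<rparr>)"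
| Seq: "exec M c s k s' \<Longrightarrow> exec M d s' l s'' \<Longrightarrow> exec M (Seq c d) s (k + l) s''"
| IfTrue: "test M s b = Some True \<Longrightarrow> exec M c s k s' \<Longrightarrow>
    exec M (If b c d) s (1 + test_ops b + k) s'"
| IfFalse: "test M s b = Some False \<Longrightarrow> exec M d s k s' \<Longrightarrow>
    exec M (If b c d) s (1 + test_ops b + k) s'"
| WhileFalse: "test M s b = Some False \<Longrightarrow> exec M (While b c) s (1 + test_ops b) s"
| WhileTrue: "test M s b = Some True \<Longrightarrow> exec M c s k s' \<Longrightarrow> exec M (While b c) s' l s'' \<Longrightarrow>
    exec M (While b c) s (1 + test_ops b + k + l) s''"

inductive_cases exec_SkipE: "exec M Skip s k s'"
inductive_cases exec_AssignE: "exec M (Assign r e) s k s'"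
inductive_cases exec_StoreE: "exec M (Store d e) s k s'"
inductive_cases exec_OutputE: "exec M (Output e) s k s'"
inductive_cases exec_SeqE: "exec M (Seq c d) s k s'"
inductive_cases exec_IfE: "exec M (If b c d) s k s'"
inductive_cases exec_WhileE: "exec M (While b c) s k s'"

(* Final state and running time are functions of the initial state. *)
lemma exec_deterministic:
  "exec M c s k s' \<Longrightarrow> exec M c s l s'' \<Longrightarrow> k = l \<and> s' = s''"
proof (induction arbitrary: l s'' rule: exec.induct)
  case Skip
  from Skip.prems show ?case by (auto elim!: exec_SkipE)
next
  case Assign
  from Assign.prems Assign.hyps show ?case by (auto elim!: exec_AssignE)
next
  case Store
  from Store.prems Store.hyps show ?case by (auto elim!: exec_StoreE)
next
  case Output
  from Output.prems Output.hyps show ?case by (auto elim!: exec_OutputE)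
next
  case (Seq c s k s' d l0 s0)
  from Seq.prems obtain k' l' u
    where *: "l = k' + l'" "exec M c s k' u" "exec M d u l' s''"
    by (rule exec_SeqE) blast
  from Seq.IH(1)[OF *(2)] have "k = k'" "s' = u" by simp_all
  moreover from Seq.IH(2) *(3) \<open>s' = u\<close> have "l0 = l' \<and> s0 = s''" by simp
  ultimately show ?case using *(1) by simp
next
  case (IfTrue s b c k s' d)
  from IfTrue.prems obtain l' where "l = 1 + test_ops b + l'" "exec M c s l' s''"
    by (rule exec_IfE) (use IfTrue.hyps(1) in simp_all)
  with IfTrue.IH show ?case by blast
next
  case (IfFalse s b d k s' c)
  from IfFalse.prems obtain l' where "l = 1 + test_ops b + l'" "exec M d s l' s''"
    by (rule exec_IfE) (use IfFalse.hyps(1) in simp_all)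
  with IfFalse.IH show ?case by blast
next
  case WhileFalse
  from WhileFalse.prems show ?case
    by (rule exec_WhileE) (use WhileFalse.hyps in simp_all)
next
  case (WhileTrue s b c k s' l0 s0)
  from WhileTrue.prems obtain k' l' u
    where *: "l = 1 + test_ops b + k' + l'" "exec M c s k' u" "exec M (While b c) u l' s''"
    by (rule exec_WhileE) (use WhileTrue.hyps(1) in simp_all)
  from WhileTrue.IH(1)[OF *(2)] have "k = k'" "s' = u" by simp_all
  moreover from WhileTrue.IH(2) *(3) \<open>s' = u\<close> have "l0 = l' \<and> s0 = s''" by simp
  ultimately show ?case using *(1) by simp
qed

definition start :: "'r state" where
  "start = \<lparr>reg = (\<lambda>_. 0), mem = (\<lambda>_. 0), outp = []\<rparr>"

(* run P p t W T S out: with words bounded by W, the program P on pattern p and text t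
   halts after T steps within S words of work space (registers included), having
   output the list out. *)
definition run :: "'r com \<Rightarrow> int list \<Rightarrow> int list \<Rightarrow> int \<Rightarrow> nat \<Rightarrow> nat \<Rightarrow> int list \<Rightarrow> bool" where
  "run P p t W T S out \<longleftrightarrow>
     (\<exists>n s. exec \<lparr>pat_in = p, txt_in = t, word_max = W, cells = n\<rparr> P start T s \<and>
            S = n + card (regs P) \<and> out = outp s)"

end

theory Submission
  imports Defs
begin

text \<open>
  A sequence of distinct integers is encoded by its parent distances: for every position the
  distance to the nearest smaller entry on the left, or 0. Two sequences have the same Cartesian tree
  iff their codes agree, and the code of a substring arises from the code of the sequence by replacing
  the distances that leave the substring by 0.

  Swapping an ascending pair of a representative of \<open>p\<close> at position \<open>q\<close> changes the code in
  a controlled way: the only freedom is the new distance at \<open>q\<close>, which must lie on the chain of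
  nearest smaller entries between \<open>q - 1\<close> and the nearest smaller entry of \<open>q\<close>. Since these
  chains are the parts of a stack that are popped at \<open>q\<close>, at most \<open>2 m\<close> codes arise. Descending
  pairs become ascending ones after reversal, so two passes suffice, one of them on the reversed inputs.

  In a pass the codes are the rows of a trie in which every row branches off the main path \<open>p\<close>
  once; an Aho-Corasick automaton on this trie, whose transitions truncate distances to the current
  depth, finds the occurrences. Building the automaton takes time and space \<open>O(m\<^sup>2)\<close>, scanning the
  text \<open>O(n)\<close>; the logarithmic factor of the statement is not needed, because the children of main
  path nodes are found in a table indexed by depth and distance.
\<close>

section \<open>Parent distance codes\<close>

text \<open>The two orders of the exchanged pair are not symmetric. If the pair ascends, the larger
  entry moves left and the smaller one shields it from everything further right, so only the
  distance at its new place is open. If it descends, the larger entry moves right, and each later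
  entry may meet either of the two first, which distances to the left do not settle; after reversal
  this freedom is again a single distance. Conversely a representative may be chosen freely within
  its class: lifting whole subtrees leaves the code unchanged, so every distance that the code does
  not exclude is attained.

  An automaton works although a symbol depends on the start of its window, because truncating for a
  long window and then for a shorter one equals truncating for the shorter one at once; a failure
  link computed on a row therefore serves every text window with that code.

  All running times are amortised. The time budget carries 30 units for each member of the stack of
  nearest smaller entries and for each level of depth of the automaton state, slightly more than one
  loop iteration costs.\<close>

definition pd :: "int list \<Rightarrow> nat \<Rightarrow> nat" where
  "pd xs k = (if \<exists>c. 1 \<le> c \<and> c \<le> k \<and> xs ! (k - c) < xs ! k
     then LEAST c. 1 \<le> c \<and> c \<le> k \<and> xs ! (k - c) < xs ! k else 0)"

text \<open>A description by inequalities, so that every later computation of \<open>pd\<close> is a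
  guess followed by a check; \<open>is_pd_unique\<close> makes the check sufficient. For
  \<open>c = 0\<close> the last clause ranges over all earlier positions, which is how 0 encodes the
  absence of a smaller entry.\<close>

definition is_pd :: "int list \<Rightarrow> nat \<Rightarrow> nat \<Rightarrow> bool" where
  "is_pd xs k c \<longleftrightarrow> c \<le> k \<and> (c > 0 \<longrightarrow> xs ! (k - c) < xs ! k) \<and>
     (\<forall>l<k. (c > 0 \<longrightarrow> k - c < l) \<longrightarrow> xs ! k \<le> xs ! l)"

lemma is_pd_pd: "is_pd xs k (pd xs k)"
proof (cases "\<exists>c. 1 \<le> c \<and> c \<le> k \<and> xs ! (k - c) < xs ! k")
  case True
  define c where "c = (LEAST c. 1 \<le> c \<and> c \<le> k \<and> xs ! (k - c) < xs ! k)"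
  have c: "1 \<le> c \<and> c \<le> k \<and> xs ! (k - c) < xs ! k"
    unfolding c_def by (rule LeastI_ex[OF True])
  have "xs ! k \<le> xs ! l" if "l < k" "k - c < l" for l
  proof (rule ccontr)
    assume "\<not> ?thesis"
    then have "c \<le> k - l" unfolding c_def by (intro Least_le) (use that in auto)
    with that show False by simp
  qed
  moreover have "pd xs k = c" using True by (simp add: pd_def c_def)
  ultimately show ?thesis using c by (simp add: is_pd_def)
next
  case False
  have "xs ! k \<le> xs ! l" if "l < k" for l
    using False that by (auto simp: not_less dest: spec[of _ "k - l"])
  with False show ?thesis by (auto simp: is_pd_def pd_def)
qed

lemma is_pd_unique: "is_pd xs k c \<Longrightarrow> is_pd xs k d \<Longrightarrow> c = d"
proof (induction c d rule: linorder_wlog)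
  case (le c d)
  show ?case
  proof (rule ccontr)
    assume "c \<noteq> d"
    with le have *: "c < d" "d \<le> k" by (auto simp: is_pd_def)
    show False
    proof (cases "c = 0")
      case True
      with * le(2) have "xs ! k \<le> xs ! (k - d)" by (auto simp: is_pd_def)
      with * le(3) show False by (auto simp: is_pd_def)
    next
      case False
      with * le(3) have "xs ! k \<le> xs ! (k - c)" by (auto simp: is_pd_def)
      with False le(2) show False by (auto simp: is_pd_def)
    qed
  qed
qed (auto)

lemma pd_eqI: "is_pd xs k c \<Longrightarrow> pd xs k = c"
  using is_pd_pd is_pd_unique by blast

lemma pd_le: "pd xs k \<le> k"
  using is_pd_pd[of xs k] by (simp add: is_pd_def)

lemma pd_pos: "pd xs k > 0 \<Longrightarrow> xs ! (k - pd xs k) < xs ! k"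
  using is_pd_pd[of xs k] by (simp add: is_pd_def)

lemma pd_between: "l < k \<Longrightarrow> (pd xs k > 0 \<Longrightarrow> k - pd xs k < l) \<Longrightarrow> xs ! k \<le> xs ! l"
  using is_pd_pd[of xs k] by (auto simp: is_pd_def)

definition code :: "int list \<Rightarrow> nat list" where
  "code xs = map (pd xs) [0..<length xs]"

lemma length_code [simp]: "length (code xs) = length xs"
  by (simp add: code_def)

lemma nth_code [simp]: "k < length xs \<Longrightarrow> code xs ! k = pd xs k"
  by (simp add: code_def)

lemma code_eq_iff:
  "code xs = code ys \<longleftrightarrow> length xs = length ys \<and> (\<forall>k<length xs. pd xs k = pd ys k)"
  by (auto simp: list_eq_iff_nth_eq)

section \<open>Shapes of Cartesian trees and their codes\<close>

lemma argmin_unique: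
  assumes "distinct xs" "i < length xs" "\<And>j. j < length xs \<Longrightarrow> xs ! i \<le> xs ! j"
  shows "argmin xs = i"
proof -
  have "xs ! i = Min (set xs)"
    using assms by (intro Min_eqI[symmetric]) (auto simp: in_set_conv_nth)
  then have "(LEAST j. j < length xs \<and> xs ! j = Min (set xs)) = i"
    using assms(1,2) by (intro Least_equality) (simp_all, metis nth_eq_iff_index_eq order_refl)
  then show ?thesis by (simp add: argmin_def)
qed

lemma argmin_min:
  assumes "j < length xs"
  shows "xs ! argmin xs \<le> xs ! j"
proof -
  from assms have "xs \<noteq> []" by auto
  then have "Min (set xs) \<in> set xs" by simp
  then have "\<exists>i. i < length xs \<and> xs ! i = Min (set xs)" by (simp only: in_set_conv_nth)
  then have "xs ! argmin xs = Min (set xs)"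
    unfolding argmin_def by (rule LeastI2_ex) simp
  with assms show ?thesis by simp
qed

lemma argmin_min_less:
  assumes "distinct xs" "j < length xs" "j \<noteq> argmin xs"
  shows "xs ! argmin xs < xs ! j"
proof -
  have "argmin xs < length xs" using assms(2) by (intro argmin_less) auto
  then have "xs ! argmin xs \<noteq> xs ! j" using assms by (simp add: nth_eq_iff_index_eq)
  with argmin_min[OF assms(2)] show ?thesis by simp
qed

definition shape :: "int list \<Rightarrow> unit tree" where
  "shape xs = unlabel (cartesian_tree xs)"

lemma unlabel_offset: "unlabel (cartesian_at a xs) = unlabel (cartesian_at b xs)"
proof (induction xs arbitrary: a b rule: length_induct)
  case (1 xs)
  show ?case
  proof (cases "xs = []")
    case True
    then show ?thesis by (simp add: cartesian_at.simps unlabel_def)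
  next
    case False
    have *: "length (take (argmin xs) xs) < length xs"
      "length (drop (argmin xs + 1) xs) < length xs"
      using argmin_less[OF False] by auto
    show ?thesis
      using 1[rule_format, OF *(1)] 1[rule_format, OF *(2)] False
      by (subst (1 2) cartesian_at.simps) (simp add: Let_def unlabel_def)
  qed
qed

lemma shape_Nil [simp]: "shape [] = Leaf"
  by (simp add: shape_def cartesian_tree_def cartesian_at.simps unlabel_def)

lemma shape_Node:
  assumes "xs \<noteq> []"
  shows "shape xs =
    Node (shape (take (argmin xs) xs)) () (shape (drop (Suc (argmin xs)) xs))"
  unfolding shape_def cartesian_tree_def
  using assms unlabel_offset[of "Suc (argmin xs)" _ 0]
  by (subst cartesian_at.simps) (simp add: Let_def unlabel_def)

lemma ct_eq_shape: "x \<approx>CT y \<longleftrightarrow> shape x = shape y"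
  by (simp add: ct_eq_def shape_def)

lemma size_shape [simp]: "size (shape xs) = length xs"
proof (induction xs rule: length_induct)
  case (1 xs)
  show ?case
  proof (cases "xs = []")
    case False
    have "argmin xs < length xs" using argmin_less[OF False] .
    then show ?thesis using 1 False
      by (simp add: shape_Node)
  qed simp
qed

lemma ct_eq_length: "x \<approx>CT y \<Longrightarrow> length x = length y"
  by (metis ct_eq_shape size_shape)

lemma pd_take: "k < a \<Longrightarrow> pd (take a xs) k = pd xs k"
  by (rule pd_eqI) (use is_pd_pd[of xs k] in \<open>auto simp: is_pd_def\<close>)

text \<open>If the nearest smaller entry falls outside the remainder, nothing inside can replace it:
  everything in between is at least as large.\<close>

lemma pd_drop:
  assumes "a + k < length xs"
  shows "pd (drop a xs) k = (if pd xs (a + k) \<le> k then pd xs (a + k) else 0)"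
proof (rule pd_eqI)
  have *: "xs ! (a + k) \<le> xs ! (a + l)" if "l < k" "pd xs (a + k) > 0 \<Longrightarrow> a + k - pd xs (a + k) < a + l" for l
    using that by (intro pd_between) auto
  show "is_pd (drop a xs) k (if pd xs (a + k) \<le> k then pd xs (a + k) else 0)"
    using assms pd_pos[of xs "a + k"] pd_le[of xs "a + k"] by (auto simp: is_pd_def intro!: *)
qed

lemma pd_argmin:
  assumes "xs \<noteq> []"
  shows "pd xs (argmin xs) = 0"
  by (rule pd_eqI) (use argmin_less[OF assms] argmin_min in \<open>auto simp: is_pd_def\<close>)

lemma pd_after_argmin:
  assumes "distinct xs" "argmin xs < k" "k < length xs"
  shows "pd xs k > 0" "pd xs k \<le> k - argmin xs"
proof -
  have less: "xs ! argmin xs < xs ! k" using argmin_min_less assms by auto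
  have *: "is_pd xs k (pd xs k)" by (rule is_pd_pd)
  show 1: "pd xs k > 0"
  proof (rule ccontr)
    assume "\<not> ?thesis"
    with * assms have "xs ! k \<le> xs ! argmin xs" by (auto simp: is_pd_def)
    with less show False by simp
  qed
  show "pd xs k \<le> k - argmin xs"
  proof (rule ccontr)
    assume "\<not> ?thesis"
    with 1 * assms have "xs ! k \<le> xs ! argmin xs" by (auto simp: is_pd_def)
    with less show False by simp
  qed
qed

text \<open>Both sides locate the minimum: in the tree through the size of the left subtree, in the
  code as the last position with distance 0. The code of the part to the right of the minimum loses
  no information, since there a distance is truncated to 0 exactly when it leads to the minimum
  itself.\<close>

lemma shape_eq_code:
  assumes "distinct xs" "distinct ys" "length xs = length ys"
  shows "shape xs = shape ys \<longleftrightarrow> code xs = code ys"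
  using assms
proof (induction xs arbitrary: ys rule: length_induct)
  case (1 xs)
  show ?case
  proof (cases "xs = []")
    case True
    with 1 show ?thesis by simp
  next
    case False
    with 1 have ne: "ys \<noteq> []" by auto
    define g h where "g = argmin xs" and "h = argmin ys"
    have g: "g < length xs" and h: "h < length ys"
      using argmin_less False ne by (auto simp: g_def h_def)
    have IH: "shape (take g xs) = shape (take h ys) \<longleftrightarrow> code (take g xs) = code (take h ys)"
      "shape (drop (Suc g) xs) = shape (drop (Suc h) ys) \<longleftrightarrow>
         code (drop (Suc g) xs) = code (drop (Suc h) ys)" if "g = h"
      using 1 g h that by (auto intro!: 1(1)[rule_format])
    have sz: "shape (take g xs) = shape (take h ys) \<Longrightarrow> g = h"
      using g h by (metis length_take min.absorb4 size_shape)
    have cgh: "g = h" if eq: "code xs = code ys"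
    proof (rule ccontr)
      assume "g \<noteq> h"
      then consider "g < h" | "h < g" by linarith
      then show False
      proof cases
        case 1
        then have "pd xs h > 0"
          using pd_after_argmin[of xs h] h \<open>length xs = length ys\<close> \<open>distinct xs\<close> by (simp add: g_def)
        moreover have "pd ys h = 0" using pd_argmin[OF ne] by (simp add: h_def)
        ultimately show False using eq h \<open>length xs = length ys\<close> by (auto simp: code_eq_iff)
      next
        case 2
        then have "pd ys g > 0"
          using pd_after_argmin[of ys g] g \<open>length xs = length ys\<close> \<open>distinct ys\<close> by (simp add: h_def)
        moreover have "pd xs g = 0" using pd_argmin[OF False] by (simp add: g_def)
        ultimately show False using eq g \<open>length xs = length ys\<close> by (auto simp: code_eq_iff)
      qed
    qed
    have parts: "code xs = code ys \<longleftrightarrow> code (take g xs) = code (take g ys) \<and>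
        code (drop (Suc g) xs) = code (drop (Suc g) ys)" if "g = h"
    proof
      assume "code xs = code ys"
      then show "code (take g xs) = code (take g ys) \<and>
        code (drop (Suc g) xs) = code (drop (Suc g) ys)"
        by (auto simp: code_eq_iff pd_take pd_drop)
    next
      assume *: "code (take g xs) = code (take g ys) \<and>
        code (drop (Suc g) xs) = code (drop (Suc g) ys)"
      have "pd xs k = pd ys k" if k: "k < length xs" for k
      proof -
        consider "k < g" | "k = g" | "k > g" by linarith
        then show ?thesis
        proof cases
          case 1
          with * k show ?thesis by (auto simp: code_eq_iff pd_take)
        next
          case 2
          with pd_argmin[OF False] pd_argmin[OF ne] \<open>g = h\<close> show ?thesis
            by (simp add: g_def h_def)
        next
          case 3
          then obtain l where l: "k = Suc g + l" using less_iff_Suc_add by auto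
          have x: "0 < pd xs k" "pd xs k \<le> Suc l"
            using pd_after_argmin[of xs k] 3 k l \<open>distinct xs\<close> by (auto simp: g_def)
          have y: "0 < pd ys k" "pd ys k \<le> Suc l"
            using pd_after_argmin[of ys k] 3 k l \<open>distinct ys\<close> \<open>length xs = length ys\<close> \<open>g = h\<close>
            by (auto simp: h_def)
          have "pd (drop (Suc g) xs) l = pd (drop (Suc g) ys) l"
            using * k l by (auto simp: code_eq_iff)
          then have "(if pd xs k \<le> l then pd xs k else 0) = (if pd ys k \<le> l then pd ys k else 0)"
            using k \<open>length xs = length ys\<close> pd_drop[of "Suc g" l xs, folded l]
              pd_drop[of "Suc g" l ys, folded l]
            by simp
          with x y l show ?thesis by (cases "pd xs k \<le> l"; cases "pd ys k \<le> l") auto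
        qed
      qed
      with \<open>length xs = length ys\<close> show "code xs = code ys" by (simp add: code_eq_iff)
    qed
    have "shape xs = shape ys \<longleftrightarrow> shape (take g xs) = shape (take h ys) \<and>
        shape (drop (Suc g) xs) = shape (drop (Suc h) ys)"
      using False ne by (simp add: shape_Node g_def h_def)
    then show ?thesis using sz cgh parts IH by metis
  qed
qed

lemma ct_eq_code:
  assumes "distinct xs" "distinct ys"
  shows "xs \<approx>CT ys \<longleftrightarrow> code xs = code ys"
  using assms shape_eq_code ct_eq_length
  by (metis ct_eq_shape length_code)

section \<open>Reversed sequences and mirrored trees\<close>

lemma argmin_rev:
  assumes "distinct xs" "xs \<noteq> []"
  shows "argmin (rev xs) = length xs - Suc (argmin xs)"
proof (rule argmin_unique)
  show "length xs - Suc (argmin xs) < length (rev xs)" using assms by simp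
  show "rev xs ! (length xs - Suc (argmin xs)) \<le> rev xs ! j" if "j < length (rev xs)" for j
    using that assms argmin_less[of xs] argmin_min[of "length xs - Suc j" xs]
    by (simp add: rev_nth)
qed (use assms in simp)

lemma shape_rev:
  assumes "distinct xs"
  shows "shape (rev xs) = mirror (shape xs)"
  using assms
proof (induction xs rule: length_induct)
  case (1 xs)
  show ?case
  proof (cases "xs = []")
    case False
    let ?g = "argmin xs"
    have g: "?g < length xs" using argmin_less[OF False] .
    have "shape (rev xs) = Node (shape (rev (drop (Suc ?g) xs))) () (shape (rev (take ?g xs)))"
      using False g 1(2) by (simp add: shape_Node argmin_rev rev_drop rev_take Suc_diff_Suc)
    moreover have "shape (rev (drop (Suc ?g) xs)) = mirror (shape (drop (Suc ?g) xs))"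
      using 1 g by (intro 1(1)[rule_format]) auto
    moreover have "shape (rev (take ?g xs)) = mirror (shape (take ?g xs))"
      using 1 g by (intro 1(1)[rule_format]) auto
    ultimately show ?thesis using False by (simp add: shape_Node)
  qed simp
qed

lemma ct_eq_rev:
  assumes "distinct xs" "distinct ys"
  shows "rev xs \<approx>CT rev ys \<longleftrightarrow> xs \<approx>CT ys"
  using assms by (metis ct_eq_shape shape_rev mirror_mirror)

section \<open>Codes of sequences that differ by a swap\<close>

text \<open>The code after exchanging an ascending pair at \<open>q\<close> and
  \<open>Suc q\<close>, where \<open>c\<close> is the distance of the larger entry at its new place.
  The smaller entry has moved one away from its nearest smaller entry. Later entries that pointed at
  it now find it one step closer, whereas those that pointed at the larger entry find the smaller
  one in its place and keep their distance.\<close>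

definition nbr :: "nat list \<Rightarrow> nat \<Rightarrow> nat \<Rightarrow> nat list" where
  "nbr w q c = map (\<lambda>k. if k < q then w ! k else if k = q then c
     else if k = Suc q then (if w ! q = 0 then 0 else Suc (w ! q))
     else if w ! k = k - q then w ! k - 1 else w ! k) [0..<length w]"

lemma length_nbr [simp]: "length (nbr w q c) = length w"
  by (simp add: nbr_def)

text \<open>One step along the chain of nearest smaller entries, from \<open>q - c\<close> to its
  own nearest smaller entry, but measured from \<open>q\<close>.\<close>

definition nxt :: "nat list \<Rightarrow> nat \<Rightarrow> nat \<Rightarrow> nat" where
  "nxt w q c = (if w ! (q - c) = 0 then 0 else c + w ! (q - c))"

text \<open>The chain begins at the left neighbour of \<open>q\<close>. The nearest smaller entry of
  \<open>q\<close> still belongs to it, because the larger entry of the pair may lie below all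
  members passed before; the guard \<open>c \<noteq> w ! q\<close> stops the chain only there.
  Without such an entry the chain runs out with 0.\<close>

inductive_set opts :: "nat list \<Rightarrow> nat \<Rightarrow> nat set" for w q where
  start: "(if q = 0 then 0 else 1) \<in> opts w q"
| step: "c \<in> opts w q \<Longrightarrow> c \<noteq> 0 \<Longrightarrow> c \<noteq> w ! q \<Longrightarrow> nxt w q c \<in> opts w q"

text \<open>\<open>is_pd\<close> for a value that does not stand at \<open>q\<close> yet, namely the
  larger entry before the exchange.\<close>

definition is_pd_val :: "int list \<Rightarrow> nat \<Rightarrow> int \<Rightarrow> nat \<Rightarrow> bool" where
  "is_pd_val xs q v c \<longleftrightarrow> c \<le> q \<and> (c > 0 \<longrightarrow> xs ! (q - c) < v) \<and>
     (\<forall>l<q. (c > 0 \<longrightarrow> q - c < l) \<longrightarrow> v \<le> xs ! l)"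

lemma is_pd_val_exists: "\<exists>c. is_pd_val xs q v c"
proof -
  define f where "f = (\<lambda>l. if l < q then xs ! l else v)"
  let ?ys = "map f [0..<Suc q]"
  have "is_pd ?ys q (pd ?ys q)" by (rule is_pd_pd)
  then have "is_pd_val xs q v (pd ?ys q)"
    unfolding is_pd_def is_pd_val_def f_def by (auto simp: nth_append simp del: upt_Suc)
  then show ?thesis ..
qed

text \<open>Walking the chain cannot jump over the position sought: while the current entry is at
  least \<open>v\<close>, so is everything between it and its own nearest smaller entry. Nor can the
  guard of \<open>opts\<close> stop the walk too early, since the nearest smaller entry of
  \<open>q\<close> already lies below \<open>v\<close>.\<close>

lemma opts_complete:
  assumes v: "is_pd_val xs q v c" "xs ! q \<le> v" and q: "q < length xs"
  shows "c \<in> opts (code xs) q"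
proof -
  let ?w = "code xs"
  have *: "c \<in> opts ?w q" if "c' \<in> opts ?w q" "c' \<noteq> 0" "c = 0 \<or> c' \<le> c" "c' \<le> q" for c'
    using that
  proof (induction "q - c'" arbitrary: c' rule: less_induct)
    case less
    show ?case
    proof (cases "c = c'")
      case False
      have big: "v \<le> xs ! (q - c')" using v less.prems False by (auto simp: is_pd_val_def)
      then have "c' \<noteq> ?w ! q" using v(2) pd_pos[of xs q] less.prems q by auto
      then have n: "nxt ?w q c' \<in> opts ?w q" using less.prems by (auto intro: opts.step)
      define d where "d = pd xs (q - c')"
      have wd: "?w ! (q - c') = d" using q less.prems by (simp add: d_def)
      have dle: "d \<le> q - c'" by (simp add: d_def pd_le)
      have out: "\<not> q - c < q - c'" if "c > 0" "d > 0 \<Longrightarrow> q - c' - d < q - c"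
      proof
        assume lt: "q - c < q - c'"
        then have "xs ! (q - c') \<le> xs ! (q - c)"
          using that(2) by (intro pd_between) (auto simp: d_def)
        moreover have "xs ! (q - c) < v" using v(1) that(1) by (simp add: is_pd_val_def)
        ultimately show False using big by simp
      qed
      show ?thesis
      proof (cases "d = 0")
        case True
        then have "c = 0" using out less.prems False v(1) by (cases "c = 0") (auto simp: is_pd_val_def)
        with n wd True show ?thesis by (simp add: nxt_def)
      next
        case d: False
        have "c = 0 \<or> c' + d \<le> c"
        proof (rule ccontr)
          assume *: "\<not> ?thesis"
          with less.prems False v(1) have "c > 0" "q - c < q - c'"
            by (auto simp: is_pd_val_def)
          with out have "\<not> q - c' - d < q - c" by blast
          moreover have "c \<le> q" using v(1) by (simp add: is_pd_val_def)
          ultimately show False using * dle \<open>c' \<le> q\<close> by auto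
        qed
        moreover have "c' + d \<in> opts ?w q" using n wd d by (simp add: nxt_def)
        moreover have "c' + d \<le> q" "q - (c' + d) < q - c'" using dle d less.prems by auto
        ultimately show ?thesis using d by (intro less.hyps[of "c' + d"]) auto
      qed
    qed (use less in simp)
  qed
  show ?thesis
  proof (cases "q = 0")
    case True
    with v opts.start[of q ?w] show ?thesis by (auto simp: is_pd_val_def)
  next
    case False
    then show ?thesis using opts.start[of q ?w] by (intro *[of 1]) auto
  qed
qed

text \<open>These inequalities say that everything strictly between \<open>q - c\<close> and
  \<open>q\<close> lies above both ends, which is what \<open>code_raise\<close> asks of an interval
  to be lifted. The last clause, that the chain has not gone beyond the nearest smaller entry of
  \<open>q\<close>, keeps the induction running.\<close>

lemma opts_sound:
  assumes "c \<in> opts (code xs) q" "distinct xs" "q < length xs"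
  shows "c \<le> q \<and> (c > 0 \<longrightarrow> (\<forall>l<q. q - c < l \<longrightarrow> xs ! (q - c) < xs ! l)) \<and>
    (\<forall>l<q. (c > 0 \<longrightarrow> q - c < l) \<longrightarrow> xs ! q < xs ! l) \<and>
    (c > 0 \<longrightarrow> c = pd xs q \<or> xs ! q < xs ! (q - c))"
  using assms
proof (induction rule: opts.induct)
  case start
  have "xs ! q \<noteq> xs ! (q - 1)" if "q > 0"
    using start that by (simp add: nth_eq_iff_index_eq)
  moreover have "1 = pd xs q" if "xs ! (q - 1) < xs ! q" "q > 0"
    using that by (intro pd_eqI[symmetric]) (auto simp: is_pd_def)
  ultimately have "1 = pd xs q \<or> xs ! q < xs ! (q - 1)" if "q > 0"
    using that by linarith
  then show ?case by (cases "q = 0") auto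
next
  case (step c)
  then have IH: "c \<le> q" "\<And>l. l < q \<Longrightarrow> q - c < l \<Longrightarrow> xs ! (q - c) < xs ! l" 
    "xs ! q < xs ! (q - c)" by auto
  define d where "d = pd xs (q - c)"
  have wd: "code xs ! (q - c) = d" using step by (simp add: d_def)
  have dle: "d \<le> q - c" by (simp add: d_def pd_le)
  have gt: "xs ! (q - c) \<le> xs ! l" if "l < q" "d > 0 \<Longrightarrow> q - c - d < l" for l
  proof (cases "l < q - c")
    case True
    then show ?thesis using pd_between[of l "q - c" xs] that by (auto simp: d_def)
  next
    case False
    then show ?thesis using IH(2)[of l] that by (cases "l = q - c") auto
  qed
  show ?case
  proof (cases "d = 0")
    case True
    have "xs ! q < xs ! l" if "l < q" for l using gt[OF that] IH(3) True by simp
    then show ?thesis using True wd by (simp add: nxt_def)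
  next
    case False
    have e: "nxt (code xs) q c = c + d" using False wd by (simp add: nxt_def)
    have 1: "xs ! (q - c - d) < xs ! (q - c)" using False pd_pos[of xs "q - c"] by (simp add: d_def)
    have 2: "xs ! q < xs ! l" "xs ! (q - (c + d)) < xs ! l" if "l < q" "q - (c + d) < l" for l
    proof -
      have "xs ! (q - c) \<le> xs ! l" using that by (intro gt) auto
      then show "xs ! q < xs ! l" "xs ! (q - (c + d)) < xs ! l" using IH(3) 1 by auto
    qed
    have "c + d = pd xs q" if "\<not> xs ! q < xs ! (q - (c + d))"
    proof -
      have "xs ! q \<noteq> xs ! (q - (c + d))"
        using step False dle IH(1) by (simp add: nth_eq_iff_index_eq)
      then have "xs ! (q - (c + d)) < xs ! q" using that by simp
      moreover have "xs ! q \<le> xs ! l" if "l < q" "c + d > 0 \<longrightarrow> q - (c + d) < l" for l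
        using 2(1)[of l] that False by simp
      ultimately have "is_pd xs q (c + d)" using dle IH(1) by (simp add: is_pd_def)
      then show ?thesis using pd_eqI by metis
    qed
    moreover have "c + d > 0" "c + d \<le> q" using False dle IH(1) by auto
    ultimately show ?thesis unfolding e using 2 by blast
  qed
qed

text \<open>Ascents can be read off the code alone, so the admissible positions are the same for all
  representatives of a class.\<close>

lemma pd_Suc_eq_1:
  assumes "distinct xs" "Suc q < length xs"
  shows "pd xs (Suc q) = 1 \<longleftrightarrow> xs ! q < xs ! Suc q"
proof
  assume "pd xs (Suc q) = 1"
  with pd_pos[of xs "Suc q"] show "xs ! q < xs ! Suc q" by simp
next
  assume "xs ! q < xs ! Suc q"
  then show "pd xs (Suc q) = 1" by (intro pd_eqI) (auto simp: is_pd_def)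
qed

lemma nth_swap:
  assumes "Suc q < length ys" "k < length ys"
  shows "swap ys (Suc q) ! k = (if k = q then ys ! Suc q else if k = Suc q then ys ! q else ys ! k)"
  using assms by (auto simp: swap_def nth_list_update)

lemma length_swap [simp]: "length (swap ys i) = length ys"
  by (simp add: swap_def)

lemma distinct_swap: "distinct ys \<Longrightarrow> i < length ys \<Longrightarrow> distinct (swap ys i)"
  unfolding swap_def by (cases i) (auto simp: distinct_swap)

lemma code_swap:
  assumes y: "distinct ys" and q: "Suc q < length ys" and asc: "ys ! q < ys ! Suc q"
    and c: "is_pd_val ys q (ys ! Suc q) c"
  shows "code (swap ys (Suc q)) = nbr (code ys) q c"
proof -
  let ?x = "swap ys (Suc q)"
  have "pd ?x k = nbr (code ys) q c ! k" if k: "k < length ys" for k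
  proof (rule pd_eqI)
    have nth: "?x ! l = (if l = q then ys ! Suc q else if l = Suc q then ys ! q else ys ! l)"
      if "l \<le> k" for l
      using nth_swap[OF q, of l] that k by simp
    consider "k < q" | "k = q" | "k = Suc q" | "k > Suc q" by linarith
    then show "is_pd ?x k (nbr (code ys) q c ! k)"
    proof cases
      case 1
      then show ?thesis using is_pd_pd[of ys k] k by (auto simp: is_pd_def nbr_def nth)
    next
      case 2
      then show ?thesis using c k q by (auto simp: is_pd_def is_pd_val_def nbr_def nth)
    next
      case 3
      have "is_pd ys q (pd ys q)" by (rule is_pd_pd)
      then show ?thesis using 3 asc k q
        by (auto simp: is_pd_def nbr_def nth Suc_diff_le less_Suc_eq)
    next
      case 4
      define d where "d = pd ys k"
      have d: "is_pd ys k d" unfolding d_def by (rule is_pd_pd)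
      have n: "nbr (code ys) q c ! k = (if d = k - q then d - 1 else d)"
        using 4 k by (simp add: nbr_def d_def)
      show ?thesis
      proof (cases "d = k - q")
        case True
        then have "ys ! q < ys ! k" using d 4 by (auto simp: is_pd_def)
        moreover have "k - (d - 1) = Suc q" using True 4 by auto
        moreover have "ys ! k \<le> ys ! l" if "Suc q < l" "l < k" for l
          using d that True 4 by (auto simp: is_pd_def)
        ultimately show ?thesis using n True 4 by (auto simp: is_pd_def nth)
      next
        case False
        have i: "ys ! k \<le> ys ! l" if "l < k" "d > 0 \<longrightarrow> k - d < l" for l
          using d that by (auto simp: is_pd_def)
        \<comment> \<open>A search from \<open>k\<close> that passes \<open>Suc q\<close> does not
          end at \<open>q\<close> in this case, so it passes \<open>q\<close> as well. This is the
          inequality needed for the smaller entry at its new place \<open>Suc q\<close>;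
          \<open>le2\<close> is its counterpart for the larger entry.\<close>
        have le: "ys ! k \<le> ys ! q" if "d > 0 \<longrightarrow> k - d < Suc q"
          using i[of q] that False 4 d by (cases "d > 0") (auto simp: is_pd_def)
        have le2: "ys ! k \<le> ys ! Suc q" if "d > 0 \<longrightarrow> k - d < q"
          using i[of "Suc q"] that False 4 by (cases "d > 0") auto
        have "?x ! k \<le> ?x ! l" if "l < k" "d > 0 \<longrightarrow> k - d < l" for l
          using that 4 le le2 i[of l] by (auto simp: nth)
        moreover have "?x ! (k - d) < ?x ! k" if "d > 0"
        proof -
          have "ys ! (k - d) < ys ! k" "d \<le> k" using d that by (auto simp: is_pd_def)
          moreover have "k - d \<noteq> q" using False \<open>d \<le> k\<close> by auto
          ultimately show ?thesis using 4 that asc by (auto simp: nth)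
        qed
        ultimately show ?thesis using n False d by (auto simp: is_pd_def)
      qed
    qed
  qed
  then show ?thesis by (intro nth_equalityI) auto
qed

section \<open>Lifting subtrees without changing the code\<close>

definition raise :: "nat \<Rightarrow> nat \<Rightarrow> int \<Rightarrow> int list \<Rightarrow> int list" where
  "raise a b M xs = map (\<lambda>k. xs ! k + (if a \<le> k \<and> k < b then M else 0)) [0..<length xs]"

lemma length_raise [simp]: "length (raise a b M xs) = length xs"
  by (simp add: raise_def)

lemma nth_raise [simp]:
  "k < length xs \<Longrightarrow> raise a b M xs ! k = xs ! k + (if a \<le> k \<and> k < b then M else 0)"
  by (simp add: raise_def)

text \<open>No entry outside points into the interval, because \<open>xs ! b\<close> would stop its
  search first, and no search from inside passes \<open>xs ! (a - 1)\<close>. Hence each comparison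
  behind a distance has both sides in the interval, both outside, or becomes more pronounced by the
  lifting.\<close>

lemma code_raise:
  assumes M: "0 \<le> M" and b: "b \<le> length xs"
    and left: "\<And>k. 0 < a \<Longrightarrow> a \<le> k \<Longrightarrow> k < b \<Longrightarrow> xs ! (a - 1) < xs ! k"
    and right: "\<And>k. b < length xs \<Longrightarrow> a \<le> k \<Longrightarrow> k < b \<Longrightarrow> xs ! b < xs ! k"
  shows "code (raise a b M xs) = code xs"
proof -
  have "pd (raise a b M xs) k = pd xs k" if k: "k < length xs" for k
  proof (rule pd_eqI)
    define c where "c = pd xs k"
    have c: "c \<le> k" "c > 0 \<Longrightarrow> xs ! (k - c) < xs ! k"
      "\<And>l. l < k \<Longrightarrow> (c > 0 \<Longrightarrow> k - c < l) \<Longrightarrow> xs ! k \<le> xs ! l"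
      unfolding c_def by (fact pd_le, fact pd_pos, fact pd_between)
    have 1: "a \<le> k \<and> k < b" if "c > 0" "a \<le> k - c" "k - c < b"
    proof (rule ccontr)
      assume "\<not> ?thesis"
      with that have "b \<le> k" by auto
      with right[of "k - c"] that k have "xs ! b < xs ! (k - c)" by auto
      moreover have "xs ! k \<le> xs ! b" using c(3)[of b] that \<open>b \<le> k\<close> by (cases "b = k") auto
      ultimately show False using c(2) that by simp
    qed
    have 2: "a \<le> l" if "l < k" "c > 0 \<Longrightarrow> k - c < l" "a \<le> k" "k < b" for l
    proof (rule ccontr)
      assume "\<not> ?thesis"
      then have "0 < a" "l \<le> a - 1" by auto
      then have "xs ! k \<le> xs ! (a - 1)" using that by (intro c(3)) auto
      moreover have "xs ! (a - 1) < xs ! k" using left that \<open>0 < a\<close> by auto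
      ultimately show False by simp
    qed
    show "is_pd (raise a b M xs) k (pd xs k)"
      unfolding c_def[symmetric] is_pd_def
    proof (intro conjI impI allI)
      show "c \<le> k" by (rule c(1))
    next
      assume "c > 0"
      then show "raise a b M xs ! (k - c) < raise a b M xs ! k"
        using c(2) 1 M k by (cases "a \<le> k - c \<and> k - c < b") auto
    next
      fix l assume l: "l < k" "0 < c \<longrightarrow> k - c < l"
      then show "raise a b M xs ! k \<le> raise a b M xs ! l"
        using c(3)[of l] 2[of l] M k by (cases "a \<le> k \<and> k < b") auto
    qed
  qed
  then show ?thesis by (simp add: code_eq_iff)
qed

lemma distinct_raise:
  assumes "distinct xs" "\<And>x. x \<in> set xs \<Longrightarrow> \<bar>x\<bar> < L" "2 * L \<le> M"
  shows "distinct (raise a b M xs)"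
  unfolding distinct_conv_nth length_raise
proof (intro allI impI)
  fix i j assume ij: "i < length xs" "j < length xs" "i \<noteq> j"
  then have "\<bar>xs ! i\<bar> < L" "\<bar>xs ! j\<bar> < L" "xs ! i \<noteq> xs ! j"
    using assms(1,2) by (simp_all add: nth_eq_iff_index_eq)
  with assms(3) show "raise a b M xs ! i \<noteq> raise a b M xs ! j"
    unfolding nth_raise[OF ij(1)] nth_raise[OF ij(2)] by (simp split: if_split) linarith
qed

definition asc_nbr :: "nat list \<Rightarrow> nat list \<Rightarrow> bool" where
  "asc_nbr w v \<longleftrightarrow> (\<exists>q c. Suc q < length w \<and> w ! Suc q = 1 \<and> c \<in> opts w q \<and> v = nbr w q c)"

lemma asc_nbr_swap:
  assumes "distinct ys" "Suc q < length ys" "ys ! q < ys ! Suc q"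
  shows "asc_nbr (code ys) (code (swap ys (Suc q)))"
proof -
  obtain c where c: "is_pd_val ys q (ys ! Suc q) c" using is_pd_val_exists by blast
  then have "c \<in> opts (code ys) q" using assms by (intro opts_complete) auto
  with assms pd_Suc_eq_1[OF assms(1,2)] code_swap[OF assms c] show ?thesis
    unfolding asc_nbr_def by auto
qed

text \<open>The two raised intervals are subtrees; lifting them makes the larger entry of the swapped pair
  lie just above the entry at distance \<open>c\<close> from its new position.\<close>

lemma asc_nbr_realise:
  assumes p: "distinct p" and nb: "asc_nbr (code p) v"
  obtains ys q where "distinct ys" "code ys = code p" "Suc q < length ys" "ys ! q < ys ! Suc q"
    "v = code (swap ys (Suc q))"
proof -
  from nb obtain q c where q: "Suc q < length p" and asc: "pd p (Suc q) = 1"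
    and c: "c \<in> opts (code p) q" and v: "v = nbr (code p) q c"
    unfolding asc_nbr_def by (auto simp del: One_nat_def)
  have less: "p ! q < p ! Suc q" using pd_Suc_eq_1[OF p q] asc by simp
  note snd = opts_sound[OF c p Suc_lessD[OF q]]
  \<comment> \<open>From \<open>a\<close> up to \<open>q\<close> lies the part that has to end up
    above the larger entry. From \<open>Suc q\<close> up to \<open>b\<close> lies the right subtree
    of \<open>q\<close>, which must be lifted together with the larger entry.\<close>
  define a where "a = (if c = 0 then 0 else Suc (q - c))"
  define B where "B = {b. Suc q \<le> b \<and> (b = length p \<or> p ! b < p ! q)}"
  define b where "b = (LEAST b. b \<in> B)"
  have "length p \<in> B" using q by (simp add: B_def)
  then have bB: "b \<in> B" and ble: "b \<le> length p" unfolding b_def by (rule LeastI, rule Least_le)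
  have bgt: "p ! q < p ! k" if "Suc q \<le> k" "k < b" for k
  proof -
    have "k \<notin> B" using that not_less_Least[of k "\<lambda>b. b \<in> B"] by (auto simp: b_def)
    moreover have "p ! k \<noteq> p ! q" using p q that ble by (simp add: nth_eq_iff_index_eq)
    ultimately show ?thesis using that by (auto simp: B_def)
  qed
  have b1: "Suc q < b"
  proof (rule ccontr)
    assume "\<not> ?thesis"
    then have "b = Suc q" using bB by (simp add: B_def)
    with bB less q show False by (auto simp: B_def)
  qed
  define L where "L = Max (abs ` set p) + 1"
  have L: "\<bar>x\<bar> < L" if "x \<in> set p" for x
    using that Max_ge[of "abs ` set p" "\<bar>x\<bar>"] by (simp add: L_def)
  have L0: "L > 0" using L[of "p ! q"] q by fastforce
  \<comment> \<open>All absolute values lie below \<open>L\<close>, so \<open>2 * L\<close> puts the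
    larger entry above everything not lifted. Afterwards they lie below \<open>4 * L\<close>;
    \<open>8 * L\<close> is twice this bound, as \<open>distinct_raise\<close> requires, and puts
    the left part above the larger entry, which is less than \<open>3 * L\<close>.\<close>
  define ys1 where "ys1 = raise (Suc q) b (2 * L) p"
  define ys where "ys = raise a q (8 * L) ys1"
  have pL: "\<bar>p ! k\<bar> < L" if "k < length p" for k using L that by simp
  have n1: "ys1 ! k = p ! k + (if Suc q \<le> k \<and> k < b then 2 * L else 0)" if "k < length p" for k
    using that by (simp add: ys1_def)
  have n: "ys ! k = p ! k + (if Suc q \<le> k \<and> k < b then 2 * L else 0) +
      (if a \<le> k \<and> k < q then 8 * L else 0)" if "k < length p" for k
    using that n1 by (simp add: ys_def ys1_def)
  have len: "length ys = length p" "length ys1 = length p" by (simp_all add: ys_def ys1_def)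
  have c1: "code ys1 = code p"
    unfolding ys1_def using bgt bB ble q L0
    by (intro code_raise) (auto simp: B_def intro: less_trans)
  have alt: "p ! q < p ! l" if "a \<le> l" "l < q" for l
    using snd that by (auto simp: a_def split: if_splits)
  have c2: "code ys = code ys1"
    unfolding ys_def
  proof (rule code_raise)
    fix k assume k: "0 < a" "a \<le> k" "k < q"
    then have "c > 0" "a - 1 = q - c" "q - c < k" by (auto simp: a_def split: if_splits)
    then have "p ! (a - 1) < p ! k" using snd k by auto
    moreover have "a - 1 < q" using k by simp
    ultimately show "ys1 ! (a - 1) < ys1 ! k" using k q n1[of "a - 1"] n1[of k] by simp
  next
    fix k assume k: "a \<le> k" "k < q"
    show "ys1 ! q < ys1 ! k" using alt[OF k] k q by (simp add: n1)
  qed (use L0 q in \<open>auto simp: ys1_def\<close>)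
  have d1: "distinct ys1"
    unfolding ys1_def using p L by (rule distinct_raise) auto
  have "\<bar>ys1 ! k\<bar> < 4 * L" if "k < length p" for k using pL[OF that] n1[OF that] by auto
  then have d: "distinct ys"
    unfolding ys_def using d1 by (intro distinct_raise[where L = "4 * L"]) (auto simp: in_set_conv_nth len)
  have asc': "ys ! q < ys ! Suc q" using less q L0 n[of q] n[of "Suc q"] by auto
  have "is_pd_val ys q (ys ! Suc q) c"
    unfolding is_pd_val_def
  proof (intro conjI impI allI)
    show "c \<le> q" using snd by simp
  next
    assume c0: "c > 0"
    then have "q - c < a" by (simp add: a_def)
    have "ys ! (q - c) = p ! (q - c)" using q \<open>q - c < a\<close> n[of "q - c"] by auto
    moreover have "ys ! Suc q = p ! Suc q + 2 * L" using q n[of "Suc q"] b1 by simp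
    ultimately show "ys ! (q - c) < ys ! Suc q" using pL[of "q - c"] pL[of "Suc q"] q
      by (simp add: less_imp_diff_less)
  next
    fix l assume l: "l < q" "0 < c \<longrightarrow> q - c < l"
    then have "a \<le> l" by (auto simp: a_def)
    then show "ys ! Suc q \<le> ys ! l"
      using l q n[of l] n[of "Suc q"] pL[of l] pL[of "Suc q"] L0 by (simp split: if_split) linarith
  qed
  from code_swap[OF d _ asc' this] q have "code (swap ys (Suc q)) = v"
    by (simp add: len c1 c2 v)
  with d c1 c2 q asc' len show ?thesis by (intro that[of ys q]) auto
qed

section \<open>The swap relation in terms of codes\<close>

lemma rev_swap:
  assumes "Suc q < length ys"
  shows "rev (swap ys (Suc q)) = swap (rev ys) (length ys - Suc q)"
proof (rule nth_equalityI)
  fix k assume k: "k < length (rev (swap ys (Suc q)))"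
  have [simp]: "rev ys ! 0 = ys ! (length ys - Suc 0)" using assms by (intro rev_nth) linarith
  have "length ys - Suc q = Suc (length ys - Suc (Suc q))" using assms by auto
  then have "swap (rev ys) (length ys - Suc q) ! k = swap (rev ys) (Suc (length ys - Suc (Suc q))) ! k"
    by simp
  also have "\<dots> = rev (swap ys (Suc q)) ! k"
    using assms k by (subst nth_swap) (auto simp: nth_swap rev_nth Suc_diff_Suc)
  finally show "rev (swap ys (Suc q)) ! k = swap (rev ys) (length ys - Suc q) ! k" ..
qed simp

text \<open>Which of the two neighbour conditions applies depends on the order of the exchanged pair
  in the representative of \<open>p\<close>: reversal turns a descent into an ascent and, by
  \<open>ct_eq_rev\<close>, preserves equality of trees. The converse takes its representatives from
  \<open>asc_nbr_realise\<close>.\<close>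

theorem ct_swap_eq_code:
  assumes x: "distinct x" and p: "distinct p"
  shows "x \<approx>CTswap p \<longleftrightarrow> code x = code p \<or> asc_nbr (code p) (code x) \<or>
    code (rev x) = code (rev p) \<or> asc_nbr (code (rev p)) (code (rev x))"
proof -
  have same: "code (rev x) = code (rev p) \<longleftrightarrow> x \<approx>CT p" "code x = code p \<longleftrightarrow> x \<approx>CT p"
    using ct_eq_rev[OF x p] ct_eq_code[OF x p] ct_eq_code[of "rev x" "rev p"] x p by auto
  have "asc_nbr (code p) (code x) \<or> asc_nbr (code (rev p)) (code (rev x))"
    if h: "distinct x'" "distinct y'" "i \<in> {1..length x - 1}" "x' \<approx>CT x" "y' \<approx>CT p" "x' = swap y' i"
    for x' y' i
  proof -
    have cx: "code x' = code x" and cy: "code y' = code p"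
      using ct_eq_code h x p by auto
    have cxr: "code (rev x') = code (rev x)" and cyr: "code (rev y') = code (rev p)"
      using ct_eq_code[of "rev x'" "rev x"] ct_eq_code[of "rev y'" "rev p"] ct_eq_rev h x p by auto
    have len: "length x' = length x" "length y' = length x"
      using ct_eq_length[OF h(4)] h(6) by auto
    obtain q where q: "i = Suc q" "Suc q < length y'" using h(3) len by (cases i) auto
    have "y' ! q \<noteq> y' ! Suc q" using h(2) q by (simp add: nth_eq_iff_index_eq)
    then consider "y' ! q < y' ! Suc q" | "y' ! Suc q < y' ! q" by linarith
    then show ?thesis
    proof cases
      case 1
      from asc_nbr_swap[OF h(2) q(2) 1] cx cy q h(6) show ?thesis by simp
    next
      case 2
      \<comment> \<open>The left position of the pair after reversal, counted from 0.\<close>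
      let ?r = "length y' - Suc (Suc q)"
      have "asc_nbr (code (rev y')) (code (swap (rev y') (Suc ?r)))"
        using h(2) q 2 by (intro asc_nbr_swap) (auto simp: rev_nth Suc_diff_Suc)
      moreover have "swap (rev y') (Suc ?r) = rev x'"
        using rev_swap[OF q(2)] q h(6) by (simp add: Suc_diff_Suc)
      ultimately show ?thesis using cxr cyr by simp
    qed
  qed
  moreover have "x \<approx>CTswap p" if nb: "asc_nbr (code p) (code x)"
  proof -
    obtain ys q where ys: "distinct ys" "code ys = code p" "Suc q < length ys"
      "ys ! q < ys ! Suc q" "code x = code (swap ys (Suc q))"
      by (rule asc_nbr_realise[OF p nb])
    have "distinct (swap ys (Suc q))" using ys by (intro distinct_swap) auto
    moreover from this have "swap ys (Suc q) \<approx>CT x" "ys \<approx>CT p"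
      using ys x p ct_eq_code by auto
    moreover from this have "Suc q \<in> {1..length x - 1}" using ct_eq_length ys by fastforce
    ultimately show ?thesis unfolding ct_swap_eq_def using ys by blast
  qed
  moreover have "x \<approx>CTswap p" if nb: "asc_nbr (code (rev p)) (code (rev x))"
  proof -
    obtain ys q where ys: "distinct ys" "code ys = code (rev p)" "Suc q < length ys"
      "ys ! q < ys ! Suc q" "code (rev x) = code (swap ys (Suc q))"
      by (rule asc_nbr_realise[OF _ nb]) (use p in auto)
    have "distinct (swap ys (Suc q))" using ys by (intro distinct_swap) auto
    moreover from this have "swap ys (Suc q) \<approx>CT rev x" "ys \<approx>CT rev p"
      using ys x p ct_eq_code[of _ "rev x"] ct_eq_code[of _ "rev p"] by auto
    moreover from this have l: "length ys = length x" "length (swap ys (Suc q)) = length x"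
      using ct_eq_length by fastforce+
    ultimately have "distinct (rev (swap ys (Suc q)))" "rev (swap ys (Suc q)) \<approx>CT x"
      "distinct (rev ys)" "rev ys \<approx>CT p"
      using ct_eq_rev[of "swap ys (Suc q)" "rev x"] ct_eq_rev[of ys "rev p"] ys x p by auto
    moreover have "length ys - Suc q \<in> {1..length x - 1}" using ys l by auto
    ultimately show ?thesis unfolding ct_swap_eq_def using rev_swap[OF ys(3)] by metis
  qed
  ultimately show ?thesis unfolding same by (auto simp: ct_swap_eq_def)
qed

section \<open>A multiple pattern matching automaton for codes\<close>

definition cut :: "nat \<Rightarrow> nat \<Rightarrow> nat" where
  "cut c k = (if c \<le> k then c else 0)"

text \<open>If \<open>T\<close> lists the parent distances of a sequence, this is the code of its
  factor of length \<open>d\<close> at \<open>j\<close>, by \<open>pd_drop\<close>. Applied to a row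
  of the trie it yields the codes of factors of the sequences with that code.\<close>

definition win :: "(nat \<Rightarrow> nat) \<Rightarrow> nat \<Rightarrow> nat \<Rightarrow> nat list" where
  "win T j d = map (\<lambda>k. cut (T (j + k)) k) [0..<d]"

lemma length_win [simp]: "length (win T j d) = d"
  by (simp add: win_def)

lemma nth_win [simp]: "k < d \<Longrightarrow> win T j d ! k = cut (T (j + k)) k"
  by (simp add: win_def)

lemma win_0 [simp]: "win T j 0 = []"
  by (simp add: win_def)

lemma win_Suc: "win T j (Suc d) = win T j d @ [cut (T (j + d)) d]"
  by (simp add: win_def)

text \<open>Truncation for a longer window does not disturb truncation for a shorter one inside it.
  This is why links computed on rows are valid for the text.\<close>

lemma win_win: "a + e \<le> d \<Longrightarrow> win ((!) (win T j d)) a e = win T (j + a) e"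
  by (rule nth_equalityI) (auto simp: cut_def add.assoc)

lemma win_cong: "(\<And>k. k < d \<Longrightarrow> cut (T (i + k)) k = cut (U (j + k)) k) \<Longrightarrow> win T i d = win U j d"
  by (rule nth_equalityI) auto

text \<open>Row 0 is the main path of the trie; row \<open>s > 0\<close> leaves it at depth \<open>b s\<close>.
  The trie node reached by the first \<open>d\<close> symbols of row \<open>s\<close> has the number \<open>s * (m + 1) + d\<close>
  provided that \<open>s = 0\<close> or \<open>b s < d\<close>; the other numbers name no node.\<close>

locale comb =
  fixes ws :: "nat list list" and b :: "nat \<Rightarrow> nat" and br :: "nat \<Rightarrow> nat \<Rightarrow> nat" and m :: nat
  assumes m_pos: "0 < m"
    and ws_nonempty: "ws \<noteq> []"
    and length_row: "s < length ws \<Longrightarrow> length (ws ! s) = m"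
    and row_0: "s < length ws \<Longrightarrow> ws ! s ! 0 = 0"
    and b_less: "0 < s \<Longrightarrow> s < length ws \<Longrightarrow> b s < m"
    and row_below: "0 < s \<Longrightarrow> s < length ws \<Longrightarrow> k < b s \<Longrightarrow> ws ! s ! k = ws ! 0 ! k"
    and row_branch: "0 < s \<Longrightarrow> s < length ws \<Longrightarrow> ws ! s ! b s \<noteq> ws ! 0 ! b s"
    and br_complete: "0 < s \<Longrightarrow> s < length ws \<Longrightarrow> br (b s) (ws ! s ! b s) = s * Suc m + Suc (b s)"
    and br_sound: "br d c \<noteq> 0 \<Longrightarrow>
      \<exists>s. 0 < s \<and> s < length ws \<and> b s = d \<and> ws ! s ! d = c"
begin

definition depth :: "nat \<Rightarrow> nat" where
  "depth v = v mod Suc m"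

definition row :: "nat \<Rightarrow> nat" where
  "row v = v div Suc m"

definition good :: "nat \<Rightarrow> bool" where
  "good v \<longleftrightarrow> row v < length ws \<and> (row v = 0 \<or> b (row v) < depth v)"

definition word :: "nat \<Rightarrow> nat list" where
  "word v = take (depth v) (ws ! row v)"

definition prefixes :: "nat list set" where
  "prefixes = {take d w | d w. w \<in> set ws}"

text \<open>A child continues the row of its parent or, from a node of the main path only, opens
  another row; \<open>v \<le> m\<close> says that \<open>v\<close> lies on row 0. The value 0 of
  \<open>br\<close> can mean a missing child because the root is nobody's child.\<close>

definition lookup :: "nat \<Rightarrow> nat \<Rightarrow> nat option" where
  "lookup v c =
     (if depth v < m \<and> ws ! row v ! depth v = c then Some (Suc v)
      else if v \<le> m \<and> br (depth v) c \<noteq> 0 then Some (br (depth v) c)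
      else None)"

lemma depth_le: "depth v \<le> m"
  by (simp add: depth_def less_Suc_eq_le[symmetric])

lemma node_simps [simp]:
  "d \<le> m \<Longrightarrow> depth (s * Suc m + d) = d" "d \<le> m \<Longrightarrow> row (s * Suc m + d) = s"
  by (simp_all add: depth_def row_def del: mult_Suc_right)

lemma node_eq: "row v * Suc m + depth v = v"
  by (simp add: depth_def row_def del: mult_Suc_right)

lemma node_less: "good v \<Longrightarrow> v < length ws * Suc m"
  by (metis good_def row_def less_mult_imp_div_less div_less_iff_less_mult zero_less_Suc)

lemma depth_Suc: "depth v < m \<Longrightarrow> depth (Suc v) = Suc (depth v)"
  by (simp add: depth_def mod_Suc)

lemma row_Suc: "depth v < m \<Longrightarrow> row (Suc v) = row v"
  by (simp add: depth_def row_def div_Suc mod_Suc)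

lemma row_eq_0: "row v = 0 \<longleftrightarrow> v \<le> m"
  by (auto simp: row_def div_eq_0_iff)

lemma length_word: "good v \<Longrightarrow> length (word v) = depth v"
  using depth_le length_row by (simp add: word_def good_def)

lemma root [simp]: "good 0" "depth 0 = 0" "row 0 = 0" "word 0 = []"
  using ws_nonempty by (auto simp: good_def word_def depth_def row_def)

lemma prefixes_iff: "u \<in> prefixes \<longleftrightarrow> (\<exists>s<length ws. \<exists>d\<le>m. u = take d (ws ! s))"
proof
  assume "u \<in> prefixes"
  then obtain d s where "u = take d (ws ! s)" "s < length ws"
    by (auto simp: prefixes_def in_set_conv_nth)
  then have "u = take (min d m) (ws ! s)" using length_row by (simp add: min_def)
  with \<open>s < length ws\<close> show "\<exists>s<length ws. \<exists>d\<le>m. u = take d (ws ! s)"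
    by (intro exI[of _ s] conjI exI[of _ "min d m"]) auto
qed (use nth_mem in \<open>force simp: prefixes_def\<close>)

lemma prefixes_snocD: "u @ [c] \<in> prefixes \<Longrightarrow> u \<in> prefixes"
proof -
  assume "u @ [c] \<in> prefixes"
  then obtain d w where "u @ [c] = take d w" "w \<in> set ws" by (auto simp: prefixes_def)
  then have "u = take (min (length u) d) w" by (metis append_eq_conv_conj take_take)
  with \<open>w \<in> set ws\<close> show ?thesis by (auto simp: prefixes_def)
qed

lemma lookup_Some:
  assumes "good v" "lookup v c = Some v'"
  shows "good v' \<and> depth v' = Suc (depth v) \<and> word v' = word v @ [c]"
proof (cases "depth v < m \<and> ws ! row v ! depth v = c")
  case True
  with assms have v': "v' = Suc v" by (simp add: lookup_def)
  with True assms length_row[of "row v"] show ?thesis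
    by (auto simp: depth_Suc row_Suc good_def word_def take_Suc_conv_app_nth)
next
  case False
  then have v': "v \<le> m" "br (depth v) c \<noteq> 0" "v' = br (depth v) c"
    using assms by (auto simp: lookup_def split: if_splits)
  then obtain s where s: "0 < s" "s < length ws" "b s = depth v" "ws ! s ! depth v = c"
    using br_sound by blast
  then have e: "v' = s * Suc m + Suc (depth v)" using br_complete[of s] v' by simp
  have less: "depth v < m" using b_less s by metis
  then have d: "depth v' = Suc (depth v)" "row v' = s" 
    using node_simps[of "Suc (depth v)" s] by (simp_all add: e del: mult_Suc_right)
  have "take (depth v) (ws ! s) = take (depth v) (ws ! 0)"
  proof (rule nth_take_lemma)
    show "depth v \<le> length (ws ! s)" "depth v \<le> length (ws ! 0)"
      using less s length_row[of s] length_row[of 0] ws_nonempty by auto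
  qed (use row_below[OF s(1,2)] s in auto)
  then show ?thesis
    using d s less v' length_row[of s] row_eq_0[of v]
    by (auto simp: good_def word_def take_Suc_conv_app_nth)
qed

text \<open>Two rows that leave the main path at the same depth with the same symbol coincide, since
  \<open>br\<close> gives both the same node number. Hence a node off the main path has no child
  except the one on its own row.\<close>

lemma lookup_complete:
  assumes "good v" "word v @ [c] \<in> prefixes"
  shows "lookup v c \<noteq> None"
proof -
  obtain s where s: "s < length ws" "word v @ [c] = take (Suc (depth v)) (ws ! s)"
      "depth v < m"
  proof -
    obtain s d where *: "s < length ws" "d \<le> m" "word v @ [c] = take d (ws ! s)"
      using assms(2) by (auto simp: prefixes_iff)
    then have "length (word v @ [c]) = d" using length_row by simp
    then have "d = Suc (depth v)" using length_word assms(1) by simp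
    with * that show thesis by auto
  qed
  have w: "take (depth v) (ws ! s) = take (depth v) (ws ! row v)" "ws ! s ! depth v = c"
    using s length_row[of s] by (auto simp: word_def take_Suc_conv_app_nth)
  have eq: "ws ! s ! k = ws ! row v ! k" if "k < depth v" for k
    using w(1) that by (metis nth_take)
  show ?thesis
  proof (cases "ws ! row v ! depth v = c")
    case True
    then show ?thesis using s by (simp add: lookup_def)
  next
    case False
    have rv: "row v = 0"
    proof (rule ccontr)
      assume r: "row v \<noteq> 0"
      then have r': "0 < row v" "row v < length ws" "b (row v) < depth v"
        using assms(1) by (auto simp: good_def)
      \<comment> \<open>Row \<open>s\<close> agrees with row \<open>row v\<close> up to the depth of
        \<open>v\<close>, hence also where the latter leaves the main path; so neither can leave it
        before the other.\<close>
      have ne: "ws ! s ! b (row v) \<noteq> ws ! 0 ! b (row v)"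
        using eq[OF r'(3)] row_branch[OF r'(1,2)] by simp
      then have "s > 0" by (cases s) auto
      have "b s \<le> b (row v)" using ne row_below[OF \<open>s > 0\<close> s(1)] by (meson not_less)
      moreover have "b (row v) \<le> b s"
      proof (rule ccontr)
        assume "\<not> ?thesis"
        then have "ws ! row v ! b s = ws ! 0 ! b s" using row_below[OF r'(1,2)] by simp
        moreover have "ws ! s ! b s = ws ! row v ! b s" using eq[of "b s"] \<open>b s \<le> b (row v)\<close> r' by simp
        ultimately show False using row_branch[OF \<open>s > 0\<close> s(1)] by simp
      qed
      ultimately have "b s = b (row v)" by simp
      then have "s * Suc m + Suc (b s) = row v * Suc m + Suc (b s)"
        using br_complete[OF r'(1,2)] br_complete[OF \<open>s > 0\<close> s(1)] eq[OF r'(3)] by simp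
      then have "s = row v" by (simp del: mult_Suc_right)
      with False w show False by simp
    qed
    then have "s > 0" using False w by (cases s) auto
    have "b s = depth v"
    proof (rule linorder_cases[of "b s" "depth v"])
      assume "b s < depth v"
      then show ?thesis using eq[of "b s"] rv row_branch[OF \<open>s > 0\<close> s(1)] by simp
    next
      assume "depth v < b s"
      then show ?thesis using row_below[OF \<open>s > 0\<close> s(1), of "depth v"] w False rv by simp
    qed simp
    then have "br (depth v) c = s * Suc m + Suc (depth v)"
      using br_complete[OF \<open>s > 0\<close> s(1)] w by simp
    then show ?thesis using rv by (simp add: lookup_def row_eq_0)
  qed
qed

section \<open>Longest matching windows and failure links\<close>

lemma lookup_root: "lookup 0 0 \<noteq> None"
  using m_pos row_0[of 0] ws_nonempty by (simp add: lookup_def)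

text \<open>The invariant of the automaton. Only windows starting at \<open>lo\<close> or later
  compete: \<open>lo = 0\<close> is the scan of a text, while \<open>lo = 1\<close> excludes the
  whole prefix of a row and thereby describes failure links.\<close>

definition longest :: "nat \<Rightarrow> (nat \<Rightarrow> nat) \<Rightarrow> nat \<Rightarrow> nat \<Rightarrow> bool" where
  "longest lo T e v \<longleftrightarrow> good v \<and> depth v + lo \<le> e \<and> word v = win T (e - depth v) (depth v) \<and>
     (\<forall>l. depth v < l \<and> l + lo \<le> e \<longrightarrow> win T (e - l) l \<notin> prefixes)"

text \<open>The weaker invariant while failure links are followed. Longer windows are ruled out only
  together with the symbol at \<open>e\<close>, which is all that the next transition needs.\<close>

definition candidate :: "nat \<Rightarrow> (nat \<Rightarrow> nat) \<Rightarrow> nat \<Rightarrow> nat \<Rightarrow> bool" where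
  "candidate lo T e v \<longleftrightarrow> good v \<and> depth v + lo \<le> e \<and> word v = win T (e - depth v) (depth v) \<and>
     (\<forall>l. depth v < l \<and> l + lo \<le> e \<longrightarrow> win T (e - l) (Suc l) \<notin> prefixes)"

lemma longest_init: "longest lo T lo 0"
  by (simp add: longest_def)

lemma longest_candidate: "longest lo T e v \<Longrightarrow> candidate lo T e v"
  unfolding longest_def candidate_def using prefixes_snocD by (auto simp: win_Suc)

lemma candidate_step:
  assumes v: "candidate lo T e v" and u: "lookup v (cut (T e) (depth v)) = Some u"
  shows "longest lo T (Suc e) u" "depth u = Suc (depth v)"
proof -
  have g: "good v" "depth v + lo \<le> e" "word v = win T (e - depth v) (depth v)"
    using v by (auto simp: candidate_def)
  from lookup_Some[OF g(1) u] have u': "good u" "depth u = Suc (depth v)"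
    "word u = word v @ [cut (T e) (depth v)]" by auto
  show "depth u = Suc (depth v)" by fact
  have "win T (Suc e - l) l \<notin> prefixes" if "depth u < l" "l + lo \<le> Suc e" for l
    using that v u'(2) by (cases l) (auto simp: candidate_def)
  then show "longest lo T (Suc e) u" using u' g by (simp add: longest_def win_Suc)
qed

text \<open>At depth 0 every distance is truncated to 0, and the root has a child for 0 because
  every row starts with it. The search for a transition therefore succeeds at the root at the
  latest.\<close>

lemma candidate_lookup_None:
  assumes v: "candidate lo T e v" and "lookup v (cut (T e) (depth v)) = None"
  shows "0 < depth v"
proof (rule ccontr)
  assume z: "\<not> ?thesis"
  have g: "good v" using v by (auto simp: candidate_def)
  have "row v = 0" using g z by (auto simp: good_def)
  with z node_eq[of v] have "v = 0" by simp
  with assms lookup_root show False by (simp add: cut_def split: if_splits)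
qed

text \<open>Windows with lengths between the two depths are also windows of the row of
  \<open>v\<close>, where the failure link excludes them. The window of length
  \<open>depth v\<close> is excluded by the failed lookup, and the longer ones were excluded
  before.\<close>

lemma candidate_fail:
  assumes v: "candidate lo T e v" and n: "lookup v (cut (T e) (depth v)) = None"
    and f: "longest 1 ((!) (ws ! row v)) (depth v) f"
  shows "candidate lo T e f" "depth f < depth v"
proof -
  have g: "good v" "depth v + lo \<le> e" "word v = win T (e - depth v) (depth v)"
    "\<And>l. depth v < l \<Longrightarrow> l + lo \<le> e \<Longrightarrow> win T (e - l) (Suc l) \<notin> prefixes"
    using v by (auto simp: candidate_def)
  have fl: "good f" "depth f + 1 \<le> depth v" "word f = win ((!) (ws ! row v)) (depth v - depth f) (depth f)"
    "\<And>l. depth f < l \<Longrightarrow> l + 1 \<le> depth v \<Longrightarrow> win ((!) (ws ! row v)) (depth v - l) l \<notin> prefixes"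
    using f by (auto simp: longest_def)
  show "depth f < depth v" using fl by simp
  have w: "win ((!) (ws ! row v)) (depth v - l) l = win T (e - l) l" if "l \<le> depth v" for l
  proof -
    have "win ((!) (ws ! row v)) (depth v - l) l = win ((!) (word v)) (depth v - l) l"
      using that by (intro win_cong) (simp add: word_def)
    also have "\<dots> = win T (e - depth v + (depth v - l)) l"
      unfolding g(3) using that by (intro win_win) simp
    finally show ?thesis using that g(2) by simp
  qed
  have "win T (e - l) (Suc l) \<notin> prefixes" if l: "depth f < l" "l + lo \<le> e" for l
  proof (rule linorder_cases[of l "depth v"])
    assume "l < depth v"
    then have "win T (e - l) l \<notin> prefixes" using fl(4)[of l] l w[of l] by simp
    then show ?thesis using prefixes_snocD by (auto simp: win_Suc)
  next
    assume "l = depth v"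
    then have "win T (e - l) (Suc l) = word v @ [cut (T e) (depth v)]" using g by (simp add: win_Suc)
    then show ?thesis using lookup_complete[OF g(1)] n by metis
  next
    assume "depth v < l"
    then show ?thesis using g(4) l by simp
  qed
  then show "candidate lo T e f" using fl g w[of "depth f"] by (simp add: candidate_def)
qed

lemma longest_full:
  assumes "longest 0 T e v"
  shows "depth v = m \<longleftrightarrow> m \<le> e \<and> win T (e - m) m \<in> set ws"
proof
  assume d: "depth v = m"
  then have "win T (e - m) m = take m (ws ! row v)" "m \<le> e" "row v < length ws"
    using assms by (auto simp: longest_def word_def good_def)
  with length_row[of "row v"] show "m \<le> e \<and> win T (e - m) m \<in> set ws" by simp
next
  assume a: "m \<le> e \<and> win T (e - m) m \<in> set ws"
  then have "win T (e - m) m \<in> prefixes"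
    by (auto simp: prefixes_def intro!: exI[of _ m] exI[of _ "win T (e - m) m"])
  with assms a have "\<not> depth v < m" by (auto simp: longest_def)
  with depth_le[of v] show "depth v = m" by simp
qed

end

section \<open>A weakest precondition calculus with time budgets\<close>

text \<open>Success and a property of the value in a single predicate. With the rules below,
  evaluating an expression unfolds into its side conditions on addresses and word size.\<close>

definition ev :: "machine \<Rightarrow> 'r state \<Rightarrow> 'r exp \<Rightarrow> (int \<Rightarrow> bool) \<Rightarrow> bool" where
  "ev M s e P \<longleftrightarrow> (\<exists>v. eval M s e = Some v \<and> P v)"

definition tt :: "machine \<Rightarrow> 'r state \<Rightarrow> 'r bexp \<Rightarrow> (bool \<Rightarrow> bool) \<Rightarrow> bool" where
  "tt M s b P \<longleftrightarrow> (\<exists>v. test M s b = Some v \<and> P v)"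

lemma ev_simps [simp]:
  "ev M s (Const v) P \<longleftrightarrow> P v"
  "ev M s (Reg r) P \<longleftrightarrow> P (reg s r)"
  "ev M s (Cell e) P \<longleftrightarrow> ev M s e (\<lambda>a. 0 \<le> a \<and> a < int (cells M) \<and> P (mem s (nat a)))"
  "ev M s PatLen P \<longleftrightarrow> P (int (length (pat_in M)))"
  "ev M s TxtLen P \<longleftrightarrow> P (int (length (txt_in M)))"
  "ev M s (Pat e) P \<longleftrightarrow> ev M s e (\<lambda>a. 1 \<le> a \<and> a \<le> int (length (pat_in M)) \<and> P (pat_in M ! nat (a - 1)))"
  "ev M s (Txt e) P \<longleftrightarrow> ev M s e (\<lambda>a. 1 \<le> a \<and> a \<le> int (length (txt_in M)) \<and> P (txt_in M ! nat (a - 1)))"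
  "ev M s (Arith f d e) P \<longleftrightarrow>
     ev M s d (\<lambda>a. ev M s e (\<lambda>b. \<bar>arith f a b\<bar> \<le> word_max M \<and> P (arith f a b)))"
proof -
  show "ev M s (Cell e) P \<longleftrightarrow> ev M s e (\<lambda>a. 0 \<le> a \<and> a < int (cells M) \<and> P (mem s (nat a)))"
    by (cases "eval M s e"; simp add: ev_def address_def; blast)
  show "ev M s (Pat e) P \<longleftrightarrow> ev M s e (\<lambda>a. 1 \<le> a \<and> a \<le> int (length (pat_in M)) \<and> P (pat_in M ! nat (a - 1)))"
    by (cases "eval M s e"; simp add: ev_def read_input_def; blast)
  show "ev M s (Txt e) P \<longleftrightarrow> ev M s e (\<lambda>a. 1 \<le> a \<and> a \<le> int (length (txt_in M)) \<and> P (txt_in M ! nat (a - 1)))"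
    by (cases "eval M s e"; simp add: ev_def read_input_def; blast)
  show "ev M s (Arith f d e) P \<longleftrightarrow>
     ev M s d (\<lambda>a. ev M s e (\<lambda>b. \<bar>arith f a b\<bar> \<le> word_max M \<and> P (arith f a b)))"
    by (cases "eval M s d"; cases "eval M s e") (simp_all add: ev_def word_def)
qed (simp_all add: ev_def)

lemma tt_simps [simp]:
  "tt M s (Less d e) P \<longleftrightarrow> ev M s d (\<lambda>a. ev M s e (\<lambda>b. P (a < b)))"
  "tt M s (Equal d e) P \<longleftrightarrow> ev M s d (\<lambda>a. ev M s e (\<lambda>b. P (a = b)))"
  "tt M s (Not c) P \<longleftrightarrow> tt M s c (\<lambda>v. P (\<not> v))"
  "tt M s (And c c2) P \<longleftrightarrow> tt M s c (\<lambda>v. if v then tt M s c2 P else P False)"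
proof -
  show "tt M s (Less d e) P \<longleftrightarrow> ev M s d (\<lambda>a. ev M s e (\<lambda>b. P (a < b)))"
    "tt M s (Equal d e) P \<longleftrightarrow> ev M s d (\<lambda>a. ev M s e (\<lambda>b. P (a = b)))"
    by (cases "eval M s d"; cases "eval M s e"; simp add: ev_def tt_def)+
  show "tt M s (Not c) P \<longleftrightarrow> tt M s c (\<lambda>v. P (\<not> v))"
    by (cases "test M s c") (simp_all add: tt_def)
  show "tt M s (And c c2) P \<longleftrightarrow> tt M s c (\<lambda>v. if v then tt M s c2 P else P False)"
  proof (cases "test M s c")
    case (Some v)
    then show ?thesis by (cases v) (simp_all add: tt_def ex_bool_eq)
  qed (simp add: tt_def)
qed

text \<open>\<open>F\<close> is a time budget that the run consumes; it is a ghost variable of the assertions.\<close>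

definition wp :: "machine \<Rightarrow> 'r com \<Rightarrow> ('r state \<Rightarrow> int \<Rightarrow> bool) \<Rightarrow> 'r state \<Rightarrow> int \<Rightarrow> bool" where
  "wp M c Q s F \<longleftrightarrow> (\<exists>k s'. exec M c s k s' \<and> Q s' (F - int k))"

lemma wpI: "exec M c s k s' \<Longrightarrow> Q s' (F - int k) \<Longrightarrow> wp M c Q s F"
  unfolding wp_def by (rule exI, rule exI, rule conjI)

lemma wp_Skip [simp]: "wp M Skip Q s F \<longleftrightarrow> Q s (F - 1)"
  by (auto simp: wp_def elim: exec_SkipE intro!: exec.Skip exI)

lemma wp_Assign [simp]:
  "wp M (Assign r e) Q s F \<longleftrightarrow>
     ev M s e (\<lambda>v. Q (s\<lparr>reg := (reg s)(r := v)\<rparr>) (F - 1 - int (ops e)))"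
proof
  assume "wp M (Assign r e) Q s F"
  then show "ev M s e (\<lambda>v. Q (s\<lparr>reg := (reg s)(r := v)\<rparr>) (F - 1 - int (ops e)))"
    by (auto simp: wp_def ev_def algebra_simps elim!: exec_AssignE)
next
  assume "ev M s e (\<lambda>v. Q (s\<lparr>reg := (reg s)(r := v)\<rparr>) (F - 1 - int (ops e)))"
  then obtain v where "eval M s e = Some v"
    "Q (s\<lparr>reg := (reg s)(r := v)\<rparr>) (F - int (1 + ops e))"
    by (auto simp: ev_def algebra_simps)
  then show "wp M (Assign r e) Q s F" 
    by (rule wpI[OF exec.Assign])
qed

lemma wp_Store [simp]:
  "wp M (Store d e) Q s F \<longleftrightarrow>
     ev M s d (\<lambda>a. 0 \<le> a \<and> a < int (cells M) \<and>
       ev M s e (\<lambda>v. Q (s\<lparr>mem := (mem s)(nat a := v)\<rparr>) (F - 1 - int (ops d) - int (ops e))))"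
proof
  assume "wp M (Store d e) Q s F"
  then show "ev M s d (\<lambda>a. 0 \<le> a \<and> a < int (cells M) \<and>
       ev M s e (\<lambda>v. Q (s\<lparr>mem := (mem s)(nat a := v)\<rparr>) (F - 1 - int (ops d) - int (ops e))))"
    by (auto simp: wp_def ev_def address_def algebra_simps elim!: exec_StoreE split: if_splits)
next
  assume "ev M s d (\<lambda>a. 0 \<le> a \<and> a < int (cells M) \<and>
       ev M s e (\<lambda>v. Q (s\<lparr>mem := (mem s)(nat a := v)\<rparr>) (F - 1 - int (ops d) - int (ops e))))"
  then obtain a v where "eval M s d = Some a" "0 \<le> a" "a < int (cells M)" "eval M s e = Some v"
    and Q: "Q (s\<lparr>mem := (mem s)(nat a := v)\<rparr>) (F - 1 - int (ops d) - int (ops e))"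
    by (auto simp: ev_def)
  then have "exec M (Store d e) s (1 + ops d + ops e) (s\<lparr>mem := (mem s)(nat a := v)\<rparr>)"
    by (intro exec.Store) (auto simp: address_def)
  then show "wp M (Store d e) Q s F" by (rule wpI) (use Q in \<open>simp add: algebra_simps\<close>)
qed

lemma wp_Output [simp]:
  "wp M (Output e) Q s F \<longleftrightarrow> ev M s e (\<lambda>v. Q (s\<lparr>outp := outp s @ [v]\<rparr>) (F - 1 - int (ops e)))"
proof
  assume "wp M (Output e) Q s F"
  then show "ev M s e (\<lambda>v. Q (s\<lparr>outp := outp s @ [v]\<rparr>) (F - 1 - int (ops e)))"
    by (auto simp: wp_def ev_def algebra_simps elim!: exec_OutputE)
next
  assume "ev M s e (\<lambda>v. Q (s\<lparr>outp := outp s @ [v]\<rparr>) (F - 1 - int (ops e)))"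
  then obtain v where "eval M s e = Some v"
    "Q (s\<lparr>outp := outp s @ [v]\<rparr>) (F - int (1 + ops e))"
    by (auto simp: ev_def algebra_simps)
  then show "wp M (Output e) Q s F" 
    by (rule wpI[OF exec.Output])
qed

lemma wp_Seq [simp]: "wp M (Seq c d) Q s F \<longleftrightarrow> wp M c (wp M d Q) s F"
proof
  assume "wp M c (wp M d Q) s F"
  then obtain k s' l s'' where "exec M c s k s'" "exec M d s' l s''" "Q s'' (F - int k - int l)"
    unfolding wp_def by blast
  then show "wp M (Seq c d) Q s F"
    by (intro wpI[OF exec.Seq]) (simp_all add: algebra_simps)
next
  assume "wp M (Seq c d) Q s F"
  then obtain k s' l s'' where "exec M c s k s'" "exec M d s' l s''" "Q s'' (F - int (k + l))"
    unfolding wp_def by (blast elim: exec_SeqE)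
  then show "wp M c (wp M d Q) s F"
    by (intro wpI[of M c s k s'] wpI[of M d s' l s'']) (simp_all add: algebra_simps)
qed

lemma wp_If [simp]:
  "wp M (If b c d) Q s F \<longleftrightarrow>
     tt M s b (\<lambda>v. (v \<longrightarrow> wp M c Q s (F - 1 - int (test_ops b))) \<and>
                   (\<not> v \<longrightarrow> wp M d Q s (F - 1 - int (test_ops b))))"
  (is "?L \<longleftrightarrow> ?R")
proof -
  have R: "?R \<longleftrightarrow> test M s b = Some True \<and> wp M c Q s (F - 1 - int (test_ops b)) \<or>
      test M s b = Some False \<and> wp M d Q s (F - 1 - int (test_ops b))"
    by (simp add: tt_def ex_bool_eq disj_commute)
  have e: "F - int (1 + test_ops b + k) = F - 1 - int (test_ops b) - int k" for k by simp
  show ?thesis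
  proof
    assume ?L
    then obtain n s' where n: "exec M (If b c d) s n s'" and Q: "Q s' (F - int n)"
      unfolding wp_def by blast
    from n show ?R
    proof (rule exec_IfE)
      fix k assume *: "n = Suc (test_ops b + k)" "test M s b = Some True" "exec M c s k s'"
      from Q have "Q s' (F - 1 - int (test_ops b) - int k)" by (simp add: *(1) algebra_simps)
      with * show ?R unfolding R by (simp add: wpI)
    next
      fix k assume *: "n = Suc (test_ops b + k)" "test M s b = Some False" "exec M d s k s'"
      from Q have "Q s' (F - 1 - int (test_ops b) - int k)" by (simp add: *(1) algebra_simps)
      with * show ?R unfolding R by (simp add: wpI)
    qed
  next
    assume ?R
    then show ?L unfolding R
    proof (elim disjE conjE)
      assume t: "test M s b = Some True" and "wp M c Q s (F - 1 - int (test_ops b))"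
      then obtain k s' where "exec M c s k s'" "Q s' (F - 1 - int (test_ops b) - int k)"
        unfolding wp_def by blast
      with t show ?L by (intro wpI[OF exec.IfTrue]) (simp_all only: e)
    next
      assume t: "test M s b = Some False" and "wp M d Q s (F - 1 - int (test_ops b))"
      then obtain k s' where "exec M d s k s'" "Q s' (F - 1 - int (test_ops b) - int k)"
        unfolding wp_def by blast
      with t show ?L by (intro wpI[OF exec.IfFalse]) (simp_all only: e)
    qed
  qed
qed

text \<open>The budget of an invariant is nonnegative and every iteration costs time, so no separate
  termination argument is needed.\<close>

lemma wp_While:
  assumes "I s F"
    and "\<And>s F. I s F \<Longrightarrow> 0 \<le> F \<and>
      tt M s b (\<lambda>v. (v \<longrightarrow> wp M c I s (F - 1 - int (test_ops b))) \<and>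
                    (\<not> v \<longrightarrow> Q s (F - 1 - int (test_ops b))))"
  shows "wp M (While b c) Q s F"
  using assms(1)
proof (induction "nat F" arbitrary: s F rule: less_induct)
  case less
  from assms(2)[OF less.prems] have F: "0 \<le> F"
    and "tt M s b (\<lambda>v. (v \<longrightarrow> wp M c I s (F - 1 - int (test_ops b))) \<and>
                    (\<not> v \<longrightarrow> Q s (F - 1 - int (test_ops b))))" by auto
  then obtain v where v: "test M s b = Some v"
    and t: "v \<Longrightarrow> wp M c I s (F - 1 - int (test_ops b))"
    and f: "\<not> v \<Longrightarrow> Q s (F - 1 - int (test_ops b))"
    by (auto simp: tt_def)
  show ?case
  proof (cases v)
    case False
    have "F - 1 - int (test_ops b) = F - int (1 + test_ops b)" by simp
    with f[OF False] exec.WhileFalse[of M s b c] v False show ?thesis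
      by (intro wpI[of M _ s "1 + test_ops b"]) simp_all
  next
    case True
    then obtain k s' where k: "exec M c s k s'" "I s' (F - 1 - int (test_ops b) - int k)"
      using t by (auto simp: wp_def)
    then have "wp M (While b c) Q s' (F - 1 - int (test_ops b) - int k)"
      using F assms(2)[OF k(2)] by (intro less.hyps) auto
    then obtain l s'' where l: "exec M (While b c) s' l s''"
        "Q s'' (F - 1 - int (test_ops b) - int k - int l)"
      by (auto simp: wp_def)
    have "F - 1 - int (test_ops b) - int k - int l = F - int (1 + test_ops b + k + l)" by simp
    with l exec.WhileTrue[of M s b c k s' l s''] v True k show ?thesis
      by (intro wpI[of M _ s "1 + test_ops b + k + l"]) simp_all
  qed
qed

section \<open>Program notation, stack heights and register names\<close>

abbreviation add_exp :: "'r exp \<Rightarrow> 'r exp \<Rightarrow> 'r exp" (infixl "\<oplus>" 65) where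
  "a \<oplus> b \<equiv> Arith Add a b"
abbreviation sub_exp :: "'r exp \<Rightarrow> 'r exp \<Rightarrow> 'r exp" (infixl "\<ominus>" 65) where
  "a \<ominus> b \<equiv> Arith Sub a b"
abbreviation mul_exp :: "'r exp \<Rightarrow> 'r exp \<Rightarrow> 'r exp" (infixl "\<otimes>" 70) where
  "a \<otimes> b \<equiv> Arith Mul a b"
abbreviation mod_exp :: "'r exp \<Rightarrow> 'r exp \<Rightarrow> 'r exp" (infixl "\<oslash>" 70) where
  "a \<oslash> b \<equiv> Arith Mod a b"
abbreviation seq_com :: "'r com \<Rightarrow> 'r com \<Rightarrow> 'r com" (infixr ";;" 60) where
  "c ;; d \<equiv> Seq c d"
abbreviation assign_com :: "'r \<Rightarrow> 'r exp \<Rightarrow> 'r com" (infix "::=" 61) where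
  "r ::= e \<equiv> Assign r e"

text \<open>The number of members of the chain that starts at \<open>k\<close> and follows the
  distances \<open>T\<close>: the height of the stack of nearest smaller entries once
  \<open>k\<close> has been pushed. The test \<open>k < T k\<close> makes the recursion terminate
  for arbitrary \<open>T\<close>.\<close>

function stk :: "(nat \<Rightarrow> nat) \<Rightarrow> nat \<Rightarrow> nat" where
  "stk T k = (if T k = 0 \<or> k < T k then 1 else Suc (stk T (k - T k)))"
  by pat_completeness auto
termination by (relation "measure snd") auto
declare stk.simps [simp del]

text \<open>The part of the stack not yet popped when the search from \<open>e\<close> has reached
  distance \<open>c\<close>; it pays for the remaining iterations.\<close>

definition stk_at :: "(nat \<Rightarrow> nat) \<Rightarrow> nat \<Rightarrow> nat \<Rightarrow> nat" where
  "stk_at T e c = (if c \<le> e then stk T (e - c) else 0)"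

text \<open>
  Registers: \<open>xN\<close> holds the row length \<open>m + 1\<close>; \<open>xW\<close>, \<open>xF\<close>, \<open>xT\<close> and \<open>xB\<close> hold the addresses
  of the rows of the trie, the failure links, the branching table and a circular buffer of text codes;
  \<open>xK\<close> holds the address of the next row relative to \<open>xW\<close>, \<open>xe\<close> the current position, \<open>xc\<close> a
  distance, \<open>xv\<close> the state of the automaton and \<open>xg\<close> a loop flag.
\<close>

abbreviation "xN \<equiv> 10 :: nat"
abbreviation "xW \<equiv> 11 :: nat"
abbreviation "xF \<equiv> 12 :: nat"
abbreviation "xT \<equiv> 13 :: nat"
abbreviation "xB \<equiv> 14 :: nat"
abbreviation "xK \<equiv> 15 :: nat"
abbreviation "xe \<equiv> 16 :: nat"
abbreviation "xc \<equiv> 17 :: nat"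
abbreviation "xd \<equiv> 18 :: nat"
abbreviation "xg \<equiv> 19 :: nat"
abbreviation "xx \<equiv> 20 :: nat"
abbreviation "xv \<equiv> 21 :: nat"
abbreviation "xi \<equiv> 22 :: nat"

section \<open>One transition of the automaton\<close>

definition frame :: "nat set \<Rightarrow> nat state \<Rightarrow> nat state \<Rightarrow> bool" where
  "frame R s s' \<longleftrightarrow> (\<forall>r. r \<notin> R \<longrightarrow> reg s' r = reg s r) \<and> mem s' = mem s \<and> outp s' = outp s"

lemma frame_upd: "r \<in> R \<Longrightarrow> frame R s (s'\<lparr>reg := f(r := x)\<rparr>) \<longleftrightarrow> frame R s (s'\<lparr>reg := f\<rparr>)"
proof -
  assume "r \<in> R"
  then have "q \<notin> R \<Longrightarrow> (f(r := x)) q = f q" for q by auto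
  then show ?thesis unfolding frame_def by simp
qed

text \<open>\<open>xg\<close> remains 1 as long as failure links are followed. At depth
  \<open>m\<close> a row cell holds -1, which equals no truncated distance, so after a full match
  the command falls through to the failure link.\<close>

definition step_com :: "nat com" where
  "step_com =
     xg ::= Const 1 ;;
     While (Equal (Reg xg) (Const 1))
       (xd ::= Reg xv \<oslash> Reg xN ;;
        If (Less (Reg xd) (Reg xc)) (xx ::= Const 0) (xx ::= Reg xc) ;;
        If (Equal (Cell (Reg xW \<oplus> Reg xv)) (Reg xx))
          (xv ::= Reg xv \<oplus> Const 1 ;; xg ::= Const 0)
          (If (Less (Reg xv) (Reg xN))
             (xx ::= Cell (Reg xT \<oplus> (Reg xd \<otimes> Reg xN \<oplus> Reg xx)))
             (xx ::= Const 0) ;;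
           If (Equal (Reg xx) (Const 0))
             (xv ::= Cell (Reg xF \<oplus> Reg xv))
             (xv ::= Reg xx ;; xg ::= Const 0)))"

locale tables = comb +
  fixes M :: machine and wa fa ta :: nat
  assumes rows_le: "length ws \<le> 2 * Suc m"
    and wa_cells: "wa + 2 * Suc m * Suc m \<le> cells M"
    and fa_cells: "fa + 2 * Suc m * Suc m \<le> cells M"
    and ta_cells: "ta + Suc m * Suc m \<le> cells M"
    and cells_word: "int (cells M) \<le> word_max M"
begin

definition stored :: "nat state \<Rightarrow> bool" where
  "stored s \<longleftrightarrow> reg s xN = int (Suc m) \<and> reg s xW = int wa \<and> reg s xF = int fa \<and> reg s xT = int ta \<and>
     (\<forall>v. good v \<longrightarrow> mem s (wa + v) = (if depth v < m then int (ws ! row v ! depth v) else -1)) \<and>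
     (\<forall>d\<le>m. \<forall>c\<le>m. mem s (ta + (d * Suc m + c)) = int (br d c))"

text \<open>Limited to depth \<open>D\<close> because the links are built level by level, by the
  same transition that consults them.\<close>

definition fails :: "nat state \<Rightarrow> nat \<Rightarrow> bool" where
  "fails s D \<longleftrightarrow> (\<forall>v. good v \<longrightarrow> 0 < depth v \<longrightarrow> depth v \<le> D \<longrightarrow>
     (\<exists>f. mem s (fa + v) = int f \<and> longest 1 ((!) (ws ! row v)) (depth v) f))"

lemma good_less: "good v \<Longrightarrow> v < 2 * Suc m * Suc m"
  using node_less[of v] rows_le mult_le_mono1[of "length ws" "2 * Suc m" "Suc m"] by linarith

lemma cut_le: "cut c d \<le> d"
  by (simp add: cut_def)

lemma tab_less: "d \<le> m \<Longrightarrow> c \<le> m \<Longrightarrow> d * Suc m + c < Suc m * Suc m"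
proof -
  assume "d \<le> m" "c \<le> m"
  then have "d * Suc m \<le> m * Suc m" by (intro mult_le_mono1)
  with \<open>c \<le> m\<close> show ?thesis by simp
qed

text \<open>Amortisation over the depth: every link followed lowers the depth and thus releases at
  least 30 units, while an iteration costs at most 25. The surplus of 90 pays for the successful
  iteration and for the level that it adds.\<close>

lemma step_com_wp:
  assumes st: "stored s" and fl: "fails s (depth v)"
    and v: "reg s xv = int v" "longest lo T e v" and c: "reg s xc = int (T e)"
    and F: "F \<ge> R + 30 * (int (depth v) + 3)" and R: "0 \<le> R"
    and Q: "\<And>s' F' u. frame {xd, xg, xx, xv} s s' \<Longrightarrow> reg s' xv = int u \<Longrightarrow>
      longest lo T (Suc e) u \<Longrightarrow> F' \<ge> R + 30 * int (depth u) \<Longrightarrow> Q s' F'"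
  shows "wp M step_com Q s F"
proof -
  define rest where "rest = If (Equal (Cell (Reg xW \<oplus> Reg xv)) (Reg xx))
          (xv ::= Reg xv \<oplus> Const 1 ;; xg ::= Const 0)
          (If (Less (Reg xv) (Reg xN))
             (xx ::= Cell (Reg xT \<oplus> (Reg xd \<otimes> Reg xN \<oplus> Reg xx)))
             (xx ::= Const 0) ;;
           If (Equal (Reg xx) (Const 0))
             (xv ::= Cell (Reg xF \<oplus> Reg xv))
             (xv ::= Reg xx ;; xg ::= Const 0))"
  define body where "body = xd ::= Reg xv \<oslash> Reg xN ;;
        If (Less (Reg xd) (Reg xc)) (xx ::= Const 0) (xx ::= Reg xc) ;; rest"
  define J where "J = (\<lambda>s'. frame {xd, xg, xx, xv} s s')"
  \<comment> \<open>The reserve of 60 units covers the last iteration and the level gained by it;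
    the 3 units kept afterwards cover the final loop test.\<close>
  define I where "I = (\<lambda>s' F'. J s' \<and> (\<exists>u. reg s' xv = int u \<and>
     (reg s' xg = 1 \<and> candidate lo T e u \<and> depth u \<le> depth v \<and> F' \<ge> R + 30 * (int (depth u) + 2) \<or>
      reg s' xg = 0 \<and> longest lo T (Suc e) u \<and> F' \<ge> R + 30 * int (depth u) + 3)))"
  have J_upd: "J (s'\<lparr>reg := f(r := x)\<rparr>) = J (s'\<lparr>reg := f\<rparr>)" if "r \<in> {xd, xg, xx, xv}" for s' r x f
    unfolding J_def using that by (rule frame_upd)
  have I1: "I s' G" if "J s'" "reg s' xv = int u" "reg s' xg = 1" "candidate lo T e u"
    "depth u \<le> depth v" "G \<ge> R + 30 * (int (depth u) + 2)" for s' u G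
    unfolding I_def by (rule conjI[OF that(1)], rule exI[of _ u]) (use that in simp)
  have I0: "I s' G" if "J s'" "reg s' xv = int u" "reg s' xg = 0" "longest lo T (Suc e) u"
    "G \<ge> R + 30 * int (depth u) + 3" for s' u G
    unfolding I_def by (rule conjI[OF that(1)], rule exI[of _ u]) (use that in simp)
  have wp_body: "wp M body I s' (F' - 2)"
    if a: "J s'" "reg s' xv = int u" "reg s' xg = 1" "candidate lo T e u" "depth u \<le> depth v"
      and F': "F' \<ge> R + 30 * (int (depth u) + 2)" for s' u F'
  proof -
    define N where "N = Suc m"
    have g: "good u" using a by (simp add: candidate_def)
    have fr: "reg s' xN = int (N)" "reg s' xW = int wa" "reg s' xF = int fa" "reg s' xT = int ta"
      "reg s' xc = int (T e)" "mem s' = mem s"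
      using a(1) st c by (simp_all add: J_def frame_def stored_def N_def)
    have wu: "mem s (wa + u) = (if depth u < m then int (ws ! row u ! depth u) else -1)"
      using st g by (simp add: stored_def)
    let ?c = "cut (T e) (depth u)"
    have md: "int u mod int (N) = int (depth u)" unfolding depth_def N_def by (simp only: of_nat_mod)
    have dm: "depth u \<le> m" by (rule depth_le)
    have cm: "?c \<le> m" using cut_le[of "T e" "depth u"] dm by simp
    have tl: "depth u * N + ?c < N * N" unfolding N_def by (rule tab_less[OF dm cm])
    have ul: "u < 2 * N * N" unfolding N_def by (rule good_less[OF g])
    have bounds: "wa + u < cells M" "fa + u < cells M" "ta + (depth u * N + ?c) < cells M"
       using ul tl wa_cells fa_cells ta_cells unfolding N_def by linarith+
    have br: "mem s (ta + (depth u * N + ?c)) = int (br (depth u) ?c)"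
      using st dm cm unfolding stored_def N_def by blast
    have eqw: "mem s (wa + u) = int ?c \<longleftrightarrow> depth u < m \<and> ws ! row u ! depth u = ?c"
      using wu by auto
    have um: "int u < int (N) \<longleftrightarrow> u \<le> m" unfolding N_def by linarith
    have ok: "\<bar>int (depth u)\<bar> \<le> word_max M" "\<bar>int (wa + u)\<bar> \<le> word_max M" "\<bar>int (fa + u)\<bar> \<le> word_max M"
      "\<bar>int (ta + (depth u * N + ?c))\<bar> \<le> word_max M" "\<bar>int (depth u * N + ?c)\<bar> \<le> word_max M"
      "\<bar>int (depth u * N)\<bar> \<le> word_max M" "\<bar>int u + 1\<bar> \<le> word_max M"
      "int (wa + u) < int (cells M)" "int (fa + u) < int (cells M)"
      "int (ta + (depth u * N + ?c)) < int (cells M)"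
      "0 \<le> int (wa + u)" "0 \<le> int (fa + u)" "0 \<le> int (ta + (depth u * N + ?c))"
      using bounds cells_word tl ul dm ta_cells wa_cells le_square[of N] unfolding N_def by linarith+
    let ?s = "s'\<lparr>reg := (reg s')(xd := int (depth u), xx := int ?c)\<rparr>"
    have "wp M rest I ?s H" if H: "H \<ge> F' - 7" for H
    proof (cases "lookup u ?c")
      case (Some u')
      note step = candidate_step[OF a(4) Some]
      show ?thesis
      proof (cases "depth u < m \<and> ws ! row u ! depth u = ?c")
        case True
        then have "u' = Suc u" using Some by (simp add: lookup_def)
        then have fin: "I s'' G" if "J s''" "reg s'' xv = int u + 1" "reg s'' xg = 0" "G \<ge> F' - 25" for s'' G
          using that F' step by (intro I0[of s'' u']) auto
        show ?thesis using True eqw a(1) H ok unfolding rest_def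
          by (simp add: fr a(2) J_upd fin of_nat_add[symmetric] of_nat_mult[symmetric]
              del: of_nat_add of_nat_mult)
      next
        case False
        then have br': "u \<le> m" "br (depth u) ?c \<noteq> 0" "u' = br (depth u) ?c"
          using Some by (auto simp: lookup_def split: if_splits)
        have fin: "I s'' G" if "J s''" "reg s'' xv = int (br (depth u) ?c)" "reg s'' xg = 0" "G \<ge> F' - 25" for s'' G
          using that F' step br' by (intro I0[of s'' u']) auto
        have neq: "mem s (wa + u) \<noteq> int ?c" using False eqw by simp
        show ?thesis using neq br' a(1) um H ok unfolding rest_def
          by (simp add: fr a(2) J_upd fin br of_nat_add[symmetric] of_nat_mult[symmetric]
              del: of_nat_add of_nat_mult)
      qed
    next
      case None
      then have neq: "mem s (wa + u) \<noteq> int ?c" and br0: "u \<le> m \<Longrightarrow> br (depth u) ?c = 0"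
        using eqw by (auto simp: lookup_def split: if_splits)
      have du: "0 < depth u" by (rule candidate_lookup_None[OF a(4) None])
      then obtain f where f: "mem s (fa + u) = int f" "longest 1 ((!) (ws ! row u)) (depth u) f"
        using fl g a(5) unfolding fails_def by blast
      note cf = candidate_fail[OF a(4) None f(2)]
      have fin: "I s'' G" if "J s''" "reg s'' xv = int f" "reg s'' xg = 1" "G \<ge> F' - 25" for s'' G
        using that F' cf a(5) by (intro I1[of s'' f]) auto
      show ?thesis using neq br0 a(1,3) um f(1) H ok unfolding rest_def
        by (simp add: fr a(2) J_upd fin br of_nat_add[symmetric] of_nat_mult[symmetric]
              del: of_nat_add of_nat_mult)
    qed
    then show ?thesis using ok unfolding body_def
      by (cases "depth u < T e") (simp_all add: fr a(2) md cut_def)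
  qed
  have "wp M (While (Equal (Reg xg) (Const 1)) body) Q (s\<lparr>reg := (reg s)(xg := 1)\<rparr>) (F - 1)"
  proof (rule wp_While[where I = I])
    show "I (s\<lparr>reg := (reg s)(xg := 1)\<rparr>) (F - 1)"
      by (rule I1[of _ v]) (use F v longest_candidate in \<open>simp_all add: J_upd, simp_all add: J_def frame_def\<close>)
  next
    fix s' F' assume I: "I s' F'"
    then obtain u where J: "J s'" and u: "reg s' xv = int u" and
      "reg s' xg = 1 \<and> candidate lo T e u \<and> depth u \<le> depth v \<and> F' \<ge> R + 30 * (int (depth u) + 2) \<or>
      reg s' xg = 0 \<and> longest lo T (Suc e) u \<and> F' \<ge> R + 30 * int (depth u) + 3"
      unfolding I_def by (elim conjE exE)
    then show "0 \<le> F' \<and> tt M s' (Equal (Reg xg) (Const 1))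
       (\<lambda>v. (v \<longrightarrow> wp M body I s' (F' - 1 - int (test_ops (Equal (Reg xg) (Const 1))))) \<and>
         (\<not> v \<longrightarrow> Q s' (F' - 1 - int (test_ops (Equal (Reg xg) (Const 1))))))"
    proof (elim disjE conjE)
      assume a: "reg s' xg = 1" "candidate lo T e u" "depth u \<le> depth v" "F' \<ge> R + 30 * (int (depth u) + 2)"
      from wp_body[OF J u a] a(1,4) R show ?thesis by simp
    next
      assume a: "reg s' xg = 0" "longest lo T (Suc e) u" "F' \<ge> R + 30 * int (depth u) + 3"
      have "Q s' (F' - 2)" using J a(3) by (intro Q[OF _ u a(2)]) (simp_all add: J_def)
      with a R show ?thesis by simp
    qed
  qed
  then show ?thesis unfolding step_com_def body_def rest_def by simp
qed

end

section \<open>The parent distance of one position\<close>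

text \<open>The search follows the chain of nearest smaller entries from the left neighbour, using
  distances stored earlier. It gives up beyond distance \<open>m\<close>, so a circular buffer of
  \<open>N\<close> cells suffices.\<close>

definition prev_com :: "(nat exp \<Rightarrow> nat exp) \<Rightarrow> nat \<Rightarrow> nat com" where
  "prev_com X rb =
     xc ::= Const 1 ;; xg ::= Const 1 ;;
     While (Equal (Reg xg) (Const 1))
       (If (And (Less (Reg xc) (Reg xe \<oplus> Const 1)) (Less (Reg xc) (Reg xN)))
         (If (Less (X (Reg xe \<ominus> Reg xc)) (X (Reg xe)))
           (xg ::= Const 0)
           (xd ::= Cell (Reg rb \<oplus> ((Reg xe \<ominus> Reg xc) \<oslash> Reg xN)) ;;
            If (Equal (Reg xd) (Const 0))
              (xc ::= Const 0 ;; xg ::= Const 0)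
              (xc ::= Reg xc \<oplus> Reg xd)))
         (xc ::= Const 0 ;; xg ::= Const 0))"

text \<open>Distances above \<open>m\<close> vanish in every window of length \<open>m\<close>;
  dropping them at once limits how far back a search has to look.\<close>

definition tpd :: "nat \<Rightarrow> int list \<Rightarrow> nat \<Rightarrow> nat" where
  "tpd m xs k = cut (pd xs k) m"

text \<open>\<open>X e\<close> reads the entry of \<open>xs\<close> at the position \<open>e\<close>, counted from 0.\<close>

definition source :: "machine \<Rightarrow> (nat exp \<Rightarrow> nat exp) \<Rightarrow> int list \<Rightarrow> bool" where
  "source M X xs \<longleftrightarrow> (\<forall>s e P. ev M s e (\<lambda>a. 0 \<le> a \<and> a < int (length xs)) \<longrightarrow>
     ev M s (X e) P = ev M s e (\<lambda>a. P (xs ! nat a))) \<and> (\<forall>e. ops (X e) \<le> ops e + 2)"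

lemma source_ev: "source M X xs \<Longrightarrow> ev M s e (\<lambda>a. 0 \<le> a \<and> a < int (length xs)) \<Longrightarrow>
    ev M s (X e) P = ev M s e (\<lambda>a. P (xs ! nat a))"
  by (simp add: source_def)

lemma source_ops: "source M X xs \<Longrightarrow> ops (X e) \<le> ops e + 2"
  by (simp add: source_def)

text \<open>The possible outcomes of one loop iteration. In the fourth, the entry at
  \<open>e - c\<close> has no smaller entry among the \<open>m\<close> positions before it and is at
  least the entry at \<open>e\<close>, so the latter finds none within \<open>m\<close> positions
  either.\<close>

lemma tpd_cases:
  assumes c: "0 < c" "\<forall>l<e. e < l + c \<longrightarrow> xs ! e \<le> xs ! l"
  shows "e < c \<Longrightarrow> tpd m xs e = 0"
    and "c \<le> e \<Longrightarrow> m < c \<Longrightarrow> tpd m xs e = 0"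
    and "c \<le> e \<Longrightarrow> c \<le> m \<Longrightarrow> xs ! (e - c) < xs ! e \<Longrightarrow> tpd m xs e = c"
    and "c \<le> e \<Longrightarrow> \<not> xs ! (e - c) < xs ! e \<Longrightarrow> tpd m xs (e - c) = 0 \<Longrightarrow> tpd m xs e = 0"
    and "c \<le> e \<Longrightarrow> \<not> xs ! (e - c) < xs ! e \<Longrightarrow> tpd m xs (e - c) \<noteq> 0 \<Longrightarrow>
      \<forall>l<e. e < l + (c + tpd m xs (e - c)) \<longrightarrow> xs ! e \<le> xs ! l"
proof -
  have z: "\<not> (0 < pd xs e \<and> pd xs e < c)" 
  proof
    assume h: "0 < pd xs e \<and> pd xs e < c"
    then have "xs ! e \<le> xs ! (e - pd xs e)" using pd_le[of xs e] c(2) by auto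
    with pd_pos[of xs e] h show False by simp
  qed
  show "tpd m xs e = 0" if "e < c"
    using z pd_le[of xs e] that by (auto simp: tpd_def cut_def)
  show "tpd m xs e = 0" if "c \<le> e" "m < c"
    using z that by (auto simp: tpd_def cut_def)
  show "tpd m xs e = c" if "c \<le> e" "c \<le> m" "xs ! (e - c) < xs ! e"
  proof -
    have "pd xs e = c" using that c by (intro pd_eqI) (auto simp: is_pd_def)
    then show ?thesis using that by (simp add: tpd_def cut_def)
  qed
  have b: "xs ! e \<le> xs ! l" if h: "c \<le> e" "\<not> xs ! (e - c) < xs ! e" "l < e"
    "pd xs (e - c) = 0 \<or> e < l + (c + pd xs (e - c))" for l
  proof (rule linorder_cases[of l "e - c"])
    assume l: "l < e - c"
    then have "xs ! (e - c) \<le> xs ! l" using h pd_le[of xs "e - c"] by (intro pd_between) linarith+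
    then show ?thesis using h by simp
  next
    assume "e - c < l" then show ?thesis using c(2) h by auto
  next
    assume "l = e - c" then show ?thesis using h by simp
  qed
  show "tpd m xs e = 0" if h: "c \<le> e" "\<not> xs ! (e - c) < xs ! e" "tpd m xs (e - c) = 0"
  proof (rule ccontr)
    assume "tpd m xs e \<noteq> 0"
    then have d: "0 < pd xs e" "pd xs e \<le> m" by (auto simp: tpd_def cut_def split: if_splits)
    have "pd xs (e - c) = 0 \<or> m < pd xs (e - c)" using h(3) by (auto simp: tpd_def cut_def split: if_splits)
    then have "xs ! e \<le> xs ! (e - pd xs e)" using d pd_le[of xs e] c(1) h(1) by (intro b h) auto
    with pd_pos[OF d(1)] show False by simp
  qed
  show "\<forall>l<e. e < l + (c + tpd m xs (e - c)) \<longrightarrow> xs ! e \<le> xs ! l"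
    if h: "c \<le> e" "\<not> xs ! (e - c) < xs ! e" "tpd m xs (e - c) \<noteq> 0"
  proof (intro allI impI)
    fix l assume "l < e" "e < l + (c + tpd m xs (e - c))"
    with h show "xs ! e \<le> xs ! l" by (intro b) (auto simp: tpd_def cut_def split: if_splits)
  qed
qed

lemma tpd_le: "tpd m xs e \<le> e" "tpd m xs e \<le> m"
  using pd_le[of xs e] by (auto simp: tpd_def cut_def)

text \<open>A failed comparison pops a member of the stack, whose 30 units pay for the iteration;
  the survivors keep theirs. The height afterwards also counts the entry at \<open>e\<close>, hence
  the \<open>- 1\<close>.\<close>

lemma prev_com_wp:
  assumes X: "source M X xs" and e: "reg s xe = int e" "e < length xs"
    and N: "reg s xN = int (Suc m)" and rb: "reg s rb = int ba" "rb \<notin> {xc, xd, xg}"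
    and buf: "\<And>k. k < e \<Longrightarrow> e \<le> k + m \<Longrightarrow> mem s (ba + k mod Suc m) = int (tpd m xs k)"
    and cells: "ba + m < cells M"
    and wmax: "int (ba + 3 * m + 3 + length xs) \<le> word_max M"
    and F: "F \<ge> R + 30 * int (stk_at (tpd m xs) e 1 + 2)" and R: "R \<ge> 0"
    and Q: "\<And>s' F'. frame {xc, xd, xg} s s' \<Longrightarrow> reg s' xc = int (tpd m xs e) \<Longrightarrow>
      F' \<ge> R + 30 * (int (stk (tpd m xs) e) - 1) \<Longrightarrow> Q s' F'"
  shows "wp M (prev_com X rb) Q s F"
proof -
  let ?T = "tpd m xs"
  define body where "body = If (And (Less (Reg xc) (Reg xe \<oplus> Const 1)) (Less (Reg xc) (Reg xN)))
         (If (Less (X (Reg xe \<ominus> Reg xc)) (X (Reg xe)))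
           (xg ::= Const 0)
           (xd ::= Cell (Reg rb \<oplus> ((Reg xe \<ominus> Reg xc) \<oslash> Reg xN)) ;;
            If (Equal (Reg xd) (Const 0))
              (xc ::= Const 0 ;; xg ::= Const 0)
              (xc ::= Reg xc \<oplus> Reg xd)))
         (xc ::= Const 0 ;; xg ::= Const 0)"
  define J where "J = (\<lambda>s'. frame {xc, xd, xg} s s')"
  \<comment> \<open>The search only continues from a distance of at most \<open>m\<close>, by a
    stored distance of at most \<open>m\<close>; the bound \<open>2 * m + 1\<close> keeps the sum
    within a word.\<close>
  define I where "I = (\<lambda>s' F'. J s' \<and> (\<exists>c. reg s' xc = int c \<and>
     (reg s' xg = 1 \<and> 0 < c \<and> c \<le> 2 * m + 1 \<and> (\<forall>l<e. e < l + c \<longrightarrow> xs ! e \<le> xs ! l) \<and>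
         F' \<ge> R + 30 * (int (stk_at ?T e c) + 1) \<or>
      reg s' xg = 0 \<and> c = ?T e \<and> F' \<ge> R + 30 * (int (stk ?T e) - 1) + 3)))"
  have J_upd: "J (s'\<lparr>reg := f(r := x)\<rparr>) = J (s'\<lparr>reg := f\<rparr>)" if "r \<in> {xc, xd, xg}" for s' r x f
    unfolding J_def using that by (rule frame_upd)
  have I1: "I s' G" if "J s'" "reg s' xc = int c" "reg s' xg = 1" "0 < c" "c \<le> 2 * m + 1"
    "\<forall>l<e. e < l + c \<longrightarrow> xs ! e \<le> xs ! l" "G \<ge> R + 30 * (int (stk_at ?T e c) + 1)" for s' c G
    unfolding I_def by (rule conjI[OF that(1)], rule exI[of _ c]) (use that in simp)
  have I0: "I s' G" if "J s'" "reg s' xc = int (?T e)" "reg s' xg = 0"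
    "G \<ge> R + 30 * (int (stk ?T e) - 1) + 3" for s' G
    unfolding I_def by (rule conjI[OF that(1)], rule exI[of _ "?T e"]) (use that in simp)
  have stk1: "stk ?T k \<ge> 1" for k by (subst stk.simps) simp
  have wp_body: "wp M body I s' (F' - 2)"
    if fr: "J s'" and g: "reg s' xg = 1" and
      c: "reg s' xc = int c" "0 < c" "c \<le> 2 * m + 1" "\<forall>l<e. e < l + c \<longrightarrow> xs ! e \<le> xs ! l"
      and F': "F' \<ge> R + 30 * (int (stk_at ?T e c) + 1)" for s' c F'
  proof -
    define N where "N = Suc m"
    have rs: "reg s' xe = int e" "reg s' xN = int N" "reg s' rb = int ba" "mem s' = mem s"
      using fr e N rb by (simp_all add: J_def frame_def N_def)
    have w1: "\<bar>int e + 1\<bar> \<le> word_max M" using wmax e by simp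
    note T = tpd_cases[OF c(2,4), where m = m]
    have fin: "I s'' G" if "?T e = 0" "J s''" "reg s'' xc = 0" "reg s'' xg = 0" "G \<ge> F' - 27" for s'' G
    proof -
      have "stk ?T e = 1" using that(1) by (subst stk.simps) simp
      then show ?thesis using that F' by (intro I0) simp_all
    qed
    show ?thesis
    proof (cases "c \<le> e \<and> c \<le> m")
      case False
      then have T0: "?T e = 0" using T(1,2) by linarith
      have "\<not> (int c < int e + 1 \<and> int c < int N)" using False by (simp add: N_def) linarith
      then show ?thesis using w1 fr unfolding body_def by (auto simp: rs c(1) J_upd fin[OF T0])
    next
      case ce: True
      have lt: "int c < int e + 1" "int c < int (N)" using ce by (simp_all add: N_def)
      have k: "(int e - int c) mod int N = int ((e - c) mod N)" "nat (int e - int c) = e - c"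
        using ce unfolding of_nat_mod by (simp_all add: of_nat_diff)
      have kb: "(e - c) mod N \<le> m" unfolding N_def by (simp add: less_Suc_eq_le[symmetric])
      have w2: "\<bar>int e - int c\<bar> \<le> word_max M" "0 \<le> int e - int c" "int e - int c < int (length xs)"
        "\<bar>int ((e - c) mod N)\<bar> \<le> word_max M" "\<bar>int (ba + (e - c) mod N)\<bar> \<le> word_max M"
        "int (ba + (e - c) mod N) < int (cells M)" "\<bar>int c + int (?T (e - c))\<bar> \<le> word_max M"
        using wmax e ce kb cells tpd_le[of m xs "e - c"] by linarith+
      have o: "ops (X (Reg xe \<ominus> Reg xc)) \<le> 3" "ops (X (Reg xe)) \<le> 2"
        using source_ops[OF X, of "Reg xe \<ominus> Reg xc"] source_ops[OF X, of "Reg xe"] by simp_all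
      have ev1: "ev M s' (X (Reg xe \<ominus> Reg xc)) P = P (xs ! (e - c))" for P
        by (subst source_ev[OF X]) (use rs c(1) w2 k in simp_all)
      have ev2: "ev M s' (X (Reg xe)) P = P (xs ! e)" for P
        by (subst source_ev[OF X]) (use rs e in simp_all)
      have bufc: "mem s (ba + (e - c) mod N) = int (?T (e - c))"
        using buf[of "e - c"] ce c(2) unfolding N_def by auto
      show ?thesis
      proof (cases "xs ! (e - c) < xs ! e")
        case less: True
        have Te: "?T e = c" using T(3) ce less by simp
        have st: "stk ?T e = Suc (stk_at ?T e c)"
          using Te c(2) ce by (subst stk.simps) (simp add: stk_at_def)
        have fin2: "I s'' G" if "J s''" "reg s'' xc = int c" "reg s'' xg = 0" "G \<ge> F' - 22" for s'' G
          using that st Te F' by (intro I0) simp_all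
        show ?thesis using less lt w1 o fr unfolding body_def
          by (simp add: ev1 ev2 rs c(1) J_upd fin2)
      next
        case nless: False
        show ?thesis
        proof (cases "?T (e - c) = 0")
          case True
          have T0: "?T e = 0" using T(4) ce nless True by simp
          show ?thesis using nless lt w1 w2 o fr bufc True unfolding body_def
            by (simp add: ev1 ev2 k(1) rs c(1) J_upd fin[OF T0] of_nat_add[symmetric] del: of_nat_add)
        next
          case d: False
          let ?d = "?T (e - c)"
          have "stk ?T (e - c) = Suc (stk ?T (e - c - ?d))"
            using d tpd_le[of m xs "e - c"] by (subst stk.simps) simp
          then have "stk_at ?T e (c + ?d) + 1 \<le> stk_at ?T e c" using ce by (simp add: stk_at_def)
          then have "int (stk_at ?T e (c + ?d)) + 1 \<le> int (stk_at ?T e c)" by linarith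
          moreover have "c + ?d \<le> 2 * m + 1" using tpd_le[of m xs "e - c"] ce by simp
          moreover have "\<forall>l<e. e < l + (c + ?d) \<longrightarrow> xs ! e \<le> xs ! l" using T(5) ce nless d by blast
          ultimately have fin3: "I s'' G" if "J s''" "reg s'' xc = int (c + ?d)" "reg s'' xg = 1" "G \<ge> F' - 27" for s'' G
            using that F' c(2) by (intro I1) (simp_all, linarith)
          show ?thesis using nless lt w1 w2 o fr bufc d unfolding body_def
            by (simp add: ev1 ev2 k(1) rs c(1) g J_upd fin3 of_nat_add[symmetric] del: of_nat_add)
        qed
      qed
    qed
  qed
  have "wp M (While (Equal (Reg xg) (Const 1)) body) Q
     (s\<lparr>reg := (reg s)(xc := 1, xg := 1)\<rparr>) (F - 2)"
  proof (rule wp_While[where I = I])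
    show "I (s\<lparr>reg := (reg s)(xc := 1, xg := 1)\<rparr>) (F - 2)"
      by (rule I1[of _ 1]) (use F in \<open>simp_all add: J_upd, simp_all add: J_def frame_def\<close>)
  next
    fix s' F' assume I: "I s' F'"
    then obtain c where J: "J s'" and c: "reg s' xc = int c" and
      "reg s' xg = 1 \<and> 0 < c \<and> c \<le> 2 * m + 1 \<and> (\<forall>l<e. e < l + c \<longrightarrow> xs ! e \<le> xs ! l) \<and>
         F' \<ge> R + 30 * (int (stk_at ?T e c) + 1) \<or>
      reg s' xg = 0 \<and> c = ?T e \<and> F' \<ge> R + 30 * (int (stk ?T e) - 1) + 3"
      unfolding I_def by (elim conjE exE)
    then show "0 \<le> F' \<and> tt M s' (Equal (Reg xg) (Const 1))
       (\<lambda>v. (v \<longrightarrow> wp M body I s' (F' - 1 - int (test_ops (Equal (Reg xg) (Const 1))))) \<and>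
         (\<not> v \<longrightarrow> Q s' (F' - 1 - int (test_ops (Equal (Reg xg) (Const 1))))))"
    proof (elim disjE conjE)
      assume a: "reg s' xg = 1" "0 < c" "c \<le> 2 * m + 1" "\<forall>l<e. e < l + c \<longrightarrow> xs ! e \<le> xs ! l"
        "F' \<ge> R + 30 * (int (stk_at ?T e c) + 1)"
      from wp_body[OF J a(1) c a(2-5)] a(1,5) R show ?thesis by simp
    next
      assume a: "reg s' xg = 0" "c = ?T e" "F' \<ge> R + 30 * (int (stk ?T e) - 1) + 3"
      have "Q s' (F' - 2)" using J a c by (intro Q) (simp_all add: J_def)
      with a R stk1[of e] show ?thesis by simp
    qed
  qed
  then show ?thesis unfolding prev_com_def body_def by simp
qed

section \<open>Building the rows of the trie\<close>

text \<open>The row being written doubles as the buffer of \<open>prev_com\<close>: all its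
  positions lie below \<open>m\<close>, where reduction modulo \<open>N\<close> changes
  nothing.\<close>

definition code_com :: "(nat exp \<Rightarrow> nat exp) \<Rightarrow> nat com" where
  "code_com X =
     xe ::= Const 0 ;;
     While (Less (Reg xe) PatLen)
       (prev_com X xW ;; Store (Reg xW \<oplus> Reg xe) (Reg xc) ;; xe ::= Reg xe \<oplus> Const 1) ;;
     Store (Reg xW \<oplus> Reg xe) (Const (-1))"

definition entry_com :: "nat com" where
  "entry_com =
     If (Less (Reg xi) (Reg xe)) (xx ::= Cell (Reg xW \<oplus> Reg xi))
      (If (Equal (Reg xi) (Reg xe)) (xx ::= Reg xc)
        (If (Equal (Reg xi) (Reg xe \<oplus> Const 1))
          (If (Equal (Cell (Reg xW \<oplus> Reg xe)) (Const 0)) (xx ::= Const 0)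
            (xx ::= Cell (Reg xW \<oplus> Reg xe) \<oplus> Const 1))
          (If (Equal (Cell (Reg xW \<oplus> Reg xi)) (Reg xi \<ominus> Reg xe))
            (xx ::= Cell (Reg xW \<oplus> Reg xi) \<ominus> Const 1)
            (xx ::= Cell (Reg xW \<oplus> Reg xi)))))"

definition copy_com :: "nat com" where
  "copy_com =
     xi ::= Const 0 ;;
     While (Less (Reg xi) PatLen)
       (entry_com ;; Store (Reg xW \<oplus> (Reg xK \<oplus> Reg xi)) (Reg xx) ;; xi ::= Reg xi \<oplus> Const 1) ;;
     Store (Reg xW \<oplus> (Reg xK \<oplus> Reg xi)) (Const (-1))"

text \<open>Six blocks of \<open>N * N\<close> cells from \<open>wa\<close> on: two for at most
  \<open>2 * N\<close> rows, two for their failure links, one for the branching table and one for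
  the text buffer. The word bound leaves room for addresses, for distances during a search and for
  text positions.\<close>

locale mach =
  fixes M :: machine and m wa :: nat
  assumes m_pos: "0 < m" and pat_len: "length (pat_in M) = m"
    and fit: "wa + 6 * (Suc m * Suc m) \<le> cells M"
    and word_bound: "int (cells M) + 3 * int m + 3 + int (length (txt_in M)) \<le> word_max M"
begin

definition N :: nat where "N = Suc m"
definition fa :: nat where "fa = wa + 2 * (N * N)"
definition ta :: nat where "ta = wa + 4 * (N * N)"
definition ba :: nat where "ba = wa + 5 * (N * N)"

definition cfg :: "(nat \<Rightarrow> int) \<Rightarrow> bool" where
  "cfg f \<longleftrightarrow> f xN = int N \<and> f xW = int wa \<and> f xF = int fa \<and> f xT = int ta \<and> f xB = int ba"

lemma cfg_upd [simp]: "r \<notin> {xN, xW, xF, xT, xB} \<Longrightarrow> cfg (f(r := x)) = cfg f"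
  by (simp add: cfg_def)

lemma cfgD: "cfg f \<Longrightarrow> f xN = int N" "cfg f \<Longrightarrow> f xW = int wa" "cfg f \<Longrightarrow> f xF = int fa"
  "cfg f \<Longrightarrow> f xT = int ta" "cfg f \<Longrightarrow> f xB = int ba"
  by (simp_all add: cfg_def)

lemma frame_reg: "frame R s s' \<Longrightarrow> r \<notin> R \<Longrightarrow> reg s' r = reg s r"
  by (simp add: frame_def)

lemma frame_mem: "frame R s s' \<Longrightarrow> mem s' = mem s" "frame R s s' \<Longrightarrow> outp s' = outp s"
  by (simp_all add: frame_def)

lemma frame_cfg: "frame R s s' \<Longrightarrow> xN \<notin> R \<Longrightarrow> xW \<notin> R \<Longrightarrow> xF \<notin> R \<Longrightarrow> xT \<notin> R \<Longrightarrow> xB \<notin> R \<Longrightarrow>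
    cfg (reg s') = cfg (reg s)"
  unfolding cfg_def by (simp add: frame_reg)

lemma N_le: "N \<le> N * N" "m < N"
  by (simp_all add: N_def)

lemma code_com_wp:
  assumes X: "source M X xs" and xs: "length xs = m" and c: "cfg (reg s)"
    and F: "F \<ge> R + 130 * int m + 20" and R: "0 \<le> R"
    and Q: "\<And>s' F'. cfg (reg s') \<Longrightarrow> (\<And>k. k < m \<Longrightarrow> mem s' (wa + k) = int (code xs ! k)) \<Longrightarrow>
      mem s' (wa + m) = -1 \<Longrightarrow> (\<And>a. a < wa \<or> wa + N \<le> a \<Longrightarrow> mem s' a = mem s a) \<Longrightarrow>
      outp s' = outp s \<Longrightarrow> R \<le> F' \<Longrightarrow> Q s' F'"
  shows "wp M (code_com X) Q s F"
proof -
  let ?T = "tpd m xs"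
  define body where "body = prev_com X xW ;; Store (Reg xW \<oplus> Reg xe) (Reg xc) ;; xe ::= Reg xe \<oplus> Const 1"
  define I where "I = (\<lambda>(s' :: nat state) F'. \<exists>e. reg s' xe = int e \<and> e \<le> m \<and> cfg (reg s') \<and>
      (\<forall>k<e. mem s' (wa + k) = int (?T k)) \<and> (\<forall>a. a < wa \<or> wa + N \<le> a \<longrightarrow> mem s' a = mem s a) \<and>
      outp s' = outp s \<and> F' \<ge> R + 100 * (int m - int e) + 30 * int (stk_at ?T e 1) + 10)"
  have Tpd: "?T k = code xs ! k" if "k < m" for k
    using that pd_le[of xs k] xs by (simp add: tpd_def cut_def)
  have big: "wa + N \<le> cells M" using fit N_le unfolding N_def by linarith
  have "wp M (While (Less (Reg xe) PatLen) body)
     (wp M (Store (Reg xW \<oplus> Reg xe) (Const (-1))) Q) (s\<lparr>reg := (reg s)(xe := 0)\<rparr>) (F - 1)"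
  proof (rule wp_While[where I = I])
    show "I (s\<lparr>reg := (reg s)(xe := 0)\<rparr>) (F - 1)"
      unfolding I_def by (rule exI[of _ 0]) (use c F in \<open>simp add: stk_at_def\<close>)
  next
    fix s' F' assume "I s' F'"
    then obtain e where e: "reg s' xe = int e" "e \<le> m" and c: "cfg (reg s')" and
      mm: "\<forall>k<e. mem s' (wa + k) = int (?T k)" "\<forall>a. a < wa \<or> wa + N \<le> a \<longrightarrow> mem s' a = mem s a"
      and o: "outp s' = outp s" and F': "F' \<ge> R + 100 * (int m - int e) + 30 * int (stk_at ?T e 1) + 10"
      unfolding I_def by (elim exE conjE)
    have nn: "0 \<le> int m - int e" using e(2) by simp
    have body: "wp M body I s' (F' - 2)" if lt: "e < m"
      unfolding body_def wp_Seq
    proof (rule prev_com_wp[OF X e(1), where R = "R + 100 * (int m - int e) - 52"])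
      show "e < length xs" using lt xs by simp
      show "reg s' xN = int (Suc m)" "reg s' xW = int wa" using cfgD[OF c] by (simp_all add: N_def)
      show "wa + m < cells M" using big by (simp add: N_def)
      show "int (wa + 3 * m + 3 + length xs) \<le> word_max M" using big word_bound xs by (simp add: N_def)
      show "mem s' (wa + k mod Suc m) = int (?T k)" if "k < e" "e \<le> k + m" for k
        using that mm(1) e(2) by simp
      fix s'' F'' assume fr: "frame {xc, xd, xg} s' s''" and xc: "reg s'' xc = int (?T e)"
        and F'': "F'' \<ge> R + 100 * (int m - int e) - 52 + 30 * (int (stk ?T e) - 1)"
      have r: "reg s'' xW = int wa" "reg s'' xe = int e" "cfg (reg s'')" "mem s'' = mem s'" "outp s'' = outp s'"
        using fr e c cfgD[OF c] frame_cfg[OF fr] by (simp_all add: frame_reg frame_mem)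
      have I': "I t G" if "reg t = (reg s'')(xe := int e + 1)" "mem t = (mem s')(wa + e := int (?T e))"
        "outp t = outp s'" "G \<ge> F'' - 6" for t G
        unfolding I_def
      proof (intro exI[of _ "Suc e"] conjI allI impI)
        show "reg t xe = int (Suc e)" "Suc e \<le> m" "cfg (reg t)" "outp t = outp s"
          using that lt r o by simp_all
        show "mem t (wa + k) = int (?T k)" if "k < Suc e" for k
          using that \<open>mem t = _\<close> mm(1) by (cases "k = e") simp_all
        show "mem t a = mem s a" if "a < wa \<or> wa + N \<le> a" for a
          using that \<open>mem t = _\<close> mm(2) lt by (cases "a = wa + e") (auto simp: N_def)
        show "R + 100 * (int m - int (Suc e)) + 30 * int (stk_at ?T (Suc e) 1) + 10 \<le> G"
          using \<open>G \<ge> F'' - 6\<close> F'' by (simp add: stk_at_def)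
      qed
      have "\<bar>int wa + int e\<bar> \<le> word_max M" "\<bar>int e + 1\<bar> \<le> word_max M" "int wa + int e < int (cells M)"
        using big word_bound lt by (simp_all add: N_def)
      then show "wp M (Store (Reg xW \<oplus> Reg xe) (Reg xc)) (wp M (xe ::= Reg xe \<oplus> Const 1) I) s'' F''"
        using r by (simp add: xc nat_add_distrib I')
    qed (use F' lt R nn in simp_all)
    have fin: "wp M (Store (Reg xW \<oplus> Reg xe) (Const (-1))) Q s' (F' - 2)" if ge: "\<not> e < m"
    proof -
      have em: "e = m" using ge e by simp
      have "Q t G" if "reg t = reg s'" "mem t = (mem s')(wa + m := -1)" "outp t = outp s'" "G \<ge> F' - 6" for t G
        by (rule Q) (use that c o mm em F' Tpd in \<open>auto simp: N_def\<close>)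
      then show ?thesis using cfgD[OF c] e em big word_bound by (simp add: N_def nat_add_distrib)
    qed
    show "0 \<le> F' \<and> tt M s' (Less (Reg xe) PatLen)
       (\<lambda>v. (v \<longrightarrow> wp M body I s' (F' - 1 - int (test_ops (Less (Reg xe) PatLen)))) \<and>
         (\<not> v \<longrightarrow> wp M (Store (Reg xW \<oplus> Reg xe) (Const (-1))) Q s' (F' - 1 - int (test_ops (Less (Reg xe) PatLen)))))"
      using F' R nn body fin by (simp add: e(1) pat_len del: wp_Store)
  qed
  then show ?thesis unfolding code_com_def body_def by simp
qed

lemma entry_com_wp:
  assumes c: "cfg (reg s)" and w: "length w = m" "\<And>k. k < m \<Longrightarrow> mem s (wa + k) = int (w ! k)"
    "\<And>k. k < m \<Longrightarrow> w ! k \<le> k"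
    and q: "reg s xe = int q" "Suc q < m" and i: "reg s xi = int i" "i < m"
    and d: "reg s xc = int c"
    and Q: "\<And>F'. F' \<ge> F - 30 \<Longrightarrow> Q (s\<lparr>reg := (reg s)(xx := int (nbr w q c ! i))\<rparr>) F'"
  shows "wp M entry_com Q s F"
proof -
  have big: "wa + N \<le> cells M" using fit N_le unfolding N_def by linarith
  have wi: "mem s (wa + i) = int (w ! i)" "w ! i \<le> i" and wq: "mem s (wa + q) = int (w ! q)" "w ! q \<le> q"
    using w(2,3) i q by auto
  have b: "\<bar>int wa + int i\<bar> \<le> word_max M" "\<bar>int q + 1\<bar> \<le> word_max M" "int wa + int i < int (cells M)"
      "\<bar>int wa + int q\<bar> \<le> word_max M" "int wa + int q < int (cells M)"
      "\<bar>int i - int q\<bar> \<le> word_max M" "\<bar>int (w ! q) + 1\<bar> \<le> word_max M" "\<bar>int (w ! i) - 1\<bar> \<le> word_max M"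
    using big word_bound q i wi wq unfolding N_def by linarith+
  note ev = cfgD[OF c] q(1) i(1) d nat_add_distrib
  consider "i < q" | "i = q" | "i = Suc q" | "Suc q < i" "w ! i = i - q" | "Suc q < i" "w ! i \<noteq> i - q"
    by linarith
  then show ?thesis
  proof cases
    case 1
    then have "nbr w q c ! i = w ! i" using i w by (simp add: nbr_def)
    then show ?thesis using 1 b wi Q unfolding entry_com_def by (simp add: ev)
  next
    case 2
    then have "nbr w q c ! i = c" using i w by (simp add: nbr_def)
    then show ?thesis using 2 b Q unfolding entry_com_def by (simp add: ev)
  next
    case 3
    then have "nbr w q c ! i = (if w ! q = 0 then 0 else Suc (w ! q))" using i w by (simp add: nbr_def)
    then show ?thesis using 3 b wq Q unfolding entry_com_def
      by (cases "w ! q = 0") (simp_all add: ev add.commute)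
  next
    case 4
    then have n: "nbr w q c ! i = w ! i - 1" using i w by (simp add: nbr_def)
    have "int (w ! i - 1) = int (w ! i) - 1" "int (w ! i) = int i - int q" using 4 by auto
    then show ?thesis using 4(1) n b wi Q unfolding entry_com_def by (simp add: ev)
  next
    case 5
    then have n: "nbr w q c ! i = w ! i" using i w by (simp add: nbr_def)
    have "int (w ! i) \<noteq> int i - int q" using 5 by auto
    then show ?thesis using 5(1) n b wi Q unfolding entry_com_def by (simp add: ev)
  qed
qed

lemma copy_com_wp:
  assumes c: "cfg (reg s)" and w: "length w = m" "\<And>k. k < m \<Longrightarrow> mem s (wa + k) = int (w ! k)"
    "\<And>k. k < m \<Longrightarrow> w ! k \<le> k"
    and q: "reg s xe = int q" "Suc q < m" and d: "reg s xc = int c"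
    and K: "reg s xK = int (K * N)" "0 < K" "K < 2 * N"
    and F: "F \<ge> R + 40 * int m + 20" and R: "0 \<le> R"
    and Q: "\<And>s' F'. cfg (reg s') \<Longrightarrow> reg s' xe = int q \<Longrightarrow> reg s' xc = int c \<Longrightarrow> reg s' xK = int (K * N) \<Longrightarrow>
      reg s' xg = reg s xg \<Longrightarrow>
      (\<And>k. k < m \<Longrightarrow> mem s' (wa + (K * N + k)) = int (nbr w q c ! k)) \<Longrightarrow>
      mem s' (wa + (K * N + m)) = -1 \<Longrightarrow> (\<And>a. a < wa + K * N \<or> wa + K * N + N \<le> a \<Longrightarrow> mem s' a = mem s a) \<Longrightarrow>
      outp s' = outp s \<Longrightarrow> R \<le> F' \<Longrightarrow> Q s' F'"
  shows "wp M copy_com Q s F"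
proof -
  define body where "body = entry_com ;; Store (Reg xW \<oplus> (Reg xK \<oplus> Reg xi)) (Reg xx) ;; xi ::= Reg xi \<oplus> Const 1"
  define C where "C = (\<lambda>f. cfg f \<and> f xe = int q \<and> f xc = int c \<and> f xK = int (K * N) \<and> f xg = reg s xg)"
  have C_upd: "C (f(r := x)) = C f" if "r \<in> {xi, xx}" for f r x
    using that by (auto simp: C_def)
  define I where "I = (\<lambda>(s' :: nat state) F'. \<exists>i. reg s' xi = int i \<and> i \<le> m \<and> C (reg s') \<and>
      (\<forall>k<i. mem s' (wa + (K * N + k)) = int (nbr w q c ! k)) \<and>
      (\<forall>a. a < wa + K * N \<or> wa + K * N + N \<le> a \<longrightarrow> mem s' a = mem s a) \<and>
      outp s' = outp s \<and> F' \<ge> R + 40 * (int m - int i) + 15)"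
  have "K * N + N \<le> 2 * N * N" using K(3) by (metis mult_le_mono1 add.commute mult_Suc Suc_leI)
  then have big: "wa + (K * N + N) \<le> cells M" using fit unfolding N_def by simp
  have KN: "N \<le> K * N" using K(2) by simp
  have "wp M (While (Less (Reg xi) PatLen) body)
     (wp M (Store (Reg xW \<oplus> (Reg xK \<oplus> Reg xi)) (Const (-1))) Q) (s\<lparr>reg := (reg s)(xi := 0)\<rparr>) (F - 1)"
  proof (rule wp_While[where I = I])
    show "I (s\<lparr>reg := (reg s)(xi := 0)\<rparr>) (F - 1)"
      unfolding I_def by (rule exI[of _ 0]) (use c q d K F in \<open>simp add: C_def\<close>)
  next
    fix s' F' assume "I s' F'"
    then obtain i where i: "reg s' xi = int i" "i \<le> m" and C: "C (reg s')" and
      mm: "\<forall>k<i. mem s' (wa + (K * N + k)) = int (nbr w q c ! k)"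
        "\<forall>a. a < wa + K * N \<or> wa + K * N + N \<le> a \<longrightarrow> mem s' a = mem s a"
      and o: "outp s' = outp s" and F': "F' \<ge> R + 40 * (int m - int i) + 15"
      unfolding I_def by (elim exE conjE)
    have nn: "0 \<le> int m - int i" using i(2) by simp
    have C': "cfg (reg s')" "reg s' xe = int q" "reg s' xc = int c" "reg s' xK = int (K * N)" "reg s' xW = int wa"
      using C cfgD by (auto simp: C_def)
    have mw: "mem s' (wa + k) = int (w ! k)" if "k < m" for k
      using mm(2) w(2)[OF that] that KN by (simp add: N_def)
    have b: "\<bar>int (wa + (K * N + i))\<bar> \<le> word_max M" "\<bar>int (K * N + i)\<bar> \<le> word_max M" "\<bar>int i + 1\<bar> \<le> word_max M"
        "int (wa + (K * N + i)) < int (cells M)"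
      using big word_bound i unfolding N_def by linarith+
    have body: "wp M body I s' (F' - 2)" if lt: "i < m"
      unfolding body_def wp_Seq
    proof (rule entry_com_wp[OF C'(1) w(1) mw w(3) C'(2) q(2) i(1) lt C'(3)])
      fix G assume G: "G \<ge> F' - 2 - 30"
      have I': "I t H" if "reg t = (reg s')(xx := int (nbr w q c ! i), xi := int i + 1)"
        "mem t = (mem s')(wa + (K * N + i) := int (nbr w q c ! i))" "outp t = outp s'" "H \<ge> G - 7" for t H
        unfolding I_def
      proof (intro exI[of _ "Suc i"] conjI allI impI)
        show "reg t xi = int (Suc i)" "Suc i \<le> m" "C (reg t)" "outp t = outp s"
          using that lt C o by (simp_all add: C_upd)
        show "mem t (wa + (K * N + k)) = int (nbr w q c ! k)" if "k < Suc i" for k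
          using that \<open>mem t = _\<close> mm(1) by (cases "k = i") simp_all
        show "mem t a = mem s a" if "a < wa + K * N \<or> wa + K * N + N \<le> a" for a
          using that \<open>mem t = _\<close> mm(2) lt by (cases "a = wa + (K * N + i)") (auto simp: N_def)
        show "R + 40 * (int m - int (Suc i)) + 15 \<le> H"
          using \<open>H \<ge> G - 7\<close> F' G by simp
      qed
      show "wp M (Store (Reg xW \<oplus> (Reg xK \<oplus> Reg xi)) (Reg xx)) (wp M (xi ::= Reg xi \<oplus> Const 1) I)
        (s'\<lparr>reg := (reg s')(xx := int (nbr w q c ! i))\<rparr>) G"
        using b by (simp add: C' i of_nat_add[symmetric] of_nat_mult[symmetric] I' del: of_nat_add of_nat_mult)
    qed
    have fin: "wp M (Store (Reg xW \<oplus> (Reg xK \<oplus> Reg xi)) (Const (-1))) Q s' (F' - 2)" if ge: "\<not> i < m"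
    proof -
      have im: "i = m" using ge i by simp
      have "Q t G" if "reg t = reg s'" "mem t = (mem s')(wa + (K * N + m) := -1)" "outp t = outp s'" "G \<ge> F' - 10" for t G
        by (rule Q) (use that C o mm im F' in \<open>auto simp: N_def C_def\<close>)
      then show ?thesis using b im
        by (simp add: C' i of_nat_add[symmetric] of_nat_mult[symmetric] del: of_nat_add of_nat_mult)
    qed
    show "0 \<le> F' \<and> tt M s' (Less (Reg xi) PatLen)
       (\<lambda>v. (v \<longrightarrow> wp M body I s' (F' - 1 - int (test_ops (Less (Reg xi) PatLen)))) \<and>
         (\<not> v \<longrightarrow> wp M (Store (Reg xW \<oplus> (Reg xK \<oplus> Reg xi)) (Const (-1))) Q s' (F' - 1 - int (test_ops (Less (Reg xi) PatLen)))))"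
      using F' R nn body fin by (simp add: i(1) pat_len del: wp_Store)
  qed
  then show ?thesis unfolding copy_com_def body_def by simp
qed

end

section \<open>Branching points and number of the neighbouring codes\<close>

definition opt_ok :: "nat list \<Rightarrow> nat \<times> nat \<Rightarrow> bool" where
  "opt_ok w = (\<lambda>(q, c). Suc q < length w \<and> w ! Suc q = 1 \<and> c \<in> opts w q)"

definition rows :: "nat list \<Rightarrow> (nat \<times> nat) list \<Rightarrow> nat list list" where
  "rows w ps = w # map (\<lambda>(q, c). nbr w q c) ps"

text \<open>For \<open>c = w ! q\<close> the neighbour still agrees with \<open>w\<close> at
  \<open>q\<close> and first differs at \<open>Suc q\<close>, where \<open>w\<close> has 1 and the
  neighbour has 0 or at least 2.\<close>

definition brk :: "nat list \<Rightarrow> nat \<times> nat \<Rightarrow> nat" where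
  "brk w = (\<lambda>(q, c). if c = w ! q then Suc q else q)"

definition key :: "nat list \<Rightarrow> nat \<times> nat \<Rightarrow> nat" where
  "key w = (\<lambda>(q, c). nbr w q c ! brk w (q, c))"

lemma key_eq:
  "Suc q < length w \<Longrightarrow>
    key w (q, c) = (if c = w ! q then if w ! q = 0 then 0 else Suc (w ! q) else c)"
  by (simp add: key_def brk_def nbr_def)

lemma opts_le:
  assumes "c \<in> opts w q" "\<And>k. k \<le> q \<Longrightarrow> w ! k \<le> k"
  shows "c \<le> q"
  using assms(1)
proof induction
  case (step c)
  then show ?case using assms(2)[of "q - c"] by (auto simp: nxt_def)
qed auto

lemma opts_1: "c \<in> opts w q \<Longrightarrow> 0 < q \<Longrightarrow> w ! q = 1 \<Longrightarrow> c = 1"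
  by (induction rule: opts.induct) auto

text \<open>So a table cell names at most one row. Options that branch at the same depth either
  share \<open>q\<close>, and then the symbol reveals \<open>c\<close>, or sit at neighbouring
  positions. In the latter case the right position ends an ascent, where the chain stops at once
  with the distance 1 that \<open>w\<close> has there; but the row of this option branches one depth
  later.\<close>

lemma key_inj:
  assumes "opt_ok w x" "opt_ok w y" "brk w x = brk w y" "key w x = key w y"
  shows "x = y"
proof -
  obtain q c q' c' where xy: "x = (q, c)" "y = (q', c')" by (cases x; cases y)
  have a: "Suc q < length w" "w ! Suc q = 1" "c \<in> opts w q"
    "Suc q' < length w" "w ! Suc q' = 1" "c' \<in> opts w q'"
    using assms xy by (auto simp: opt_ok_def)
  have 1: "c = w ! q" if "q = Suc q'"
    using opts_1[OF a(3)] that a(5) by simp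
  have 2: "c' = w ! q'" if "q' = Suc q"
    using opts_1[OF a(6)] that a(2) by simp
  show ?thesis
    using assms(3,4) 1 2 unfolding xy key_eq[OF a(1)] key_eq[OF a(4)]
    by (auto simp: brk_def split: if_splits)
qed

lemma stk_nxt:
  assumes "c \<in> opts w q" "\<And>k. k \<le> q \<Longrightarrow> w ! k \<le> k" "c \<noteq> 0"
  shows "(if nxt w q c = 0 then 0 else stk ((!) w) (q - nxt w q c)) + 1 = stk ((!) w) (q - c)"
proof -
  have le: "w ! (q - c) \<le> q - c" using assms(2)[of "q - c"] by simp
  show ?thesis
  proof (cases "w ! (q - c) = 0")
    case True
    then show ?thesis by (subst (2) stk.simps) (simp add: nxt_def)
  next
    case False
    then have "stk ((!) w) (q - c) = Suc (stk ((!) w) (q - c - w ! (q - c)))"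
      using le by (subst stk.simps) simp
    with False show ?thesis by (simp add: nxt_def)
  qed
qed

text \<open>All options of \<open>q\<close> are members of the stack that \<open>q - 1\<close>
  leaves behind, or 0, so none can have more below it than the top.\<close>

lemma stk_opts:
  assumes "c \<in> opts w q" "\<And>k. k \<le> q \<Longrightarrow> w ! k \<le> k"
  shows "(if c = 0 then 0 else stk ((!) w) (q - c)) \<le> stk_at ((!) w) q 1"
  using assms(1)
proof induction
  case start
  then show ?case by (auto simp: stk_at_def)
next
  case (step c)
  then show ?case using stk_nxt[OF step.hyps(1) assms(2)] by simp
qed

lemma pd_opts: "q < length xs \<Longrightarrow> pd xs q \<in> opts (code xs) q"
  using is_pd_pd[of xs q] by (intro opts_complete) (auto simp: is_pd_def is_pd_val_def)

lemma stk_Suc_le: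
  assumes "q < length xs"
  shows "stk ((!) (code xs)) q = Suc (if pd xs q = 0 then 0 else stk ((!) (code xs)) (q - pd xs q))"
    and "stk ((!) (code xs)) q \<le> Suc (stk_at ((!) (code xs)) q 1)"
proof -
  show 1: "stk ((!) (code xs)) q = Suc (if pd xs q = 0 then 0 else stk ((!) (code xs)) (q - pd xs q))"
    using assms pd_le[of xs q] by (subst stk.simps) simp
  have "code xs ! k \<le> k" if "k \<le> q" for k using assms that pd_le[of xs k] by simp
  from stk_opts[OF pd_opts[OF assms] this] 1
  show "stk ((!) (code xs)) q \<le> Suc (stk_at ((!) (code xs)) q 1)" by simp
qed

text \<open>The number entered into the table is that of the first node beyond the branch, and the
  column is the symbol found in the row just written. Clearing \<open>xg\<close> at
  \<open>c = w ! q\<close> mirrors the guard of \<open>opts\<close>.\<close>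

definition gen_com :: "nat com" where
  "gen_com =
     copy_com ;;
     If (Equal (Reg xc) (Cell (Reg xW \<oplus> Reg xe)))
       (xd ::= Reg xe \<oplus> Const 1 ;; xg ::= Const 0) (xd ::= Reg xe) ;;
     Store (Reg xT \<oplus> (Reg xd \<otimes> Reg xN \<oplus> Cell (Reg xW \<oplus> (Reg xK \<oplus> Reg xd)))) (Reg xK \<oplus> Reg xd \<oplus> Const 1) ;;
     xK ::= Reg xK \<oplus> Reg xN ;;
     If (Equal (Reg xg) (Const 1))
       (xd ::= Cell (Reg xW \<oplus> (Reg xe \<ominus> Reg xc)) ;;
        If (Equal (Reg xd) (Const 0)) (xc ::= Const 0) (xc ::= Reg xc \<oplus> Reg xd))
       Skip"

definition rows_com :: "nat com" where
  "rows_com =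
     xK ::= Reg xN ;; xe ::= Const 0 ;;
     While (Less (Reg xe \<oplus> Const 1) PatLen)
       (If (Equal (Cell (Reg xW \<oplus> (Reg xe \<oplus> Const 1))) (Const 1))
          (If (Equal (Reg xe) (Const 0)) (xc ::= Const 0) (xc ::= Const 1) ;;
           xg ::= Const 1 ;;
           While (Equal (Reg xg) (Const 1)) gen_com)
          Skip ;;
        xe ::= Reg xe \<oplus> Const 1)"

section \<open>Writing one row for each option\<close>

context mach
begin

lemma node_inj: "c < N \<Longrightarrow> c' < N \<Longrightarrow> d * N + c = d' * N + c' \<longleftrightarrow> d = d' \<and> c = c'"
proof
  assume h: "c < N" "c' < N" "d * N + c = d' * N + c'"
  have "d = (d * N + c) div N" "c = (d * N + c) mod N" using h(1) by simp_all
  moreover have "d' = (d' * N + c') div N" "c' = (d' * N + c') mod N" using h(2) by simp_all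
  ultimately show "d = d' \<and> c = c'" unfolding h(3) by metis
qed simp

lemma node_lt: "c < N \<Longrightarrow> d < D \<Longrightarrow> d * N + c < D * N"
proof -
  assume "c < N" "d < D"
  then have "d * N + N \<le> D * N" using mult_le_mono1[of "Suc d" D N] by simp
  with \<open>c < N\<close> show ?thesis by simp
qed

text \<open>The third clause records that all other table cells are 0; it becomes the assumption
  \<open>br_sound\<close> of the trie, that is, the absence of spurious children.\<close>

definition tabs :: "nat list \<Rightarrow> (nat \<times> nat) list \<Rightarrow> (nat \<Rightarrow> int) \<Rightarrow> bool" where
  "tabs w ps f \<longleftrightarrow>
    (\<forall>i<Suc (length ps). (\<forall>k<m. f (wa + (i * N + k)) = int (rows w ps ! i ! k)) \<and> f (wa + (i * N + m)) = -1) \<and>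
    (\<forall>i<length ps. f (ta + (brk w (ps ! i) * N + key w (ps ! i))) = int (Suc i * N + Suc (brk w (ps ! i)))) \<and>
    (\<forall>d<N. \<forall>c<N. f (ta + (d * N + c)) = 0 \<or> (\<exists>i<length ps. d = brk w (ps ! i) \<and> c = key w (ps ! i)))"

lemma key_bounds:
  assumes "opt_ok w x" "length w = m" "\<And>k. k < m \<Longrightarrow> w ! k \<le> k"
  shows "brk w x < m" "key w x < N"
proof -
  obtain q c where x: "x = (q, c)" by (cases x)
  have q: "Suc q < length w" "c \<in> opts w q" using assms x by (auto simp: opt_ok_def)
  have "c \<le> q" using opts_le[OF q(2)] assms q by auto
  then show "brk w x < m" "key w x < N"
    using q assms(2) assms(3)[of q] unfolding x by (auto simp: brk_def key_eq N_def)
qed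

lemma tabs_snoc:
  assumes t: "tabs w ps f" and w: "length w = m" "\<And>k. k < m \<Longrightarrow> w ! k \<le> k"
    and ok: "\<And>y. y \<in> set ps \<Longrightarrow> opt_ok w y" "opt_ok w x" "x \<notin> set ps" and K: "Suc (length ps) < 2 * N"
    and row: "\<And>k. k < m \<Longrightarrow> g (wa + (Suc (length ps) * N + k)) = int (nbr w (fst x) (snd x) ! k)"
      "g (wa + (Suc (length ps) * N + m)) = -1"
    and g: "\<And>a. a < wa + Suc (length ps) * N \<or> wa + Suc (length ps) * N + N \<le> a \<Longrightarrow> g a = f a"
  shows "tabs w (ps @ [x])
    (g(ta + (brk w x * N + key w x) := int (Suc (length ps) * N + Suc (brk w x))))"
proof -
  let ?K = "Suc (length ps)"
  let ?h = "g(ta + (brk w x * N + key w x) := int (?K * N + Suc (brk w x)))"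
  have b: "brk w y < m" "key w y < N" if "opt_ok w y" for y
    using key_bounds[OF that w] by auto
  have KN: "?K * N + N \<le> 2 * (N * N)" using mult_le_mono1[of "Suc ?K" "2 * N" N] K by simp
  have low: "?h a = g a" if "a < wa + 2 * (N * N)" for a
    using that by (simp add: ta_def)
  have hi: "g a = f a" if "ta \<le> a" for a using that KN by (intro g) (simp add: ta_def)
  have R: "rows w (ps @ [x]) = rows w ps @ [nbr w (fst x) (snd x)]"
    by (simp add: rows_def case_prod_beta)
  have lr: "length (rows w ps) = ?K" by (simp add: rows_def)
  have rowi: "(\<forall>k<m. ?h (wa + (i * N + k)) = int (rows w (ps @ [x]) ! i ! k)) \<and> ?h (wa + (i * N + m)) = -1"
    if i: "i < Suc (length (ps @ [x]))" for i
  proof (cases "i = ?K")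
    case True
    have "?h (wa + (?K * N + k)) = g (wa + (?K * N + k))" if "k < N" for k
      using KN that by (intro low) simp
    then show ?thesis using True row R lr by (simp add: N_def nth_append)
  next
    case False
    with i have i': "i < ?K" by simp
    have "?h (wa + (i * N + k)) = f (wa + (i * N + k))" if "k < N" for k
    proof -
      have "i * N + k < ?K * N" by (rule node_lt[OF that i'])
      then show ?thesis using KN g[of "wa + (i * N + k)"] low[of "wa + (i * N + k)"] by simp
    qed
    moreover have "rows w (ps @ [x]) ! i = rows w ps ! i" using R lr i' by (simp add: nth_append)
    ultimately show ?thesis using t i' unfolding tabs_def by (simp add: N_def)
  qed
  \<comment> \<open>The cell of the new row cannot be taken: two different options would agree in
    branching depth and symbol, contradicting \<open>key_inj\<close>.\<close>
  have ne: "brk w (ps ! i) * N + key w (ps ! i) \<noteq> brk w x * N + key w x" if i: "i < length ps" for i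
  proof
    assume "brk w (ps ! i) * N + key w (ps ! i) = brk w x * N + key w x"
    then have "brk w (ps ! i) = brk w x \<and> key w (ps ! i) = key w x"
      using b ok i by (subst (asm) node_inj) auto
    then have "ps ! i = x" using key_inj ok i by (metis nth_mem)
    with i ok(3) show False by (metis nth_mem)
  qed
  have "?h (ta + (brk w ((ps @ [x]) ! i) * N + key w ((ps @ [x]) ! i))) =
      int (Suc i * N + Suc (brk w ((ps @ [x]) ! i)))" if i: "i < length (ps @ [x])" for i
  proof (cases "i = length ps")
    case True
    then show ?thesis by simp
  next
    case False
    with i have "i < length ps" by simp
    then show ?thesis using ne[of i] hi t unfolding tabs_def by (simp add: nth_append)
  qed
  moreover have "?h (ta + (d * N + c)) = 0 \<or>
      (\<exists>i<length (ps @ [x]). d = brk w ((ps @ [x]) ! i) \<and> c = key w ((ps @ [x]) ! i))" if dc: "d < N" "c < N" for d c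
  proof (cases "d * N + c = brk w x * N + key w x")
    case True
    then have "d = brk w x \<and> c = key w x" using node_inj dc b(2)[OF ok(2)] by simp
    then show ?thesis by (intro disjI2 exI[of _ "length ps"]) simp
  next
    case False
    then have "?h (ta + (d * N + c)) = f (ta + (d * N + c))" using hi by simp
    moreover have "f (ta + (d * N + c)) = 0 \<or> (\<exists>i<length ps. d = brk w (ps ! i) \<and> c = key w (ps ! i))"
      using t dc unfolding tabs_def by blast
    ultimately show ?thesis by (metis (no_types, lifting) length_append_singleton less_SucI nth_append)
  qed
  ultimately show ?thesis using rowi unfolding tabs_def by blast
qed

text \<open>The blocks free to change are exactly the rows and the branching table.\<close>

definition outside :: "(nat \<Rightarrow> int) \<Rightarrow> (nat \<Rightarrow> int) \<Rightarrow> bool" where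
  "outside f g \<longleftrightarrow> (\<forall>a. a < wa \<or> fa \<le> a \<and> a < ta \<or> ba \<le> a \<longrightarrow> g a = f a)"

text \<open>The options of a position are visited in the order of their distance, \<open>V\<close> being the ones
  before \<open>c\<close>; the distance 0 comes last.\<close>

definition visited :: "nat list \<Rightarrow> nat \<Rightarrow> nat set \<Rightarrow> nat \<Rightarrow> bool" where
  "visited w q V c \<longleftrightarrow> c \<in> opts w q \<and> V \<subseteq> opts w q \<and> (if q = 0 then 0 else 1) \<in> insert c V \<and>
     (\<forall>c'\<in>V. 0 < c' \<and> c' \<noteq> w ! q \<and> (c = 0 \<or> c' < c) \<and> nxt w q c' \<in> insert c V)"

lemma visited_start: "visited w q {} (if q = 0 then 0 else 1)"
  by (simp add: visited_def opts.start)

lemma visited_step: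
  assumes "visited w q V c" "c \<noteq> w ! q" "c \<noteq> 0"
  shows "visited w q (insert c V) (nxt w q c)"
proof -
  have "nxt w q c \<in> opts w q" using assms by (auto simp: visited_def intro: opts.step)
  moreover have "nxt w q c = 0 \<or> c < nxt w q c" by (auto simp: nxt_def)
  ultimately show ?thesis using assms unfolding visited_def by auto
qed

lemma visited_end:
  assumes "visited w q V c" "c = w ! q"
  shows "opts w q = insert c V"
proof
  show "opts w q \<subseteq> insert c V"
  proof
    fix c' assume "c' \<in> opts w q"
    then show "c' \<in> insert c V"
      by induction (use assms in \<open>auto simp: visited_def\<close>)
  qed
qed (use assms in \<open>auto simp: visited_def\<close>)

lemma gen_com_wp:
  assumes c: "cfg (reg s)" and t: "tabs w ps (mem s)"
    and w: "length w = m" "\<And>k. k < m \<Longrightarrow> w ! k \<le> k"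
    and ok: "\<And>y. y \<in> set ps \<Longrightarrow> opt_ok w y" "opt_ok w (q, c)" "(q, c) \<notin> set ps"
    and K: "Suc (length ps) < 2 * N"
    and r: "reg s xe = int q" "reg s xc = int c" "reg s xK = int (Suc (length ps) * N)" "reg s xg = 1"
    and F: "F \<ge> R + 40 * int m + 80" and R: "0 \<le> R"
    and Q: "\<And>s' F'. cfg (reg s') \<Longrightarrow> tabs w (ps @ [(q, c)]) (mem s') \<Longrightarrow> outside (mem s) (mem s') \<Longrightarrow>
      outp s' = outp s \<Longrightarrow> reg s' xe = int q \<Longrightarrow> reg s' xK = int (Suc (Suc (length ps)) * N) \<Longrightarrow>
      reg s' xg = (if c = w ! q then 0 else 1) \<Longrightarrow>
      (c \<noteq> w ! q \<Longrightarrow> reg s' xc = int (nxt w q c)) \<Longrightarrow> R \<le> F' \<Longrightarrow> Q s' F'"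
  shows "wp M gen_com Q s F"
proof -
  define K where "K = Suc (length ps)"
  define rest2 where "rest2 = If (Equal (Reg xg) (Const 1))
       (xd ::= Cell (Reg xW \<oplus> (Reg xe \<ominus> Reg xc)) ;;
        If (Equal (Reg xd) (Const 0)) (xc ::= Const 0) (xc ::= Reg xc \<oplus> Reg xd))
       Skip"
  define rest where "rest = Store (Reg xT \<oplus> (Reg xd \<otimes> Reg xN \<oplus> Cell (Reg xW \<oplus> (Reg xK \<oplus> Reg xd)))) (Reg xK \<oplus> Reg xd \<oplus> Const 1) ;;
     xK ::= Reg xK \<oplus> Reg xN ;; rest2"
  have q: "Suc q < m" "c \<in> opts w q" using ok(2) w(1) by (auto simp: opt_ok_def)
  have cq: "c \<le> q" using opts_le[OF q(2)] w(2) q(1) by simp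
  have w0: "mem s (wa + k) = int (w ! k)" if "k < m" for k
  proof -
    have "\<forall>k<m. mem s (wa + (0 * N + k)) = int (rows w ps ! 0 ! k)" using t unfolding tabs_def by blast
    with that show ?thesis by (simp add: rows_def)
  qed
  define d where "d = brk w (q, c)"
  define ky where "ky = key w (q, c)"
  have kb: "d < m" "ky < N" using key_bounds[OF ok(2) w] by (simp_all add: d_def ky_def)
  have KN: "K * N + N \<le> 2 * (N * N)" using mult_le_mono1[of "Suc K" "2 * N" N] K by (simp add: K_def)
  have N1: "N \<le> K * N" by (simp add: K_def)
  have fit': "wa + 6 * (N * N) \<le> cells M" using fit by (simp add: N_def)
  have dky: "d * N + ky < N * N" using kb node_lt[of ky d N] by (simp add: N_def)
  have b: "int q + 1 \<le> word_max M" "int d \<le> word_max M" "int (K * N + d) \<le> word_max M" "int (wa + (K * N + d)) \<le> word_max M"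
     "wa + (K * N + d) < cells M" "int (d * N) \<le> word_max M" "int (d * N + ky) \<le> word_max M"
     "int (ta + (d * N + ky)) \<le> word_max M" "ta + (d * N + ky) < cells M"
     "int (K * N + d) + 1 \<le> word_max M" "int (K * N + N) \<le> word_max M"
     "int (q - c) \<le> word_max M" "int (wa + (q - c)) \<le> word_max M" "wa + (q - c) < cells M"
     "int (wa + q) \<le> word_max M" "wa + q < cells M"
    using fit' word_bound KN N_le dky kb q(1) unfolding ta_def by linarith+
  have sub: "int q - int c = int (q - c)" using cq by (simp add: of_nat_diff)
  have wqc: "w ! (q - c) \<le> q - c" using w(2) q(1) by simp
  have b2: "int (c + w ! (q - c)) \<le> word_max M" using wqc cq q(1) word_bound by simp
  show ?thesis
    unfolding gen_com_def wp_Seq[of M copy_com]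
  proof (rule copy_com_wp[OF c w(1) w0 w(2) r(1) q(1) r(2), where R = "R + 50"])
    show "reg s xK = int (K * N)" "0 < K" "K < 2 * N" using r K by (simp_all add: K_def)
    show "R + 50 + 40 * int m + 20 \<le> F" "0 \<le> R + 50" using F R by simp_all
    fix u :: "nat state" and G
    assume u: "cfg (reg u)" "reg u xe = int q" "reg u xc = int c" "reg u xK = int (K * N)" "reg u xg = reg s xg"
      and row: "\<And>k. k < m \<Longrightarrow> mem u (wa + (K * N + k)) = int (nbr w q c ! k)" "mem u (wa + (K * N + m)) = -1"
      and oth: "\<And>a. a < wa + K * N \<or> wa + K * N + N \<le> a \<Longrightarrow> mem u a = mem s a"
      and o: "outp u = outp s" and G: "R + 50 \<le> G"
    have uw: "mem u (wa + k) = int (w ! k)" if "k < m" for k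
      using that w0 N1 oth[of "wa + k"] by (simp add: N_def)
    have uk: "mem u (wa + (K * N + d)) = int ky" using row(1)[OF kb(1)] by (simp add: ky_def d_def key_def)
    have tb: "tabs w (ps @ [(q, c)]) ((mem u)(ta + (d * N + ky) := int (K * N + d) + 1))"
    proof -
      have "tabs w (ps @ [(q, c)]) ((mem u)(ta + (brk w (q, c) * N + key w (q, c)) :=
          int (Suc (length ps) * N + Suc (brk w (q, c)))))"
        by (rule tabs_snoc[OF t w ok K])
          (use row oth in \<open>simp_all only: K_def fst_conv snd_conv\<close>)
      moreover have "int (Suc (length ps) * N + Suc (brk w (q, c))) = int (K * N + d) + 1"
        by (simp add: K_def d_def)
      ultimately show ?thesis by (simp only: d_def ky_def)
    qed
    have ne: "wa + (q - c) \<noteq> ta + (d * N + ky)" using q(1) N_le unfolding ta_def by linarith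
    have out: "outside (mem s) ((mem u)(ta + (d * N + ky) := v))" for v
      unfolding outside_def
    proof (intro allI impI)
      fix a assume a: "a < wa \<or> fa \<le> a \<and> a < ta \<or> ba \<le> a"
      then have "a \<noteq> ta + (d * N + ky)" using dky by (auto simp: ta_def fa_def ba_def)
      moreover have "mem u a = mem s a" using a KN by (intro oth) (auto simp: fa_def ta_def ba_def)
      ultimately show "((mem u)(ta + (d * N + ky) := v)) a = mem s a" by simp
    qed
    define MM where "MM = (mem u)(ta + (d * N + ky) := int (K * N + d) + 1)"
    have MMw: "MM (wa + (q - c)) = int (w ! (q - c))" using ne uw[of "q - c"] q(1) by (simp add: MM_def)
    have fin: "Q z Z" if "cfg (reg z)" "mem z = MM" "outp z = outp u"
      "reg z xe = int q" "reg z xK = int (K * N + N)" "reg z xg = (if c = w ! q then 0 else 1)"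
      "c \<noteq> w ! q \<Longrightarrow> reg z xc = int (nxt w q c)" "R \<le> Z" for z :: "nat state" and Z
    proof (rule Q)
      show "tabs w (ps @ [(q, c)]) (mem z)" "outside (mem s) (mem z)"
        unfolding that(2) MM_def by (fact tb, fact out)
      have "K * N + N = Suc (Suc (length ps)) * N" by (simp add: K_def)
      then show "reg z xK = int (Suc (Suc (length ps)) * N)" using that(5) by (simp only:)
    qed (use that o in simp_all)
    have rest2: "wp M rest2 Q z Z" if z: "cfg (reg z)" "mem z = MM" "outp z = outp u"
      "reg z xe = int q" "reg z xc = int c" "reg z xK = int (K * N + N)"
      "reg z xg = (if c = w ! q then 0 else 1)" "R + 15 \<le> Z" for z :: "nat state" and Z
    proof (cases "c = w ! q")
      case True
      have "Q z (Z - 3)" by (rule fin) (use z True in simp_all)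
      then show ?thesis using True z(7) unfolding rest2_def by simp
    next
      case False
      have nx: "nxt w q c = (if w ! (q - c) = 0 then 0 else c + w ! (q - c))" by (simp add: nxt_def)
      have fin': "Q y Y" if "reg y = (reg z)(xd := v, xc := int (nxt w q c))" "mem y = MM" "outp y = outp u" "Y \<ge> Z - 15"
        for y :: "nat state" and Y v
        by (rule fin) (use that z False in simp_all)
      show ?thesis
      proof (cases "w ! (q - c) = 0")
        case True
        then have "nxt w q c = 0" by (simp add: nxt_def)
        with fin' have "Q (z\<lparr>reg := (reg z)(xd := 0, xc := 0)\<rparr>) Y" if "Y \<ge> Z - 15" for Y
          using that z(2,3) by simp
        then show ?thesis using False True unfolding rest2_def
          by (simp add: z cfgD[OF z(1)] sub b MMw of_nat_add[symmetric] del: of_nat_add of_nat_diff)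
      next
        case nz: False
        then have "int (nxt w q c) = int (c + w ! (q - c))" by (simp add: nxt_def)
        with fin' have "Q (z\<lparr>reg := (reg z)(xd := int (w ! (q - c)), xc := int (c + w ! (q - c)))\<rparr>) Y" if "Y \<ge> Z - 15" for Y
          using that z(2,3) by simp
        then show ?thesis using False nz unfolding rest2_def
          by (simp add: z cfgD[OF z(1)] sub b b2 MMw of_nat_add[symmetric] del: of_nat_add of_nat_diff)
      qed
    qed
    have rest: "wp M rest Q v H"
      if v: "cfg (reg v)" "reg v xd = int d" "reg v xe = int q" "reg v xc = int c" "reg v xK = int (K * N)"
        "reg v xg = (if c = w ! q then 0 else 1)" "mem v = mem u" "outp v = outp u" "G - 10 \<le> H"
      for v :: "nat state" and H
    proof -
      have "wp M rest2 Q (v\<lparr>mem := MM, reg := (reg v)(xK := int (K * N + N))\<rparr>) Z" if "Z \<ge> H - 25" for Z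
        by (rule rest2) (use that v G in simp_all)
      then show ?thesis unfolding rest_def MM_def
        by (simp add: v(2-5,7) cfgD[OF v(1)] uk b of_nat_add[symmetric] of_nat_mult[symmetric]
              del: of_nat_add of_nat_mult)
    qed
    have wq: "mem u (wa + q) = int (w ! q)" using uw q(1) by simp
    have "wp M (If (Equal (Reg xc) (Cell (Reg xW \<oplus> Reg xe)))
       (xd ::= Reg xe \<oplus> Const 1 ;; xg ::= Const 0) (xd ::= Reg xe) ;; rest) Q u G"
    proof (cases "c = w ! q")
      case True
      then have "int q + 1 = int d" by (simp add: d_def brk_def)
      then show ?thesis using True u G wq r(4)
        by (simp add: cfgD[OF u(1)] b of_nat_add[symmetric] rest del: of_nat_add)
    next
      case False
      then have "d = q" by (simp add: d_def brk_def)
      then show ?thesis using False u G wq r(4)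
        by (simp add: cfgD[OF u(1)] b of_nat_add[symmetric] rest del: of_nat_add)
    qed
    then show "wp M (If (Equal (Reg xc) (Cell (Reg xW \<oplus> Reg xe)))
       (xd ::= Reg xe \<oplus> Const 1 ;; xg ::= Const 0) (xd ::= Reg xe) ;;
     Store (Reg xT \<oplus> (Reg xd \<otimes> Reg xN \<oplus> Cell (Reg xW \<oplus> (Reg xK \<oplus> Reg xd)))) (Reg xK \<oplus> Reg xd \<oplus> Const 1) ;;
     xK ::= Reg xK \<oplus> Reg xN ;;
     If (Equal (Reg xg) (Const 1))
       (xd ::= Cell (Reg xW \<oplus> (Reg xe \<ominus> Reg xc)) ;;
        If (Equal (Reg xd) (Const 0)) (xc ::= Const 0) (xc ::= Reg xc \<oplus> Reg xd))
       Skip) Q u G"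
      unfolding rest_def rest2_def .
  qed
qed

lemma outside_trans: "outside f g \<Longrightarrow> outside g h \<Longrightarrow> outside f h"
  by (simp add: outside_def)

lemma outside_refl: "outside f f"
  by (simp add: outside_def)

text \<open>The stack members from the current option downwards; moving to the next option uses up
  one of them.\<close>

definition potential :: "nat list \<Rightarrow> nat \<Rightarrow> nat \<Rightarrow> nat" where
  "potential w q c = (if c = 0 then 0 else stk ((!) w) (q - c))"

text \<open>The sum of the number of rows and the stack height is what stays bounded. Moving from
  one option to the next trades a stack member for a row. Only the row of the last option and the
  push of \<open>q\<close> are not compensated, so the sum grows by at most 2 per position.\<close>

lemma gen_loop_wp:
  assumes c: "cfg (reg s)" and t: "tabs w ps (mem s)" and wx: "w = code xs" "length xs = m"
    and set: "set ps = {(q', c). q' < q \<and> opt_ok w (q', c)}"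
    and K: "Suc (length ps) + stk_at ((!) w) q 1 \<le> 2 * q + 1"
    and q: "Suc q < m" "w ! Suc q = 1"
    and r: "reg s xe = int q" "reg s xc = (if q = 0 then 0 else 1)" "reg s xK = int (Suc (length ps) * N)" "reg s xg = 1"
    and F: "F \<ge> R + (40 * int m + 90) * (2 * int N - int (length ps)) + 10" and R: "0 \<le> R"
    and Q: "\<And>s' F' ps'. cfg (reg s') \<Longrightarrow> tabs w ps' (mem s') \<Longrightarrow> outside (mem s) (mem s') \<Longrightarrow>
      outp s' = outp s \<Longrightarrow> reg s' xe = int q \<Longrightarrow> reg s' xK = int (Suc (length ps') * N) \<Longrightarrow>
      set ps' = {(q', c). q' < Suc q \<and> opt_ok w (q', c)} \<Longrightarrow>
      Suc (length ps') + stk ((!) w) q \<le> 2 * q + 3 \<Longrightarrow>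
      R + (40 * int m + 90) * (2 * int N - int (length ps')) \<le> F' \<Longrightarrow> Q s' F'"
  shows "wp M (While (Equal (Reg xg) (Const 1)) gen_com) Q s F"
proof -
  have w: "length w = m" "w ! k \<le> k" if "k < m" for k
    using wx that pd_le[of xs k] by auto
  have wl: "length w = m" using wx by simp
  \<comment> \<open>Pays for one row, including copying it and the iteration around it;
    \<open>2 * N\<close> minus the number of rows written so far counts the shares left in the
    budget.\<close>
  define A where "A = 40 * int m + 90"
  define B where "B = (\<lambda>(s' :: nat state) ps'. cfg (reg s') \<and> tabs w ps' (mem s') \<and> outside (mem s) (mem s') \<and>
     outp s' = outp s \<and> reg s' xe = int q \<and> reg s' xK = int (Suc (length ps') * N))"
  define I1 where "I1 = (\<lambda>(s' :: nat state) F' ps' c V. B s' ps' \<and> reg s' xg = 1 \<and> reg s' xc = int c \<and>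
     set ps' = set ps \<union> {q} \<times> V \<and> visited w q V c \<and>
     Suc (length ps') + potential w q c \<le> 2 * q + 1 \<and> F' \<ge> R + A * (2 * int N - int (length ps')) + 10)"
  define I0 where "I0 = (\<lambda>(s' :: nat state) F' ps'. B s' ps' \<and> reg s' xg = 0 \<and>
     set ps' = {(q', c). q' < Suc q \<and> opt_ok w (q', c)} \<and>
     Suc (length ps') + stk ((!) w) q \<le> 2 * q + 3 \<and> F' \<ge> R + A * (2 * int N - int (length ps')) + 10)"
  define I where "I = (\<lambda>s' F'. (\<exists>ps' c V. I1 s' F' ps' c V) \<or> (\<exists>ps'. I0 s' F' ps'))"
  have II1: "I s' F'" if "I1 s' F' ps' c V" for s' F' ps' c V
    unfolding I_def by (rule disjI1, rule exI, rule exI, rule exI) (rule that)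
  have II0: "I s' F'" if "I0 s' F' ps'" for s' F' ps'
    unfolding I_def by (rule disjI2, rule exI) (rule that)
  have Apos: "0 \<le> A * (2 * int N - int (length ps'))" if "Suc (length ps') \<le> 2 * q + 3" for ps' :: "(nat \<times> nat) list"
    using that q(1) by (intro mult_nonneg_nonneg) (auto simp: A_def N_def)
  have body: "wp M gen_com I s' (F' - 2)" if I1: "I1 s' F' ps' c V" for s' F' ps' c V
  proof -
    have B: "cfg (reg s')" "tabs w ps' (mem s')" "outside (mem s) (mem s')"
     "outp s' = outp s" "reg s' xe = int q" "reg s' xK = int (Suc (length ps') * N)"
      and g: "reg s' xg = 1" "reg s' xc = int c" and sp: "set ps' = set ps \<union> {q} \<times> V"
      and vis: "visited w q V c" and KK: "Suc (length ps') + potential w q c \<le> 2 * q + 1"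
      and F': "F' \<ge> R + A * (2 * int N - int (length ps')) + 10"
      using I1 by (simp_all add: I1_def B_def)
    have co: "c \<in> opts w q" "V \<subseteq> opts w q" "c \<notin> V" using vis by (auto simp: visited_def)
    have ok: "opt_ok w (q, c)" using co(1) q wl by (simp add: opt_ok_def)
    have ok': "opt_ok w y" if "y \<in> set ps'" for y
      using that sp set co(2) q wl by (auto simp: opt_ok_def)
    have nin: "(q, c) \<notin> set ps'" using sp set co(3) by auto
    have K2: "Suc (length ps') < 2 * N" using KK q(1) by (simp add: N_def)
    have dist: "A * (2 * int N - int (length ps')) = A * (2 * int N - int (Suc (length ps'))) + A"
      by (simp add: algebra_simps)
    have nn: "0 \<le> A * (2 * int N - int (Suc (length ps')))"
      using Apos[of "(0,0) # ps'"] KK by simp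
    have wk: "w ! k \<le> k" if "k \<le> q" for k using w that q(1) by simp
    show ?thesis
    proof (rule gen_com_wp[OF B(1,2) wl w(2) ok' ok nin K2 B(5) g(2) B(6) g(1),
          where R = "R + A * (2 * int N - int (Suc (length ps'))) + 10"])
      show "R + A * (2 * int N - int (Suc (length ps'))) + 10 + 40 * int m + 80 \<le> F' - 2"
        using F' dist by (simp add: A_def)
      show "0 \<le> R + A * (2 * int N - int (Suc (length ps'))) + 10" using R nn by simp
      fix t :: "nat state" and G
      assume t: "cfg (reg t)" "tabs w (ps' @ [(q, c)]) (mem t)" "outside (mem s') (mem t)" "outp t = outp s'"
        "reg t xe = int q" "reg t xK = int (Suc (Suc (length ps')) * N)"
        and tg: "reg t xg = (if c = w ! q then 0 else 1)"
        and tc: "c \<noteq> w ! q \<Longrightarrow> reg t xc = int (nxt w q c)"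
        and G: "R + A * (2 * int N - int (Suc (length ps'))) + 10 \<le> G"
      have Bt: "B t (ps' @ [(q, c)])"
        using t B outside_trans[OF B(3) t(3)] unfolding B_def by simp
      have sp': "set (ps' @ [(q, c)]) = set ps \<union> {q} \<times> insert c V" using sp by auto
      show "I t G"
      proof (cases "c = w ! q")
        case True
        have "opts w q = insert c V" using visited_end[OF vis True] .
        then have "set (ps' @ [(q, c)]) = {(q', c). q' < Suc q \<and> opt_ok w (q', c)}"
          unfolding sp' set using q wl by (auto simp: opt_ok_def less_Suc_eq)
        moreover have "stk ((!) w) q = Suc (potential w q c)"
          using stk_Suc_le(1)[of q xs] wx q(1) True by (simp add: potential_def)
        ultimately have "I0 t G (ps' @ [(q, c)])"
          unfolding I0_def using Bt tg True KK G by simp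
        then show ?thesis by (rule II0)
      next
        case False
        \<comment> \<open>The distance 0 has no successor on the chain, so by then all options are
          in \<open>insert c V\<close>. Since \<open>w ! q\<close> is an option that
          \<open>visited\<close> keeps out of \<open>V\<close>, it must be 0.\<close>
        have "w ! q = 0" if "c = 0"
        proof -
          have "opts w q \<subseteq> insert c V"
          proof
            fix c' assume "c' \<in> opts w q"
            then show "c' \<in> insert c V"
              by induction (use vis that in \<open>auto simp: visited_def\<close>)
          qed
          moreover have "w ! q \<in> opts w q" using pd_opts[of q xs] wx q(1) by simp
          ultimately show ?thesis using that vis by (auto simp: visited_def)
        qed
        then have c0: "c \<noteq> 0" using False by auto
        have "potential w q (nxt w q c) + 1 = potential w q c"
          using stk_nxt[OF co(1) wk c0] c0 by (simp add: potential_def)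
        moreover have "visited w q (insert c V) (nxt w q c)" by (rule visited_step[OF vis False c0])
        ultimately have "I1 t G (ps' @ [(q, c)]) (nxt w q c) (insert c V)"
          unfolding I1_def using Bt tg tc False KK G sp' by simp
        then show ?thesis by (rule II1)
      qed
    qed
  qed
  have init: "I1 s F ps (if q = 0 then 0 else 1) {}"
    unfolding I1_def B_def using c t r F visited_start[of w q] K
    by (simp add: outside_refl A_def potential_def stk_at_def split: if_splits)
  show ?thesis
  proof (rule wp_While[where I = I])
    show "I s F" using init by (rule II1)
    fix s' F' assume "I s' F'"
    then consider ps' c V where "I1 s' F' ps' c V" | ps' where "I0 s' F' ps'" 
      unfolding I_def by (elim disjE exE)
    then show "0 \<le> F' \<and> tt M s' (Equal (Reg xg) (Const 1))
       (\<lambda>v. (v \<longrightarrow> wp M gen_com I s' (F' - 1 - int (test_ops (Equal (Reg xg) (Const 1))))) \<and>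
         (\<not> v \<longrightarrow> Q s' (F' - 1 - int (test_ops (Equal (Reg xg) (Const 1))))))"
    proof cases
      case 1
      then have "reg s' xg = 1" "Suc (length ps') \<le> 2 * q + 3" "F' \<ge> R + A * (2 * int N - int (length ps')) + 10"
        unfolding I1_def by auto
      then show ?thesis using body[OF 1] Apos[of ps'] R by simp
    next
      case 2
      then have I0: "B s' ps'" "reg s' xg = 0" "set ps' = {(q', c). q' < Suc q \<and> opt_ok w (q', c)}"
        "Suc (length ps') + stk ((!) w) q \<le> 2 * q + 3" "F' \<ge> R + A * (2 * int N - int (length ps')) + 10"
        unfolding I0_def by auto
      have "Q s' (F' - 2)"
        by (rule Q[of _ ps']) (use I0 in \<open>simp_all add: B_def A_def\<close>)
      then show ?thesis using I0 Apos[of ps'] R by simp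
    qed
  qed
qed

lemma rows_com_wp:
  assumes c: "cfg (reg s)" and wx: "w = code xs" "length xs = m"
    and row: "\<And>k. k < m \<Longrightarrow> mem s (wa + k) = int (w ! k)" "mem s (wa + m) = -1"
    and zero: "\<And>a. ta \<le> a \<Longrightarrow> a < ba \<Longrightarrow> mem s a = 0"
    and F: "F \<ge> R + (40 * int m + 90) * (2 * int N) + 40 * int m + 30" and R: "0 \<le> R"
    and Q: "\<And>s' F' ps. cfg (reg s') \<Longrightarrow> tabs w ps (mem s') \<Longrightarrow> outside (mem s) (mem s') \<Longrightarrow>
      outp s' = outp s \<Longrightarrow> reg s' xK = int (Suc (length ps) * N) \<Longrightarrow>
      set ps = {x. opt_ok w x} \<Longrightarrow> Suc (length ps) \<le> 2 * N \<Longrightarrow> R \<le> F' \<Longrightarrow> Q s' F'"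
  shows "wp M rows_com Q s F"
proof -
  define A where "A = 40 * int m + 90"
  define loop where "loop = While (Equal (Reg xg) (Const 1)) gen_com"
  define inc where "inc = (xe ::= Reg xe \<oplus> Const 1)"
  define body where "body = If (Equal (Cell (Reg xW \<oplus> (Reg xe \<oplus> Const 1))) (Const 1))
          (If (Equal (Reg xe) (Const 0)) (xc ::= Const 0) (xc ::= Const 1) ;;
           xg ::= Const 1 ;; loop)
          Skip ;; inc"
  have wl: "length w = m" using wx by simp
  have wk: "w ! k \<le> k" if "k < m" for k using wx that pd_le[of xs k] by simp
  have N_pos: "0 < N" by (simp add: N_def)
  define B where "B = (\<lambda>(s' :: nat state) q ps. cfg (reg s') \<and> tabs w ps (mem s') \<and> outside (mem s) (mem s') \<and>
     outp s' = outp s \<and> reg s' xe = int q \<and> reg s' xK = int (Suc (length ps) * N) \<and>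
     set ps = {(q', c). q' < q \<and> opt_ok w (q', c)} \<and> Suc (length ps) + stk_at ((!) w) q 1 \<le> 2 * q + 1)"
  define I where "I = (\<lambda>(s' :: nat state) F'. \<exists>q ps. q < m \<and> B s' q ps \<and>
     F' \<ge> R + A * (2 * int N - int (length ps)) + 40 * (int m - int q) + 20)"
  have II: "I s' F'" if "q < m" "B s' q ps" "F' \<ge> R + A * (2 * int N - int (length ps)) + 40 * (int m - int q) + 20"
    for s' F' q ps
    unfolding I_def by (rule exI[of _ q], rule exI[of _ ps]) (use that in simp)
  have Apos: "0 \<le> A * (2 * int N - int (length ps'))" if "Suc (length ps') \<le> 2 * q + 3" "q < m" for q and ps' :: "(nat \<times> nat) list"
    using that by (intro mult_nonneg_nonneg) (auto simp: A_def N_def)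
  have big: "wa + N \<le> cells M" using fit N_le unfolding N_def by linarith
  have init: "tabs w [] (mem s)"
    unfolding tabs_def
  proof (intro conjI allI impI)
    fix d c assume "d < N" "c < N"
    then have "d * N + c < N * N" by (intro node_lt)
    then show "mem s (ta + (d * N + c)) = 0 \<or> (\<exists>i<length []. d = brk w ([] ! i) \<and> c = key w ([] ! i))"
      by (intro disjI1 zero) (simp_all add: ta_def ba_def)
  qed (use row in \<open>simp_all add: rows_def\<close>)
  have wpb: "wp M body I s' (F' - 3)"
    if q: "q < m" and B: "B s' q ps" and F': "F' \<ge> R + A * (2 * int N - int (length ps)) + 40 * (int m - int q) + 20"
      and lt: "Suc q < m" for s' F' q ps
  proof -
    have b: "cfg (reg s')" "tabs w ps (mem s')" "outside (mem s) (mem s')" "outp s' = outp s"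
      "reg s' xe = int q" "reg s' xK = int (Suc (length ps) * N)"
      "set ps = {(q', c). q' < q \<and> opt_ok w (q', c)}" "Suc (length ps) + stk_at ((!) w) q 1 \<le> 2 * q + 1"
      using B by (simp_all add: B_def)
    have "\<forall>k<m. mem s' (wa + (0 * N + k)) = int (rows w ps ! 0 ! k)" using b(2) unfolding tabs_def by blast
    then have "\<forall>k<m. mem s' (wa + k) = int (w ! k)" by (simp add: rows_def)
    with lt have cell: "mem s' (wa + Suc q) = int (w ! Suc q)" by blast
    have bnd: "int q + 1 \<le> word_max M" "int (Suc q) \<le> word_max M" "int (wa + Suc q) \<le> word_max M" "wa + Suc q < cells M"
      using big word_bound lt unfolding N_def by linarith+
    have sq: "int q + 1 = int (Suc q)" by simp
    have nextq: "wp M inc I t G"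
      if "cfg (reg t)" "tabs w ps' (mem t)" "outside (mem s) (mem t)" "outp t = outp s" "reg t xe = int q"
        "reg t xK = int (Suc (length ps') * N)" "set ps' = {(q', c). q' < Suc q \<and> opt_ok w (q', c)}"
        "Suc (length ps') + stk ((!) w) q \<le> 2 * q + 3"
        "G \<ge> R + A * (2 * int N - int (length ps')) + 40 * (int m - int q) - 10" for t :: "nat state" and G ps'
    proof -
      have "B (t\<lparr>reg := (reg t)(xe := int q + 1)\<rparr>) (Suc q) ps'"
        unfolding B_def using that by (simp add: stk_at_def)
      then have "I (t\<lparr>reg := (reg t)(xe := int q + 1)\<rparr>) (G - 2)"
        by (rule II[OF lt]) (use that(9) in simp)
      then show ?thesis using that(5) bnd by (simp add: inc_def)
    qed
    have rq: "wp M loop (wp M inc I) t G"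
      if asc: "w ! Suc q = 1" and t: "reg t = (reg s')(xc := (if q = 0 then 0 else 1), xg := 1)" "mem t = mem s'" "outp t = outp s'"
        "G \<ge> F' - 16" for t :: "nat state" and G
      unfolding loop_def
    proof (rule gen_loop_wp[OF _ _ wx, where ps = ps and q = q and R = "R + 40 * (int m - int q) - 10"])
      show "cfg (reg t)" "tabs w ps (mem t)" "set ps = {(q', c). q' < q \<and> opt_ok w (q', c)}"
        "Suc (length ps) + stk_at ((!) w) q 1 \<le> 2 * q + 1" "Suc q < m" "w ! Suc q = 1"
        "reg t xe = int q" "reg t xc = (if q = 0 then 0 else 1)" "reg t xK = int (Suc (length ps) * N)" "reg t xg = 1"
        using b lt asc by (simp_all add: t)
      show "R + 40 * (int m - int q) - 10 + (40 * int m + 90) * (2 * int N - int (length ps)) + 10 \<le> G"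
        using t(4) F' by (simp add: A_def)
      show "0 \<le> R + 40 * (int m - int q) - 10" using R q by simp
      fix s'' :: "nat state" and F'' ps'
      assume h: "cfg (reg s'')" "tabs w ps' (mem s'')" "outside (mem t) (mem s'')" "outp s'' = outp t"
        "reg s'' xe = int q" "reg s'' xK = int (Suc (length ps') * N)" 
        "set ps' = {(q', c). q' < Suc q \<and> opt_ok w (q', c)}" "Suc (length ps') + stk ((!) w) q \<le> 2 * q + 3"
        "R + 40 * (int m - int q) - 10 + (40 * int m + 90) * (2 * int N - int (length ps')) \<le> F''"
      have "outside (mem s) (mem s'')" using outside_trans b(3) h(3) t(2) by metis
      then show "wp M inc I s'' F''"
        by (rule nextq[OF h(1,2) _ _ h(5-8)]) (use h b t in \<open>simp_all add: A_def\<close>)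
    qed
    show ?thesis
    proof (cases "w ! Suc q = 1")
      case True
      define E where "E = Suc q"
      from True cell have *: "mem s' (wa + E) = 1" by (simp add: E_def)
      show ?thesis unfolding body_def
        by (simp add: b(5) cfgD[OF b(1)] bnd[folded E_def] sq[folded E_def] * rq[OF True]
            of_nat_add[symmetric] del: of_nat_add)
    next
      case False
      have "Suc (length ps) + stk ((!) w) q \<le> 2 * q + 3"
        using stk_Suc_le(2)[of q xs] wx q b(8) by simp
      moreover have "set ps = {(q', c). q' < Suc q \<and> opt_ok w (q', c)}"
        unfolding b(7) using False by (auto simp: opt_ok_def less_Suc_eq)
      ultimately have nx: "wp M inc I s' G" if "G \<ge> F' - 20" for G
        by (intro nextq[OF b(1-6)]) (use that F' in simp_all)
      define E where "E = Suc q"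
      have *: "mem s' (wa + E) \<noteq> 1" using False cell by (simp add: E_def)
      show ?thesis unfolding body_def
        by (simp add: * nx b(5) cfgD[OF b(1)] bnd[folded E_def] sq[folded E_def] of_nat_add[symmetric] del: of_nat_add)
    qed
  qed
  have "wp M (While (Less (Reg xe \<oplus> Const 1) PatLen) body) Q
    (s\<lparr>reg := (reg s)(xK := int N, xe := 0)\<rparr>) (F - 2)"
  proof (rule wp_While[where I = I])
    have "B (s\<lparr>reg := (reg s)(xK := int N, xe := 0)\<rparr>) 0 []"
      unfolding B_def using c init by (simp add: outside_refl stk_at_def)
    then show "I (s\<lparr>reg := (reg s)(xK := int N, xe := 0)\<rparr>) (F - 2)"
      by (rule II[OF m_pos]) (use F in \<open>simp add: A_def\<close>)
  next
    fix s' F' assume "I s' F'"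
    then obtain q ps where q: "q < m" and B: "B s' q ps" and
      F': "F' \<ge> R + A * (2 * int N - int (length ps)) + 40 * (int m - int q) + 20"
      unfolding I_def by (elim exE conjE)
    have b: "cfg (reg s')" "tabs w ps (mem s')" "outside (mem s) (mem s')" "outp s' = outp s"
      "reg s' xe = int q" "reg s' xK = int (Suc (length ps) * N)"
      "set ps = {(q', c). q' < q \<and> opt_ok w (q', c)}" "Suc (length ps) + stk_at ((!) w) q 1 \<le> 2 * q + 1"
      using B by (simp_all add: B_def)
    have nn: "0 \<le> A * (2 * int N - int (length ps))" using Apos[of ps q] b(8) q by simp
    have m': "0 < int m - int q" using q by simp
    have fin: "Q s' (F' - 3)" if "\<not> Suc q < m"
    proof (rule Q[OF b(1-4,6)])
      show "set ps = {x. opt_ok w x}" unfolding b(7) using that q wl by (auto simp: opt_ok_def)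
      show "Suc (length ps) \<le> 2 * N" using b(8) q by (simp add: N_def)
      show "R \<le> F' - 3" using F' nn m' by simp
    qed
    have "int q + 1 < int m \<longleftrightarrow> Suc q < m" by linarith
    moreover have "\<bar>int q + 1\<bar> \<le> word_max M" using q word_bound by simp
    moreover have "0 \<le> F'" using F' nn m' R by simp
    ultimately show "0 \<le> F' \<and> tt M s' (Less (Reg xe \<oplus> Const 1) PatLen)
       (\<lambda>v. (v \<longrightarrow> wp M body I s' (F' - 1 - int (test_ops (Less (Reg xe \<oplus> Const 1) PatLen)))) \<and>
         (\<not> v \<longrightarrow> Q s' (F' - 1 - int (test_ops (Less (Reg xe \<oplus> Const 1) PatLen)))))"
      using wpb[OF q B F'] fin by (simp add: b(5) pat_len)
  qed
  then show ?thesis unfolding rows_com_def body_def loop_def inc_def by (simp add: cfgD[OF c])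
qed

end

section \<open>Failure links and scanning\<close>

text \<open>The row plays the role of the text, read from its second entry on: the link of depth
  \<open>Suc e\<close> is the state that the automaton reaches from the link of depth
  \<open>e\<close>.\<close>

definition fail_body :: "nat com" where
  "fail_body =
     xv ::= Cell (Reg xF \<oplus> (Reg xi \<oplus> Reg xe)) ;;
     xc ::= Cell (Reg xW \<oplus> (Reg xi \<oplus> Reg xe)) ;;
     step_com ;;
     Store (Reg xF \<oplus> (Reg xi \<oplus> (Reg xe \<oplus> Const 1))) (Reg xv) ;;
     xi ::= Reg xi \<oplus> Reg xN"

text \<open>Level by level over all rows, because a link may lead into any other row, whose links at
  smaller depths must then be present. The links of depth 1 lead to the root, which has number 0,
  and are provided by the zeroed memory.\<close>

definition fail_com :: "nat com" where
  "fail_com =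
     xe ::= Const 1 ;;
     While (Less (Reg xe) PatLen)
       (xi ::= Const 0 ;; While (Less (Reg xi) (Reg xK)) fail_body ;; xe ::= Reg xe \<oplus> Const 1)"

definition scan_com :: "(nat exp \<Rightarrow> nat exp) \<Rightarrow> nat exp \<Rightarrow> nat com" where
  "scan_com Y out =
     xe ::= Const 0 ;; xv ::= Const 0 ;;
     While (Less (Reg xe) TxtLen)
       (prev_com Y xB ;;
        Store (Reg xB \<oplus> (Reg xe \<oslash> Reg xN)) (Reg xc) ;;
        step_com ;;
        If (Equal (Reg xv \<oslash> Reg xN) PatLen) (Output out) Skip ;;
        xe ::= Reg xe \<oplus> Const 1)"

locale automaton = mach M m wa + comb ws b br m
  for M m wa ws b br +
  assumes rows_le: "length ws \<le> 2 * Suc m"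
begin

sublocale tables ws b br m M wa fa ta
proof
  have "2 * Suc m * Suc m = 2 * (Suc m * Suc m)" by (simp only: mult.assoc)
  then show "wa + 2 * Suc m * Suc m \<le> cells M" "fa + 2 * Suc m * Suc m \<le> cells M" "ta + Suc m * Suc m \<le> cells M"
    using fit unfolding fa_def ta_def N_def by linarith+
  show "int (cells M) \<le> word_max M" using word_bound by simp
qed (rule rows_le)

text \<open>Rows before \<open>i\<close> are already one level ahead. Every row has its own links
  from depth 1 on, also at numbers that name no node because the prefix is shared with the main
  path; each row can thus be run without locating those nodes.\<close>

definition progress :: "(nat \<Rightarrow> int) \<Rightarrow> nat \<Rightarrow> nat \<Rightarrow> bool" where
  "progress f D i \<longleftrightarrow> (\<forall>j<length ws. \<forall>d. 1 \<le> d \<longrightarrow> d \<le> (if j < i then Suc D else D) \<longrightarrow>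
     (\<exists>g. f (fa + (j * N + d)) = int g \<and> longest 1 ((!) (ws ! j)) d g))"

text \<open>The depth of the latest link of row \<open>j\<close>. Summed over the rows it is the
  potential that pays for the links followed during the construction.\<close>

definition fail_depth :: "(nat \<Rightarrow> int) \<Rightarrow> nat \<Rightarrow> nat \<Rightarrow> nat \<Rightarrow> nat" where
  "fail_depth f D i j = depth (nat (f (fa + (j * N + (if j < i then Suc D else D)))))"

lemma progress_fails: "progress (mem s) D i \<Longrightarrow> fails s D"
  unfolding fails_def
proof (intro allI impI)
  fix v assume p: "progress (mem s) D i" and v: "good v" "0 < depth v" "depth v \<le> D"
  have "row v * N + depth v = v" using node_eq[of v] by (simp only: N_def)
  moreover have "row v < length ws" using v(1) by (simp add: good_def)
  ultimately show "\<exists>f. mem s (fa + v) = int f \<and> longest 1 ((!) (ws ! row v)) (depth v) f"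
    using p v unfolding progress_def by (metis One_nat_def Suc_leI le_SucI)
qed

lemma progress_next: "progress f D (length ws) \<Longrightarrow> progress f (Suc D) 0"
  by (simp add: progress_def)

lemma stored_cong:
  assumes "stored s" "cfg (reg s')" "\<And>a. wa \<le> a \<and> a < fa \<or> ta \<le> a \<and> a < ba \<Longrightarrow> mem s' a = mem s a"
  shows "stored s'"
proof -
  have "mem s' (wa + v) = mem s (wa + v)" if "good v" for v
  proof -
    have "2 * Suc m * Suc m = 2 * (Suc m * Suc m)" by (simp only: mult.assoc)
    then show ?thesis using good_less[OF that] by (intro assms(3)) (simp add: fa_def N_def)
  qed
  moreover have "mem s' (ta + (d * Suc m + c)) = mem s (ta + (d * Suc m + c))" if "d \<le> m" "c \<le> m" for d c
    using tab_less[OF that] by (intro assms(3)) (simp add: ba_def ta_def N_def)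
  ultimately show ?thesis using assms(1) cfgD[OF assms(2)] unfolding stored_def by (simp add: N_def)
qed

lemma K_N_le: "length ws * N \<le> 2 * (N * N)"
  using mult_le_mono1[OF rows_le, of N] by (simp add: N_def)

lemma fail_body_wp:
  assumes st: "stored s" "cfg (reg s)" and p: "progress (mem s) D i" and i: "i < length ws" and D: "1 \<le> D" "D < m"
    and rowc: "mem s (wa + (i * N + D)) = int (ws ! i ! D)"
    and r: "reg s xi = int (i * N)" "reg s xe = int D" "reg s xK = int (length ws * N)"
    and F: "F \<ge> R + 30 * int (\<Sum>j<length ws. fail_depth (mem s) D i j) + 120" and R: "0 \<le> R"
    and Q: "\<And>s' F'. stored s' \<Longrightarrow> cfg (reg s') \<Longrightarrow> progress (mem s') D (Suc i) \<Longrightarrow>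
      reg s' xi = int (Suc i * N) \<Longrightarrow> reg s' xe = int D \<Longrightarrow> reg s' xK = int (length ws * N) \<Longrightarrow>
      (\<And>a. a < fa \<or> ta \<le> a \<Longrightarrow> mem s' a = mem s a) \<Longrightarrow> outp s' = outp s \<Longrightarrow>
      R + 30 * int (\<Sum>j<length ws. fail_depth (mem s') D (Suc i) j) \<le> F' \<Longrightarrow> Q s' F'"
  shows "wp M fail_body Q s F"
proof -
  have iN: "i * N + N \<le> length ws * N" using mult_le_mono1[of "Suc i" "length ws" N] i by simp
  have fit': "wa + 6 * (N * N) \<le> cells M" using fit by (simp add: N_def)
  have bnd: "int (i * N + D) \<le> word_max M" "int (fa + (i * N + D)) \<le> word_max M" "fa + (i * N + D) < cells M"
    "int (wa + (i * N + D)) \<le> word_max M" "wa + (i * N + D) < cells M" "int D + 1 \<le> word_max M"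
    "int (i * N + Suc D) \<le> word_max M" "int (fa + (i * N + Suc D)) \<le> word_max M" "fa + (i * N + Suc D) < cells M"
    "int (Suc D) \<le> word_max M" "int (i * N + N) \<le> word_max M"
    using iN K_N_le fit' D word_bound unfolding fa_def N_def by linarith+
  obtain v where v: "mem s (fa + (i * N + D)) = int v" "longest 1 ((!) (ws ! i)) D v"
    using p i D(1) unfolding progress_def by force
  \<comment> \<open>Only row \<open>i\<close> moves; the potential of the other rows passes through
    the transition as part of its reserve.\<close>
  define psi where "psi = (\<Sum>j\<in>{..<length ws} - {i}. fail_depth (mem s) D i j)"
  have sum: "(\<Sum>j<length ws. fail_depth (mem s) D i j) = depth v + psi"
    using i v(1) by (subst sum.remove[of _ i]) (simp_all add: psi_def fail_depth_def)
  have dv: "depth v < D" using v(2) by (simp add: longest_def)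
  have sD: "int D + 1 = int (Suc D)" by simp
  define tail where "tail = Store (Reg xF \<oplus> (Reg xi \<oplus> (Reg xe \<oplus> Const 1))) (Reg xv) ;; xi ::= Reg xi \<oplus> Reg xN"
  have step: "wp M step_com (wp M tail Q) t G"
    if t: "reg t = (reg s)(xv := int v, xc := int (ws ! i ! D))" "mem t = mem s" "outp t = outp s" "G \<ge> F - 10" for t :: "nat state" and G
  proof (rule step_com_wp[where v = v and lo = 1 and T = "(!) (ws ! i)" and e = D and R = "R + 30 * int psi + 20"])
    show "stored t" by (rule stored_cong[OF st(1)]) (use t st(2) in simp_all)
    have "fails t D" by (rule progress_fails[of _ _ i]) (use p t in simp)
    then show "fails t (depth v)" using dv by (simp add: fails_def)
    show "reg t xv = int v" "longest 1 ((!) (ws ! i)) D v" "reg t xc = int (ws ! i ! D)"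
      using t v by simp_all
    show "R + 30 * int psi + 20 + 30 * (int (depth v) + 3) \<le> G" using t(4) F sum by simp
    show "0 \<le> R + 30 * int psi + 20" using R by simp
    fix z :: "nat state" and Z u
    assume z: "frame {xd, xg, xx, xv} t z" "reg z xv = int u" "longest 1 ((!) (ws ! i)) (Suc D) u"
      "R + 30 * int psi + 20 + 30 * int (depth u) \<le> Z"
    have rz: "reg z xi = int (i * N)" "reg z xe = int D" "reg z xK = int (length ws * N)" "cfg (reg z)"
       "mem z = mem s" "outp z = outp s"
      using z(1) t r st(2) frame_cfg[OF z(1)] by (simp_all add: frame_reg frame_mem)
    define g where "g = (mem s)(fa + (i * N + Suc D) := int u)"
    have g_eq: "g (fa + (j * N + d)) = mem s (fa + (j * N + d))" if "d \<le> m" "j \<noteq> i \<or> d \<noteq> Suc D" for j d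
      using that node_inj[of d "Suc D" j i] D by (auto simp: g_def N_def)
    have g_out: "g a = mem s a" if "a < fa \<or> ta \<le> a" for a
    proof -
      have "fa + (i * N + Suc D) < ta" using iN K_N_le D unfolding fa_def ta_def N_def by linarith
      then show ?thesis using that by (auto simp: g_def)
    qed
    have pg: "progress g D (Suc i)"
      unfolding progress_def
    proof (intro allI impI)
      fix j d assume jd: "j < length ws" "1 \<le> d" "d \<le> (if j < Suc i then Suc D else D)"
      show "\<exists>h. g (fa + (j * N + d)) = int h \<and> longest 1 ((!) (ws ! j)) d h"
      proof (cases "j = i \<and> d = Suc D")
        case True
        then show ?thesis using z(3) by (auto simp: g_def)
      next
        case False
        then have "g (fa + (j * N + d)) = mem s (fa + (j * N + d))"
          using jd D by (intro g_eq) (auto split: if_splits)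
        moreover have "d \<le> (if j < i then Suc D else D)" using jd(3) False by (auto split: if_splits)
        ultimately show ?thesis using p jd(1,2) unfolding progress_def by metis
      qed
    qed
    have fd: "fail_depth g D (Suc i) j = fail_depth (mem s) D i j" if "j \<noteq> i" for j
    proof -
      have "j < Suc i \<longleftrightarrow> j < i" using that by auto
      then show ?thesis using g_eq[of "if j < i then Suc D else D" j] that D by (simp add: fail_depth_def)
    qed
    have sum': "(\<Sum>j<length ws. fail_depth g D (Suc i) j) = depth u + psi"
    proof -
      have "(\<Sum>j<length ws. fail_depth g D (Suc i) j) =
        fail_depth g D (Suc i) i + (\<Sum>j\<in>{..<length ws} - {i}. fail_depth g D (Suc i) j)"
        using i by (intro sum.remove) simp_all
      also have "(\<Sum>j\<in>{..<length ws} - {i}. fail_depth g D (Suc i) j) = psi"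
        unfolding psi_def by (intro sum.cong) (simp_all add: fd)
      also have "fail_depth g D (Suc i) i = depth u" by (simp add: fail_depth_def g_def)
      finally show ?thesis .
    qed
    have "Q y Y" if y: "reg y = (reg z)(xi := int (i * N + N))" "mem y = g" "outp y = outp s" "Y \<ge> Z - 15" for y :: "nat state" and Y
    proof (rule Q)
      show "stored y"
        by (rule stored_cong[OF st(1)]) (use y rz g_out in \<open>auto simp: fa_def ta_def\<close>)
      show "reg y xi = int (Suc i * N)" using y by (simp add: add.commute)
      show "R + 30 * int (\<Sum>j<length ws. fail_depth (mem y) D (Suc i) j) \<le> Y"
        unfolding y(2) sum' using z(4) y(4) by simp
      show "progress (mem y) D (Suc i)" using pg y(2) by simp
    qed (use y rz g_out in simp_all)
    moreover define E where "E = Suc D"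
    ultimately show "wp M tail Q z Z" unfolding tail_def g_def E_def[symmetric]
      by (simp add: rz z(2) cfgD[OF rz(4)] bnd[folded E_def] sD[folded E_def] of_nat_add[symmetric]
          del: of_nat_add of_nat_mult)
  qed
  show ?thesis
    unfolding fail_body_def tail_def[symmetric]
    by (simp add: r(1,2) cfgD[OF st(2)] bnd v(1) rowc step of_nat_add[symmetric]
        del: of_nat_add of_nat_mult)
qed

lemma fail_com_wp:
  assumes st: "stored s" "cfg (reg s)"
    and rowc: "\<And>i d. i < length ws \<Longrightarrow> d < m \<Longrightarrow> mem s (wa + (i * N + d)) = int (ws ! i ! d)"
    and zero: "\<And>a. fa \<le> a \<Longrightarrow> a < ta \<Longrightarrow> mem s a = 0"
    and K: "reg s xK = int (length ws * N)"
    and F: "F \<ge> R + (130 * int (length ws) + 30) * int m + 20" and R: "0 \<le> R"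
    and Q: "\<And>s' F'. stored s' \<Longrightarrow> cfg (reg s') \<Longrightarrow> fails s' m \<Longrightarrow>
      (\<And>a. a < fa \<or> ta \<le> a \<Longrightarrow> mem s' a = mem s a) \<Longrightarrow> outp s' = outp s \<Longrightarrow> R \<le> F' \<Longrightarrow> Q s' F'"
  shows "wp M fail_com Q s F"
proof -
  define Z where "Z = 130 * int (length ws) + 30"
  define inner where "inner = While (Less (Reg xi) (Reg xK)) fail_body"
  define inc where "inc = (xe ::= Reg xe \<oplus> Const 1)"
  define B where "B = (\<lambda>(s' :: nat state) D i. stored s' \<and> cfg (reg s') \<and> progress (mem s') D i \<and>
     reg s' xe = int D \<and> reg s' xK = int (length ws * N) \<and>
     (\<forall>a. a < fa \<or> ta \<le> a \<longrightarrow> mem s' a = mem s a) \<and> outp s' = outp s)"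
  define pot where "pot = (\<lambda>(s' :: nat state) D i. int (\<Sum>j<length ws. fail_depth (mem s') D i j))"
  define I where "I = (\<lambda>(s' :: nat state) F'. \<exists>D. 1 \<le> D \<and> D \<le> m \<and> B s' D 0 \<and>
     F' \<ge> R + 30 * pot s' D 0 + Z * (int m - int D) + 10)"
  have II: "I s' F'" if "1 \<le> D" "D \<le> m" "B s' D 0" "F' \<ge> R + 30 * pot s' D 0 + Z * (int m - int D) + 10" for s' F' D
    unfolding I_def by (rule exI[of _ D]) (use that in simp)
  have pot_nonneg: "0 \<le> pot s' D i" for s' D i unfolding pot_def by (rule of_nat_0_le_iff)
  have Z_nonneg: "0 \<le> Z * (int m - int D)" if "D \<le> m" for D
    using that by (intro mult_nonneg_nonneg) (simp_all add: Z_def)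
  have bnd: "int D + 1 \<le> word_max M" if "D < m" for D using that word_bound by simp
  have ws_pos: "0 < length ws" using ws_nonempty by simp
  have inner_wp: "wp M inner (wp M inc I) t G"
    if D: "1 \<le> D" "D < m" and t: "B t D 0" "reg t xi = 0" and G: "G \<ge> R + 30 * pot t D 0 + Z * (int m - int D) + 5"
    for t G D
  proof -
    define S where "S = R + Z * (int m - int (Suc D))"
    have ZD: "Z * (int m - int D) = Z * (int m - int (Suc D)) + Z" by (simp add: algebra_simps)
    have S: "0 \<le> S" using Z_nonneg[of "Suc D"] D R by (simp add: S_def)
    define J where "J = (\<lambda>(s' :: nat state) F'. \<exists>i\<le>length ws. B s' D i \<and> reg s' xi = int (i * N) \<and>
       F' \<ge> S + 30 * pot s' D i + 130 * (int (length ws) - int i) + 25)"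
    have JJ: "J s' F'" if "i \<le> length ws" "B s' D i" "reg s' xi = int (i * N)"
       "F' \<ge> S + 30 * pot s' D i + 130 * (int (length ws) - int i) + 25" for s' F' i
      unfolding J_def by (rule exI[of _ i]) (use that in simp)
    show ?thesis
      unfolding inner_def
    proof (rule wp_While[where I = J])
      show "J t G" by (rule JJ[of 0]) (use t G ZD in \<open>simp_all add: S_def Z_def\<close>)
    next
      fix s' F' assume "J s' F'"
      then obtain i where i: "i \<le> length ws" and B: "B s' D i" and xi: "reg s' xi = int (i * N)" and
        F': "F' \<ge> S + 30 * pot s' D i + 130 * (int (length ws) - int i) + 25"
        unfolding J_def by (elim exE conjE)
      have b: "stored s'" "cfg (reg s')" "progress (mem s') D i" "reg s' xe = int D"
        "reg s' xK = int (length ws * N)" "\<And>a. a < fa \<or> ta \<le> a \<Longrightarrow> mem s' a = mem s a" "outp s' = outp s"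
        using B unfolding B_def by blast+
      have nn: "0 \<le> int (length ws) - int i" using i by simp
      have N_pos: "0 < N" by (simp add: N_def)
      have body: "wp M fail_body J s' (F' - 2)" if lt: "i < length ws"
      proof (rule fail_body_wp[OF b(1-3) lt D _ xi b(4,5), where R = "S + 130 * (int (length ws) - int (Suc i)) + 30"])
        have "i * N + D < length ws * N" using D lt by (intro node_lt) (simp_all add: N_def)
        then show "mem s' (wa + (i * N + D)) = int (ws ! i ! D)"
          using b(6)[of "wa + (i * N + D)"] rowc[OF lt D(2)] K_N_le by (simp add: fa_def)
        show "S + 130 * (int (length ws) - int (Suc i)) + 30 +
          30 * int (\<Sum>j<length ws. fail_depth (mem s') D i j) + 120 \<le> F' - 2"
          using F' unfolding pot_def by simp
        show "0 \<le> S + 130 * (int (length ws) - int (Suc i)) + 30" using S lt by simp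
        fix z :: "nat state" and Y
        assume z: "stored z" "cfg (reg z)" "progress (mem z) D (Suc i)" "reg z xi = int (Suc i * N)"
          "reg z xe = int D" "reg z xK = int (length ws * N)" "\<And>a. a < fa \<or> ta \<le> a \<Longrightarrow> mem z a = mem s' a"
          "outp z = outp s'" "S + 130 * (int (length ws) - int (Suc i)) + 30 +
          30 * int (\<Sum>j<length ws. fail_depth (mem z) D (Suc i) j) \<le> Y"
        show "J z Y"
          by (rule JJ[of "Suc i"]) (use z b lt in \<open>simp_all add: B_def pot_def\<close>)
      qed
      have fin: "wp M inc I s' (F' - 2)" if ge: "\<not> i < length ws"
      proof -
        have il: "i = length ws" using ge i by simp
        have "(\<Sum>j<length ws. fail_depth (mem s') (Suc D) 0 j) = (\<Sum>j<length ws. fail_depth (mem s') D i j)"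
          by (intro sum.cong) (simp_all add: il fail_depth_def)
        then have pe: "pot (s'\<lparr>reg := (reg s')(xe := int D + 1)\<rparr>) (Suc D) 0 = pot s' D i"
          by (simp only: pot_def) simp
        have "B (s'\<lparr>reg := (reg s')(xe := int D + 1)\<rparr>) (Suc D) 0"
          using b progress_next[of "mem s'" D] il stored_cong[OF b(1), of "s'\<lparr>reg := (reg s')(xe := int D + 1)\<rparr>"]
          by (simp add: B_def)
        then have "I (s'\<lparr>reg := (reg s')(xe := int D + 1)\<rparr>) (F' - 4)"
          by (rule II[rotated 2]) (use D F' il pe in \<open>simp_all add: S_def\<close>)
        then show ?thesis using bnd[OF D(2)] b(4) by (simp add: inc_def)
      qed
      have "int (i * N) < int (length ws * N) \<longleftrightarrow> i < length ws" using N_pos by (simp only: of_nat_less_iff) simp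
      moreover have "0 \<le> F'" using F' S pot_nonneg[of s' D i] nn by simp
      ultimately show "0 \<le> F' \<and> tt M s' (Less (Reg xi) (Reg xK))
         (\<lambda>v. (v \<longrightarrow> wp M fail_body J s' (F' - 1 - int (test_ops (Less (Reg xi) (Reg xK))))) \<and>
           (\<not> v \<longrightarrow> wp M inc I s' (F' - 1 - int (test_ops (Less (Reg xi) (Reg xK))))))"
        using body fin by (simp add: xi b(5) del: of_nat_mult)
    qed
  qed
  have "wp M (While (Less (Reg xe) PatLen) (xi ::= Const 0 ;; inner ;; inc)) Q (s\<lparr>reg := (reg s)(xe := 1)\<rparr>) (F - 1)"
  proof (rule wp_While[where I = I])
    let ?s = "s\<lparr>reg := (reg s)(xe := 1)\<rparr>"
    have z: "mem s (fa + (j * N + 1)) = 0" if "j < length ws" for j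
    proof (rule zero)
      have "j * N + 1 < length ws * N" using m_pos that by (intro node_lt) (simp_all add: N_def)
      then show "fa + (j * N + 1) < ta" using K_N_le unfolding fa_def ta_def by linarith
    qed simp
    have "progress (mem s) 1 0"
      unfolding progress_def
    proof (intro allI impI)
      fix j d assume "j < length ws" "1 \<le> d" "d \<le> (if j < 0 then Suc 1 else 1)"
      then have "d = 1" "mem s (fa + (j * N + d)) = int 0" using z[of j] by simp_all
      then show "\<exists>g. mem s (fa + (j * N + d)) = int g \<and> longest 1 ((!) (ws ! j)) d g"
        using longest_init[of 1 "(!) (ws ! j)"] by blast
    qed
    then have "B ?s 1 0"
      using st K stored_cong[OF st(1), of ?s] by (simp add: B_def)
    \<comment> \<open>All links of depth 1 lead to the root, so the construction starts without any
      potential to be paid for.\<close>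
    moreover have "pot ?s 1 0 = 0" unfolding pot_def fail_depth_def using z by simp
    moreover have "Z * (int m - 1) \<le> Z * int m" by (intro mult_left_mono) (simp_all add: Z_def)
    moreover have "F \<ge> R + Z * int m + 20" using F by (simp only: Z_def)
    ultimately show "I ?s (F - 1)"
      by (intro II[of 1]) (use m_pos in simp_all)
  next
    fix s' F' assume "I s' F'"
    then obtain D where D: "1 \<le> D" "D \<le> m" and B: "B s' D 0" and F': "F' \<ge> R + 30 * pot s' D 0 + Z * (int m - int D) + 10"
      unfolding I_def by (elim exE conjE)
    have b: "stored s'" "cfg (reg s')" "progress (mem s') D 0" "reg s' xe = int D"
      "\<And>a. a < fa \<or> ta \<le> a \<Longrightarrow> mem s' a = mem s a" "outp s' = outp s"
      using B unfolding B_def by blast+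
    have body: "wp M (xi ::= Const 0 ;; inner ;; inc) I s' (F' - 2)" if lt: "D < m"
    proof -
      let ?t = "s'\<lparr>reg := (reg s')(xi := 0)\<rparr>"
      have "B ?t D 0" using B stored_cong[OF b(1), of ?t] by (simp add: B_def)
      then have "wp M inner (wp M inc I) ?t (F' - 3)"
        by (rule inner_wp[OF D(1) lt]) (use F' in \<open>simp_all add: pot_def\<close>)
      then show ?thesis by simp
    qed
    have fin: "Q s' (F' - 2)" if "\<not> D < m"
    proof (rule Q[OF b(1,2) _ b(5,6)])
      have "D = m" using that D by simp
      then show "fails s' m" using progress_fails[OF b(3)] by simp
      show "R \<le> F' - 2" using F' pot_nonneg[of s' D 0] Z_nonneg[OF D(2)] by simp
    qed
    have "0 \<le> F'" using F' pot_nonneg[of s' D 0] Z_nonneg[OF D(2)] R by simp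
    then show "0 \<le> F' \<and> tt M s' (Less (Reg xe) PatLen)
       (\<lambda>v. (v \<longrightarrow> wp M (xi ::= Const 0 ;; inner ;; inc) I s' (F' - 1 - int (test_ops (Less (Reg xe) PatLen)))) \<and>
         (\<not> v \<longrightarrow> Q s' (F' - 1 - int (test_ops (Less (Reg xe) PatLen)))))"
      using body fin by (simp add: b(4) pat_len del: wp_Seq wp_Assign)
  qed
  then show ?thesis unfolding fail_com_def inner_def inc_def by simp
qed

text \<open>Two potentials run side by side, the height of the stack of nearest smaller entries and
  the depth of the state. A text position raises each by at most one, so a constant share of 250
  units per position suffices.\<close>

lemma scan_com_wp:
  assumes st: "stored s" "cfg (reg s)" "fails s m" and ys: "length ys = length (txt_in M)" "source M Y ys"
    and out: "\<And>s e P. reg s xe = int e \<Longrightarrow> m \<le> Suc e \<Longrightarrow> e < length ys \<Longrightarrow> ev M s out P = P (pos e)"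
      "ops out \<le> 5"
    and F: "F \<ge> R + 250 * int (length ys) + 20" and R: "0 \<le> R"
    and Q: "\<And>s' F'. (\<And>a. ba + N \<le> a \<Longrightarrow> mem s' a = mem s a) \<Longrightarrow>
      set (outp s') = set (outp s) \<union>
        pos ` {e. e < length ys \<and> m \<le> Suc e \<and> win (tpd m ys) (Suc e - m) m \<in> set ws} \<Longrightarrow> R \<le> F' \<Longrightarrow> Q s' F'"
  shows "wp M (scan_com Y out) Q s F"
proof -
  let ?T = "tpd m ys"
  let ?n = "length ys"
  define hits where "hits = (\<lambda>e. {e'. e' < e \<and> m \<le> Suc e' \<and> win ?T (Suc e' - m) m \<in> set ws})"
  define inc where "inc = (xe ::= Reg xe \<oplus> Const 1)"
  define report where "report = If (Equal (Reg xv \<oslash> Reg xN) PatLen) (Output out) Skip"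
  define put where "put = Store (Reg xB \<oplus> (Reg xe \<oslash> Reg xN)) (Reg xc)"
  define B where "B = (\<lambda>(s' :: nat state) e. stored s' \<and> cfg (reg s') \<and> fails s' m \<and> reg s' xe = int e \<and>
     (\<forall>a. ba + N \<le> a \<longrightarrow> mem s' a = mem s a))"
  define buf where "buf = (\<lambda>(s' :: nat state) e. \<forall>k<e. e \<le> k + m \<longrightarrow> mem s' (ba + k mod Suc m) = int (?T k))"
  define I where "I = (\<lambda>(s' :: nat state) F'. \<exists>e v. e \<le> ?n \<and> B s' e \<and> buf s' e \<and> reg s' xv = int v \<and>
     longest 0 ?T e v \<and> set (outp s') = set (outp s) \<union> pos ` hits e \<and>
     F' \<ge> R + 250 * (int ?n - int e) + 30 * int (stk_at ?T e 1) + 30 * int (depth v) + 10)"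
  have II: "I s' F'" if "e \<le> ?n" "B s' e" "buf s' e" "reg s' xv = int v" "longest 0 ?T e v"
    "set (outp s') = set (outp s) \<union> pos ` hits e"
    "F' \<ge> R + 250 * (int ?n - int e) + 30 * int (stk_at ?T e 1) + 30 * int (depth v) + 10" for s' F' e v
    unfolding I_def by (rule exI[of _ e], rule exI[of _ v]) (use that in simp)
  have top: "ba + N \<le> cells M" using fit N_le unfolding ba_def N_def by linarith
  have B_cong: "B s'' e'" if "B s' e" "cfg (reg s'')" "reg s'' xe = int e'" "\<And>a. a < ba \<or> ba + N \<le> a \<Longrightarrow> mem s'' a = mem s' a"
    for s' s'' e e'
  proof -
    have b: "stored s'" "fails s' m" "\<And>a. ba + N \<le> a \<Longrightarrow> mem s' a = mem s a" using that(1) by (simp_all add: B_def)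
    have "stored s''" by (rule stored_cong[OF b(1) that(2)]) (use that(4) in \<open>auto simp: fa_def ba_def\<close>)
    moreover have "mem s'' (fa + v) = mem s' (fa + v)" if "good v" for v
    proof -
      have "2 * Suc m * Suc m = 2 * (N * N)" by (simp only: mult.assoc N_def)
      then show ?thesis using good_less[OF that] by (intro \<open>\<And>a. a < ba \<or> _ a \<Longrightarrow> _\<close>) (simp add: fa_def ba_def)
    qed
    then have "fails s'' m" using b(2) unfolding fails_def by metis
    ultimately show ?thesis using that b by (simp add: B_def)
  qed
  have body: "wp M (prev_com Y xB ;; put ;; step_com ;; report ;; inc) I s' (F' - 2)"
    if e: "e < ?n" and B: "B s' e" and bf: "buf s' e" and v: "reg s' xv = int v" "longest 0 ?T e v"
      and o: "set (outp s') = set (outp s) \<union> pos ` hits e"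
      and F': "F' \<ge> R + 250 * (int ?n - int e) + 30 * int (stk_at ?T e 1) + 30 * int (depth v) + 10" for s' F' e v
    unfolding wp_Seq
  proof -
    have b: "stored s'" "cfg (reg s')" "fails s' m" "reg s' xe = int e"
      using B by (simp_all add: B_def)
    define R1 where "R1 = R + 250 * (int ?n - int e) + 30 * int (depth v) - 55"
    have en: "1 \<le> int ?n - int e" using e by simp
    have mn: "e mod N \<le> m" by (simp add: N_def less_Suc_eq_le[symmetric])
    have bn: "int e + 1 \<le> word_max M" "int (e mod N) \<le> word_max M" "int (ba + e mod N) \<le> word_max M"
        "ba + e mod N < cells M"
      using e top word_bound ys(1) mn N_le(2) by linarith+
    have incr: "wp M inc I t G"
      if "B t e" "buf t (Suc e)" "reg t xv = int u" "longest 0 ?T (Suc e) u"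
        "set (outp t) = set (outp s) \<union> pos ` hits (Suc e)"
        "G \<ge> R + 250 * (int ?n - int (Suc e)) + 30 * int (stk ?T e) + 30 * int (depth u) + 20" for t G u
    proof -
      let ?t = "t\<lparr>reg := (reg t)(xe := int e + 1)\<rparr>"
      have "B ?t (Suc e)" by (rule B_cong[OF that(1)]) (use that(1) in \<open>simp_all add: B_def\<close>)
      then have "I ?t (G - 2)"
        by (rule II[rotated]) (use that e in \<open>simp_all add: buf_def stk_at_def, linarith\<close>)
      then show ?thesis using bn that(1) by (simp add: inc_def B_def)
    qed
    show "wp M (prev_com Y xB) (wp M put (wp M step_com (wp M report (wp M inc I)))) s' (F' - 2)"
    proof (rule prev_com_wp[OF ys(2) b(4) e, where R = R1 and ba = ba])
      show "reg s' xN = int (Suc m)" "reg s' xB = int ba" using cfgD[OF b(2)] by (simp_all add: N_def)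
      show "mem s' (ba + k mod Suc m) = int (?T k)" if "k < e" "e \<le> k + m" for k
        using bf that by (simp add: buf_def)
      show "ba + m < cells M" "int (ba + 3 * m + 3 + length ys) \<le> word_max M"
        using top word_bound ys by (simp_all add: N_def)
      show "R1 + 30 * int (stk_at ?T e 1 + 2) \<le> F' - 2" "0 \<le> R1" using F' en R by (simp_all add: R1_def)
      fix t :: "nat state" and G
      assume t: "frame {xc, xd, xg} s' t" "reg t xc = int (?T e)" "R1 + 30 * (int (stk ?T e) - 1) \<le> G"
      have rt: "reg t xe = int e" "reg t xv = int v" "cfg (reg t)" "mem t = mem s'" "outp t = outp s'"
        using t(1) b v frame_cfg[OF t(1)] by (simp_all add: frame_reg frame_mem)
      define f where "f = (mem s')(ba + e mod N := int (?T e))"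
      have step: "wp M step_com (wp M report (wp M inc I)) y H"
        if y: "reg y = reg t" "mem y = f" "outp y = outp t" "H \<ge> G - 6" for y :: "nat state" and H
      proof -
        have By: "B y e"
          by (rule B_cong[OF B]) (use y rt mn N_le(2) in \<open>auto simp: f_def\<close>)
        have bufy: "buf y (Suc e)"
          unfolding buf_def
        proof (intro allI impI)
          fix k assume k: "k < Suc e" "Suc e \<le> k + m"
          show "mem y (ba + k mod Suc m) = int (?T k)"
          proof (cases "k = e")
            case False
            \<comment> \<open>Positions less than \<open>Suc m\<close> apart have different
              residues, so storing the distance of \<open>e\<close> only overwrites a position that
              later searches no longer reach.\<close>
            have "k mod Suc m \<noteq> e mod Suc m"
            proof
              assume "k mod Suc m = e mod Suc m"
              then have "Suc m dvd e - k" using k by (metis mod_eq_dvd_iff_nat less_Suc_eq_le)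
              then have "Suc m \<le> e - k" using False k by (intro dvd_imp_le) simp_all
              with k show False by simp
            qed
            then have "mem y (ba + k mod Suc m) = mem s' (ba + k mod Suc m)"
              by (simp add: y(2) f_def N_def)
            then show ?thesis using bf k False by (simp add: buf_def)
          qed (simp add: y(2) f_def N_def)
        qed
        define R2 where "R2 = R + 250 * (int ?n - int (Suc e)) + 30 * int (stk ?T e) + 40"
        show ?thesis
        proof (rule step_com_wp[where v = v and lo = 0 and T = ?T and e = e and R = R2])
          show "stored y" using By by (simp add: B_def)
          have "fails y m" using By by (simp add: B_def)
          then show "fails y (depth v)" using depth_le[of v] by (simp add: fails_def)
          show "reg y xv = int v" "longest 0 ?T e v" "reg y xc = int (?T e)" using y rt t(2) v by simp_all
          show "R2 + 30 * (int (depth v) + 3) \<le> H" using y(4) t(3) by (simp add: R1_def R2_def)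
          show "0 \<le> R2" using R en by (simp add: R2_def)
          fix z :: "nat state" and Z u
          assume z: "frame {xd, xg, xx, xv} y z" "reg z xv = int u" "longest 0 ?T (Suc e) u" "R2 + 30 * int (depth u) \<le> Z"
          have rz: "reg z xe = int e" "cfg (reg z)" "mem z = mem y" "outp z = outp s'"
            using z(1) y rt frame_cfg[OF z(1)] by (simp_all add: frame_reg frame_mem)
          have Bz: "B z e" by (rule B_cong[OF By rz(2,1)]) (simp add: rz(3))
          have bufz: "buf z (Suc e)" using bufy rz(3) by (simp add: buf_def)
          have full: "depth u = m \<longleftrightarrow> m \<le> Suc e \<and> win ?T (Suc e - m) m \<in> set ws" by (rule longest_full[OF z(3)])
          have hs: "hits (Suc e) = (if depth u = m then insert e (hits e) else hits e)"
            unfolding hits_def using full by (auto simp: less_Suc_eq)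
          have md: "int u mod int N = int (depth u)" unfolding depth_def N_def by (simp only: of_nat_mod)
          have dw: "int (depth u) \<le> word_max M" using depth_le[of u] word_bound by simp
          show "wp M report (wp M inc I) z Z"
          proof (cases "depth u = m")
            case True
            then have me: "m \<le> Suc e" using full by simp
            have "wp M inc I (z\<lparr>outp := outp z @ [pos e]\<rparr>) W" if "W \<ge> Z - 15" for W
            proof (rule incr[OF _ _ _ z(3)])
              show "B (z\<lparr>outp := outp z @ [pos e]\<rparr>) e" by (rule B_cong[OF Bz]) (simp_all add: rz)
              show "buf (z\<lparr>outp := outp z @ [pos e]\<rparr>) (Suc e)" using bufz by (simp add: buf_def)
              show "set (outp (z\<lparr>outp := outp z @ [pos e]\<rparr>)) = set (outp s) \<union> pos ` hits (Suc e)"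
                using o hs True by (auto simp: rz)
            qed (use z that in \<open>simp_all add: R2_def\<close>)
            then show ?thesis using True out(2) dw unfolding report_def
              by (simp add: z(2) cfgD[OF rz(2)] md pat_len out(1)[OF rz(1) me e])
          next
            case False
            have "wp M inc I z W" if "W \<ge> Z - 15" for W
              by (rule incr[OF Bz bufz z(2,3)]) (use z that o hs False in \<open>simp_all add: R2_def rz\<close>)
            then show ?thesis using False dw unfolding report_def
              by (simp add: z(2) cfgD[OF rz(2)] md pat_len)
          qed
        qed
      qed
      have em: "int e mod int N = int (e mod N)" by (simp only: of_nat_mod)
      show "wp M put (wp M step_com (wp M report (wp M inc I))) t G"
        unfolding put_def
        by (simp add: rt t(2) cfgD[OF rt(3)] em bn step f_def of_nat_add[symmetric] del: of_nat_add of_nat_mod)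
    qed simp_all
  qed
  let ?s = "s\<lparr>reg := (reg s)(xe := 0, xv := 0)\<rparr>"
  have "wp M (While (Less (Reg xe) TxtLen) (prev_com Y xB ;; put ;; step_com ;; report ;; inc)) Q ?s (F - 2)"
  proof (rule wp_While[where I = I])
    have "stored ?s" by (rule stored_cong[OF st(1)]) (simp_all add: st(2))
    then have "B ?s 0" using st by (simp add: B_def fails_def)
    then show "I ?s (F - 2)"
      by (rule II[rotated, where v = 0]) (use F longest_init in \<open>simp_all add: buf_def hits_def stk_at_def\<close>)
  next
    fix s' F' assume "I s' F'"
    then obtain e v where e: "e \<le> ?n" and B: "B s' e" and bf: "buf s' e" and v: "reg s' xv = int v" "longest 0 ?T e v"
      and o: "set (outp s') = set (outp s) \<union> pos ` hits e"
      and F': "F' \<ge> R + 250 * (int ?n - int e) + 30 * int (stk_at ?T e 1) + 30 * int (depth v) + 10"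
      unfolding I_def by (elim exE conjE)
    have b: "reg s' xe = int e" "\<And>a. ba + N \<le> a \<Longrightarrow> mem s' a = mem s a" using B by (simp_all add: B_def)
    have fin: "Q s' (F' - 2)" if "\<not> e < ?n"
    proof (rule Q[OF b(2)])
      have "e = ?n" using that e by simp
      then show "set (outp s') = set (outp s) \<union> pos ` {e. e < ?n \<and> m \<le> Suc e \<and> win ?T (Suc e - m) m \<in> set ws}"
        using o by (simp add: hits_def)
      show "R \<le> F' - 2" using F' e by simp
    qed simp
    have "0 \<le> F'" using F' e R by simp
    then show "0 \<le> F' \<and> tt M s' (Less (Reg xe) TxtLen)
       (\<lambda>w. (w \<longrightarrow> wp M (prev_com Y xB ;; put ;; step_com ;; report ;; inc) I s' (F' - 1 - int (test_ops (Less (Reg xe) TxtLen)))) \<and>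
         (\<not> w \<longrightarrow> Q s' (F' - 1 - int (test_ops (Less (Reg xe) TxtLen)))))"
      using body[OF _ B bf v o F'] fin ys(1) by (simp add: b(1) del: wp_Seq)
  qed
  then show ?thesis unfolding scan_com_def put_def report_def inc_def by simp
qed

end

section \<open>The two passes\<close>

text \<open>The factor \<open>k\<close> selects a memory region. Different regions for the two
  passes let both start with a zeroed branching table and zeroed links.\<close>

definition init_com :: "nat \<Rightarrow> nat com" where
  "init_com k =
     xN ::= PatLen \<oplus> Const 1 ;;
     xd ::= Reg xN \<otimes> Reg xN ;;
     xW ::= Const (int k) \<otimes> Reg xd ;;
     xF ::= Reg xW \<oplus> Const 2 \<otimes> Reg xd ;;
     xT ::= Reg xW \<oplus> Const 4 \<otimes> Reg xd ;;
     xB ::= Reg xW \<oplus> Const 5 \<otimes> Reg xd"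

definition pass_com :: "nat \<Rightarrow> (nat exp \<Rightarrow> nat exp) \<Rightarrow> (nat exp \<Rightarrow> nat exp) \<Rightarrow> nat exp \<Rightarrow> nat com" where
  "pass_com k X Y out = init_com k ;; code_com X ;; rows_com ;; fail_com ;; scan_com Y out"

lemma set_rows: "set ps = {x. opt_ok w x} \<Longrightarrow> v \<in> set (rows w ps) \<longleftrightarrow> v = w \<or> asc_nbr w v"
  by (auto simp: rows_def asc_nbr_def opt_ok_def)

text \<open>A window of length \<open>m\<close> keeps only distances below \<open>m\<close>, so the
  preliminary truncation at \<open>m\<close> is invisible in it.\<close>

lemma win_tpd:
  assumes "j + m \<le> length ys"
  shows "win (tpd m ys) j m = code (take m (drop j ys))"
proof (rule nth_equalityI)
  fix k assume "k < length (win (tpd m ys) j m)"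
  then have k: "k < m" by simp
  then show "win (tpd m ys) j m ! k = code (take m (drop j ys)) ! k"
    using assms by (simp add: tpd_def pd_take pd_drop cut_def)
qed (use assms in simp)

context mach
begin

text \<open>Reads the branching table back as a function: its filled cells give
  \<open>br_complete\<close> and its zeros give \<open>br_sound\<close>.\<close>

lemma comb_rows:
  assumes wx: "w = code xs" "length xs = m" and ps: "set ps = {x. opt_ok w x}" and t: "tabs w ps f"
    and br: "\<And>d c. br d c = (if d < N \<and> c < N then nat (f (ta + (d * N + c))) else 0)"
  shows "comb (rows w ps) (\<lambda>s. brk w (ps ! (s - 1))) br m"
proof -
  have wl: "length w = m" and wk: "\<And>k. k < m \<Longrightarrow> w ! k \<le> k" using wx pd_le[of xs] by auto
  have ok: "opt_ok w (ps ! i)" if "i < length ps" for i using ps that nth_mem by blast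
  have row_Suc: "rows w ps ! Suc i = nbr w (fst (ps ! i)) (snd (ps ! i))" if "i < length ps" for i
    using that by (simp add: rows_def case_prod_beta)
  have kb: "brk w (ps ! i) < m" "key w (ps ! i) < N" if "i < length ps" for i
    using key_bounds[OF ok[OF that] wl wk] by auto
  have key: "rows w ps ! Suc i ! brk w (ps ! i) = key w (ps ! i)" if "i < length ps" for i
    using row_Suc[OF that] by (simp add: key_def case_prod_beta)
  have t2: "f (ta + (brk w (ps ! i) * N + key w (ps ! i))) = int (Suc i * N + Suc (brk w (ps ! i)))"
    if "i < length ps" for i
    using t that unfolding tabs_def by blast
  have t3: "f (ta + (d * N + c)) = 0 \<or> (\<exists>i<length ps. d = brk w (ps ! i) \<and> c = key w (ps ! i))"
    if "d < N" "c < N" for d c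
    using t that unfolding tabs_def by blast
  have lr: "length (rows w ps) = Suc (length ps)" by (simp add: rows_def)
  show ?thesis
  proof
    show "0 < m" by (rule m_pos)
    show "rows w ps \<noteq> []" by (simp add: rows_def)
    fix s assume "s < length (rows w ps)"
    then have s: "s < Suc (length ps)" using lr by simp
    show "length (rows w ps ! s) = m"
      using s wl by (cases s) (simp_all add: row_Suc, simp add: rows_def)
    show "rows w ps ! s ! 0 = 0"
    proof (cases s)
      case 0
      then show ?thesis using wk[OF m_pos] by (simp add: rows_def)
    next
      case (Suc i)
      obtain q c where qc: "ps ! i = (q, c)" by (cases "ps ! i")
      then have o: "Suc q < m" "c \<in> opts w q" using ok[of i] s Suc wl by (auto simp: opt_ok_def)
      have "c \<le> q" using opts_le[OF o(2)] wk o(1) by simp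
      then show ?thesis using Suc s row_Suc[of i] qc wk[OF m_pos] m_pos wl by (simp add: nbr_def)
    qed
  next
    fix s assume s: "0 < s" "s < length (rows w ps)"
    then obtain i where i: "s = Suc i" "i < length ps" using lr by (cases s) auto
    obtain q c where qc: "ps ! i = (q, c)" by (cases "ps ! i")
    then have o: "Suc q < length w" using ok[of i] i by (auto simp: opt_ok_def)
    have w1: "w ! Suc q = 1" using ok[of i] i qc by (auto simp: opt_ok_def)
    show "brk w (ps ! (s - 1)) < m" using kb i by simp
    show "rows w ps ! s ! k = rows w ps ! 0 ! k" if "k < brk w (ps ! (s - 1))" for k
      using that i row_Suc[OF i(2)] qc o by (auto simp: brk_def nbr_def rows_def less_Suc_eq split: if_splits)
    show "rows w ps ! s ! brk w (ps ! (s - 1)) \<noteq> rows w ps ! 0 ! brk w (ps ! (s - 1))"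
      using key[OF i(2)] i qc key_eq[OF o, of c] w1 by (auto simp: rows_def brk_def split: if_splits)
    have "br (brk w (ps ! i)) (key w (ps ! i)) = nat (f (ta + (brk w (ps ! i) * N + key w (ps ! i))))"
      using kb[OF i(2)] N_le(2) by (simp add: br)
    also have "\<dots> = Suc i * N + Suc (brk w (ps ! i))" unfolding t2[OF i(2)] by (rule nat_int)
    finally show "br (brk w (ps ! (s - 1))) (rows w ps ! s ! brk w (ps ! (s - 1))) =
        s * Suc m + Suc (brk w (ps ! (s - 1)))"
      using key[OF i(2)] i(1) by (simp add: N_def)
  next
    fix d c assume "br d c \<noteq> 0"
    then have dc: "d < N" "c < N" "f (ta + (d * N + c)) \<noteq> 0" by (auto simp: br split: if_splits)
    then obtain i where i: "i < length ps" "d = brk w (ps ! i)" "c = key w (ps ! i)" using t3 by blast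
    then show "\<exists>s>0. s < length (rows w ps) \<and> brk w (ps ! (s - 1)) = d \<and> rows w ps ! s ! d = c"
      using key[OF i(1)] lr by (intro exI[of _ "Suc i"]) simp
  qed
qed

lemma tables_stored:
  assumes "automaton M m wa (rows w ps) b br" and c: "cfg (reg s)" and t: "tabs w ps (mem s)"
    and br: "\<And>d c. br d c = (if d < N \<and> c < N then nat (mem s (ta + (d * N + c))) else 0)"
  shows "tables.stored (rows w ps) b br m wa fa ta s"
proof -
  interpret automaton M m wa "rows w ps" b br by fact
  have lr: "length (rows w ps) = Suc (length ps)" by (simp add: rows_def)
  have t1: "(\<forall>k<m. mem s (wa + (i * N + k)) = int (rows w ps ! i ! k)) \<and> mem s (wa + (i * N + m)) = -1"
    if "i < Suc (length ps)" for i
    using t that unfolding tabs_def by blast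
  have "mem s (wa + v) = (if depth v < m then int (rows w ps ! row v ! depth v) else -1)" if "good v" for v
  proof -
    have r: "row v < Suc (length ps)" using that lr by (simp add: good_def)
    have v: "v = row v * N + depth v" using node_eq[of v] by (simp only: N_def)
    show ?thesis
    proof (cases "depth v < m")
      case True
      then show ?thesis using t1[OF r] v by metis
    next
      case False
      then have "depth v = m" using depth_le[of v] by simp
      then show ?thesis using t1[OF r] v by (metis less_irrefl)
    qed
  qed
  moreover have "mem s (ta + (d * Suc m + c)) = int (br d c)" if "d \<le> m" "c \<le> m" for d c
  proof -
    have dc: "d < N" "c < N" using that by (simp_all add: N_def)
    have "0 \<le> mem s (ta + (d * N + c))"
    proof -
      have "mem s (ta + (d * N + c)) = 0 \<or> (\<exists>i<length ps. d = brk w (ps ! i) \<and> c = key w (ps ! i))"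
        using t dc unfolding tabs_def by blast
      moreover have "\<forall>i<length ps. mem s (ta + (brk w (ps ! i) * N + key w (ps ! i))) =
          int (Suc i * N + Suc (brk w (ps ! i)))"
        using t unfolding tabs_def by blast
      ultimately show ?thesis by (metis of_nat_0_le_iff order_refl)
    qed
    then show ?thesis using dc by (simp add: br N_def)
  qed
  ultimately show ?thesis using cfgD[OF c] unfolding stored_def by (simp add: N_def)
qed

text \<open>In this order the costs of the scan, of row 0, of the other rows and of the failure
  links, the latter with at most \<open>2 * N\<close> rows. The final 40 cover the initialisation
  and the constant part of the scan.\<close>

definition budget :: int where
  "budget = 250 * int (length (txt_in M)) + (130 * int m + 20) +
     ((40 * int m + 90) * (2 * int N) + 40 * int m + 30) + ((260 * int N + 30) * int m + 20) + 40"

lemma pass_com_wp: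
  assumes wa: "wa = k * (N * N)"
    and xs: "length xs = m" "source M X xs" and ys: "length ys = length (txt_in M)" "source M Y ys"
    and out: "\<And>s e P. reg s xe = int e \<Longrightarrow> m \<le> Suc e \<Longrightarrow> e < length ys \<Longrightarrow> ev M s out P = P (pos e)"
      "ops out \<le> 5"
    and zero: "\<And>a. wa \<le> a \<Longrightarrow> a < wa + 6 * (N * N) \<Longrightarrow> mem s a = 0"
    and F: "F \<ge> R + budget" and R: "0 \<le> R"
    and Q: "\<And>s' F'. (\<And>a. wa + 6 * (N * N) \<le> a \<Longrightarrow> mem s' a = mem s a) \<Longrightarrow>
      set (outp s') = set (outp s) \<union> pos ` {e. e < length ys \<and> m \<le> Suc e \<and>
        (code (take m (drop (Suc e - m) ys)) = code xs \<or>
         asc_nbr (code xs) (code (take m (drop (Suc e - m) ys))))} \<Longrightarrow> R \<le> F' \<Longrightarrow> Q s' F'"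
  shows "wp M (pass_com k X Y out) Q s F"
proof -
  define w where "w = code xs"
  define R4 where "R4 = R + 250 * int (length ys) + 20"
  define R3 where "R3 = R4 + ((260 * int N + 30) * int m + 20)"
  define R2 where "R2 = R3 + ((40 * int m + 90) * (2 * int N) + 40 * int m + 30)"
  have NN: "m < N" "N \<le> N * N" by (simp_all add: N_le)
  have R4: "0 \<le> R4" "R \<le> R4" using R by (simp_all add: R4_def)
  have R3: "0 \<le> R3" using R4 by (simp add: R3_def)
  have R2: "0 \<le> R2" using R3 by (simp add: R2_def)
  define rest where "rest = code_com X ;; rows_com ;; fail_com ;; scan_com Y out"
  have main: "wp M rest Q t G"
    if t: "cfg (reg t)" "mem t = mem s" "outp t = outp s" "G \<ge> F - 20" for t :: "nat state" and G
    unfolding rest_def wp_Seq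
  proof (rule code_com_wp[OF xs(2,1) t(1), where R = R2])
    show "R2 + 130 * int m + 20 \<le> G" using t(4) F ys(1) by (simp add: R2_def R3_def R4_def budget_def)
    fix u :: "nat state" and H
    assume u: "cfg (reg u)" "\<And>k. k < m \<Longrightarrow> mem u (wa + k) = int (code xs ! k)" "mem u (wa + m) = - 1"
      "\<And>a. a < wa \<or> wa + N \<le> a \<Longrightarrow> mem u a = mem t a" "outp u = outp t" "R2 \<le> H"
    have mu: "mem u a = mem s a" if "fa \<le> a" for a
    proof -
      have "wa + N \<le> a" using that NN unfolding fa_def by linarith
      then show ?thesis using u(4) t(2) by simp
    qed
    have uz: "mem u a = 0" if "fa \<le> a" "a < ba" for a
      using mu[OF that(1)] zero[of a] that by (simp add: fa_def ba_def)
    show "wp M rows_com (wp M fail_com (wp M (scan_com Y out) Q)) u H"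
    proof (rule rows_com_wp[OF u(1) w_def xs(1), where R = R3])
      show "mem u (wa + k) = int (w ! k)" if "k < m" for k using u(2) that by (simp add: w_def)
      show "mem u (wa + m) = - 1" by (rule u(3))
      show "mem u a = 0" if "ta \<le> a" "a < ba" for a using uz that by (simp add: fa_def ta_def)
      show "R3 + (40 * int m + 90) * (2 * int N) + 40 * int m + 30 \<le> H" using u(6) by (simp add: R2_def)
      fix z :: "nat state" and Z ps
      assume z: "cfg (reg z)" "tabs w ps (mem z)" "outside (mem u) (mem z)" "outp z = outp u"
        "reg z xK = int (Suc (length ps) * N)" "set ps = {x. opt_ok w x}" "Suc (length ps) \<le> 2 * N" "R3 \<le> Z"
      define br where "br = (\<lambda>d c. if d < N \<and> c < N then nat (mem z (ta + (d * N + c))) else 0)"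
      have lr: "length (rows w ps) = Suc (length ps)" by (simp add: rows_def)
      have cr: "comb (rows w ps) (\<lambda>s. brk w (ps ! (s - 1))) br m"
        by (rule comb_rows[OF w_def xs(1) z(6,2)]) (simp add: br_def)
      have au: "automaton M m wa (rows w ps) (\<lambda>s. brk w (ps ! (s - 1))) br"
        using z(7) lr by (intro automaton.intro mach_axioms cr automaton_axioms.intro) (simp add: N_def)
      interpret au: automaton M m wa "rows w ps" "\<lambda>s. brk w (ps ! (s - 1))" br by (rule au)
      have st: "au.stored z" by (rule tables_stored[OF au z(1,2)]) (simp add: br_def)
      have mz: "mem z a = mem u a" if "fa \<le> a \<and> a < ta \<or> ba \<le> a" for a
        using z(3) that unfolding outside_def by blast
      show "wp M fail_com (wp M (scan_com Y out) Q) z Z"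
      proof (rule au.fail_com_wp[OF st z(1), where R = R4])
        show "mem z (wa + (i * N + d)) = int (rows w ps ! i ! d)" if "i < length (rows w ps)" "d < m" for i d
          using z(2) that lr unfolding tabs_def by simp
        show "mem z a = 0" if "fa \<le> a" "a < ta" for a
          using mz[of a] uz[of a] that by (simp add: ta_def ba_def)
        show "reg z xK = int (length (rows w ps) * N)" using z(5) lr by simp
        have "130 * int (length (rows w ps)) + 30 \<le> 260 * int N + 30" using z(7) lr by simp
        then have "(130 * int (length (rows w ps)) + 30) * int m \<le> (260 * int N + 30) * int m"
          by (intro mult_right_mono) simp_all
        then show "R4 + (130 * int (length (rows w ps)) + 30) * int m + 20 \<le> Z"
          using z(8) by (simp add: R3_def)
        fix y :: "nat state" and Y'
        assume y: "au.stored y" "cfg (reg y)" "au.fails y m" "\<And>a. a < fa \<or> ta \<le> a \<Longrightarrow> mem y a = mem z a"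
          "outp y = outp z" "R4 \<le> Y'"
        show "wp M (scan_com Y out) Q y Y'"
        proof (rule au.scan_com_wp[OF y(1-3) ys out, where R = R])
          show "R + 250 * int (length ys) + 20 \<le> Y'" using y(6) by (simp add: R4_def)
          fix x :: "nat state" and G'
          assume x: "\<And>a. ba + N \<le> a \<Longrightarrow> mem x a = mem y a"
            "set (outp x) = set (outp y) \<union> pos ` {e. e < length ys \<and> m \<le> Suc e \<and>
               win (tpd m ys) (Suc e - m) m \<in> set (rows w ps)}" "R \<le> G'"
          show "Q x G'"
          proof (rule Q)
            show "mem x a = mem s a" if "wa + 6 * (N * N) \<le> a" for a
            proof -
              have "ba + N \<le> a" "ta \<le> a" "ba \<le> a" "fa \<le> a"
                using that NN unfolding ba_def ta_def fa_def by linarith+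
              then show ?thesis using x(1) y(4) mz mu by simp
            qed
            have "{e. e < length ys \<and> m \<le> Suc e \<and> win (tpd m ys) (Suc e - m) m \<in> set (rows w ps)} =
              {e. e < length ys \<and> m \<le> Suc e \<and> (code (take m (drop (Suc e - m) ys)) = code xs \<or>
                 asc_nbr (code xs) (code (take m (drop (Suc e - m) ys))))}"
              by (intro Collect_cong conj_cong refl) (simp add: win_tpd set_rows[OF z(6)] w_def[symmetric])
            then show "set (outp x) = set (outp s) \<union> pos ` {e. e < length ys \<and> m \<le> Suc e \<and>
              (code (take m (drop (Suc e - m) ys)) = code xs \<or>
               asc_nbr (code xs) (code (take m (drop (Suc e - m) ys))))}"
              using x(2) y(5) z(4) u(5) t(3) by simp
          qed (rule x(3))
        qed (use R in simp_all)
      qed (use R4 in simp_all)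
    qed (use R3 in simp_all)
  qed (use R2 in simp_all)
  have fit': "wa + 6 * (N * N) \<le> cells M" using fit by (simp add: N_def)
  have bnd: "int N \<le> word_max M" "int (N * N) \<le> word_max M" "int wa \<le> word_max M"
    "int (2 * (N * N)) \<le> word_max M" "int (4 * (N * N)) \<le> word_max M" "int (5 * (N * N)) \<le> word_max M"
    "int fa \<le> word_max M" "int ta \<le> word_max M" "int ba \<le> word_max M"
    using fit' NN word_bound unfolding fa_def ta_def ba_def by linarith+
  have eq1: "int m + 1 = int N" by (simp add: N_def)
  have eq2: "int k * (int N * int N) = int wa" by (simp only: wa of_nat_mult)
  have eq: "int wa + 2 * (int N * int N) = int fa"
    "int wa + 4 * (int N * int N) = int ta" "int wa + 5 * (int N * int N) = int ba"
    by (simp_all add: fa_def ta_def ba_def)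
  have "wp M rest Q (s\<lparr>reg := (reg s)(xN := int N, xd := int N * int N, xW := int wa, xF := int fa,
      xT := int ta, xB := int ba)\<rparr>) G" if "G \<ge> F - 20" for G
    by (rule main) (use that in \<open>simp_all add: cfg_def\<close>)
  then show ?thesis
    unfolding pass_com_def rest_def[symmetric] init_com_def
    using bnd by (simp add: pat_len eq1 eq2 eq)
qed

end

text \<open>A window whose last position is \<open>e\<close>, counted from 0, starts at
  \<open>e + 2 - m\<close>, counted from 1. In the reversed text the last position of a window is
  the first one of the original window, which there is \<open>n - e\<close>. The factor 6 skips the
  six blocks of the first pass.\<close>

definition swap_match_com :: "nat com" where
  "swap_match_com =
     pass_com 0 (\<lambda>e. Pat (e \<oplus> Const 1)) (\<lambda>e. Txt (e \<oplus> Const 1)) (Reg xe \<oplus> Const 2 \<ominus> PatLen) ;;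
     pass_com 6 (\<lambda>e. Pat (PatLen \<ominus> e)) (\<lambda>e. Txt (TxtLen \<ominus> e)) (TxtLen \<ominus> Reg xe)"

section \<open>Reading the inputs forwards and backwards\<close>

lemma ev_range: "ev M s e (\<lambda>a. 0 \<le> a \<and> a < int l) \<Longrightarrow>
    (\<And>a. 0 \<le> a \<Longrightarrow> a < int l \<Longrightarrow> P a = Q a) \<Longrightarrow> ev M s e P = ev M s e Q"
  by (auto simp: ev_def)

lemma source_forward:
  assumes "int (length (pat_in M)) \<le> word_max M"
  shows "source M (\<lambda>e. Pat (e \<oplus> Const 1)) (pat_in M)"
  unfolding source_def
proof (intro conjI allI impI)
  fix s e P assume e: "ev M s e (\<lambda>a. 0 \<le> a \<and> a < int (length (pat_in M)))"
  show "ev M s (Pat (e \<oplus> Const 1)) P = ev M s e (\<lambda>a. P (pat_in M ! nat a))"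
    unfolding ev_simps by (rule ev_range[OF e]) (use assms in simp)
qed simp

lemma source_forward_txt:
  assumes "int (length (txt_in M)) \<le> word_max M"
  shows "source M (\<lambda>e. Txt (e \<oplus> Const 1)) (txt_in M)"
  unfolding source_def
proof (intro conjI allI impI)
  fix s e P assume e: "ev M s e (\<lambda>a. 0 \<le> a \<and> a < int (length (txt_in M)))"
  show "ev M s (Txt (e \<oplus> Const 1)) P = ev M s e (\<lambda>a. P (txt_in M ! nat a))"
    unfolding ev_simps by (rule ev_range[OF e]) (use assms in simp)
qed simp

lemma nth_rev_int:
  assumes "0 \<le> a" "a < int (length xs)"
  shows "xs ! nat (int (length xs) - a - 1) = rev xs ! nat a"
proof -
  have "nat (int (length xs) - a - 1) = length xs - Suc (nat a)" using assms by linarith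
  moreover have "nat a < length xs" using assms by linarith
  ultimately show ?thesis by (simp add: rev_nth)
qed

lemma source_backward:
  assumes "int (length (pat_in M)) \<le> word_max M"
  shows "source M (\<lambda>e. Pat (PatLen \<ominus> e)) (rev (pat_in M))"
  unfolding source_def
proof (intro conjI allI impI)
  fix s e P assume "ev M s e (\<lambda>a. 0 \<le> a \<and> a < int (length (rev (pat_in M))))"
  then have e: "ev M s e (\<lambda>a. 0 \<le> a \<and> a < int (length (pat_in M)))" by simp
  show "ev M s (Pat (PatLen \<ominus> e)) P = ev M s e (\<lambda>a. P (rev (pat_in M) ! nat a))"
    unfolding ev_simps by (rule ev_range[OF e]) (use assms in \<open>simp add: nth_rev_int\<close>)
qed simp

lemma source_backward_txt:
  assumes "int (length (txt_in M)) \<le> word_max M"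
  shows "source M (\<lambda>e. Txt (TxtLen \<ominus> e)) (rev (txt_in M))"
  unfolding source_def
proof (intro conjI allI impI)
  fix s e P assume "ev M s e (\<lambda>a. 0 \<le> a \<and> a < int (length (rev (txt_in M))))"
  then have e: "ev M s e (\<lambda>a. 0 \<le> a \<and> a < int (length (txt_in M)))" by simp
  show "ev M s (Txt (TxtLen \<ominus> e)) P = ev M s e (\<lambda>a. P (rev (txt_in M) ! nat a))"
    unfolding ev_simps by (rule ev_range[OF e]) (use assms in \<open>simp add: nth_rev_int\<close>)
qed simp

text \<open>The disjunction of \<open>ct_swap_eq_code\<close> is divided between the passes, the
  forward one testing a window and the backward one its reversal. Both may report the same position,
  so the comparison is one of sets.\<close>

lemma occurrences_code:
  assumes p: "distinct p" "0 < length p" and t: "distinct t"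
  shows "int ` occurrences p t =
    (\<lambda>e. int e + 2 - int (length p)) ` {e. e < length t \<and> length p \<le> Suc e \<and>
        (code (take (length p) (drop (Suc e - length p) t)) = code p \<or>
         asc_nbr (code p) (code (take (length p) (drop (Suc e - length p) t))))} \<union>
    (\<lambda>e. int (length t) - int e) ` {e. e < length t \<and> length p \<le> Suc e \<and>
        (code (take (length p) (drop (Suc e - length p) (rev t))) = code (rev p) \<or>
         asc_nbr (code (rev p)) (code (take (length p) (drop (Suc e - length p) (rev t)))))}"
    (is "_ = ?f ` ?A \<union> ?g ` ?B")
proof -
  let ?m = "length p" and ?n = "length t"
  define x where "x j = take ?m (drop (j - 1) t)" for j
  define fw where "fw j \<longleftrightarrow> code (x j) = code p \<or> asc_nbr (code p) (code (x j))" for j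
  define bw where "bw j \<longleftrightarrow> code (rev (x j)) = code (rev p) \<or> asc_nbr (code (rev p)) (code (rev (x j)))" for j
  have occ: "j \<in> occurrences p t \<longleftrightarrow> 1 \<le> j \<and> j + ?m \<le> ?n + 1 \<and> (fw j \<or> bw j)" for j
  proof -
    have "distinct (x j)" using t by (simp add: x_def)
    from ct_swap_eq_code[OF this p(1)] show ?thesis
      unfolding occurrences_def substring_def fw_def bw_def x_def[symmetric] by auto
  qed
  have A: "e \<in> ?A \<longleftrightarrow> e < ?n \<and> ?m \<le> Suc e \<and> fw (e + 2 - ?m)" for e
  proof -
    have "x (e + 2 - ?m) = take ?m (drop (Suc e - ?m) t)" if "?m \<le> Suc e"
      using that by (simp add: x_def Suc_diff_le)
    then show ?thesis by (auto simp: fw_def)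
  qed
  have B: "e \<in> ?B \<longleftrightarrow> e < ?n \<and> ?m \<le> Suc e \<and> bw (?n - e)" for e
  proof -
    have "rev (x (?n - e)) = take ?m (drop (Suc e - ?m) (rev t))" if "?m \<le> Suc e" "e < ?n"
    proof -
      have "take ?m (drop (Suc e - ?m) (rev t)) = rev (drop (length (take (?n - (Suc e - ?m)) t) - ?m) (take (?n - (Suc e - ?m)) t))"
        by (simp add: drop_rev take_rev)
      also have "length (take (?n - (Suc e - ?m)) t) - ?m = ?n - e - 1" using that by simp
      also have "drop (?n - e - 1) (take (?n - (Suc e - ?m)) t) = take (?n - (Suc e - ?m) - (?n - e - 1)) (drop (?n - e - 1) t)"
        by (rule drop_take)
      also have "?n - (Suc e - ?m) - (?n - e - 1) = ?m" using that by simp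
      finally show ?thesis by (simp add: x_def)
    qed
    then show ?thesis by (auto simp: bw_def)
  qed
  show ?thesis
  proof (intro equalityI subsetI)
    fix y assume "y \<in> int ` occurrences p t"
    then obtain j where j: "y = int j" "1 \<le> j" "j + ?m \<le> ?n + 1" "fw j \<or> bw j" using occ by auto
    from j(4) show "y \<in> ?f ` ?A \<union> ?g ` ?B"
    proof
      assume f: "fw j"
      have eq: "j + ?m - 2 + 2 - ?m = j" and "j + ?m - 2 < ?n" "?m \<le> Suc (j + ?m - 2)"
        using j(2,3) p(2) by linarith+
      then have "j + ?m - 2 \<in> ?A" unfolding A eq using f by blast
      moreover have "y = ?f (j + ?m - 2)" using j(1,2) p(2) by linarith
      ultimately show ?thesis by blast
    next
      assume b: "bw j"
      have eq: "?n - (?n - j) = j" and "?n - j < ?n" "?m \<le> Suc (?n - j)"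
        using j(2,3) p(2) by linarith+
      then have "?n - j \<in> ?B" unfolding B eq using b by blast
      moreover have "y = ?g (?n - j)" using j(1-3) p(2) by linarith
      ultimately show ?thesis by blast
    qed
  next
    fix y assume "y \<in> ?f ` ?A \<union> ?g ` ?B"
    then show "y \<in> int ` occurrences p t"
    proof
      assume "y \<in> ?f ` ?A"
      then obtain e where e: "e \<in> ?A" "y = ?f e" by blast
      then have "e < ?n" "?m \<le> Suc e" "fw (e + 2 - ?m)" using A by blast+
      then have "e + 2 - ?m \<in> occurrences p t" "y = int (e + 2 - ?m)"
        unfolding occ using e(2) by auto
      then show ?thesis by blast
    next
      assume "y \<in> ?g ` ?B"
      then obtain e where e: "e \<in> ?B" "y = ?g e" by blast
      then have "e < ?n" "?m \<le> Suc e" "bw (?n - e)" using B by blast+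
      then have "?n - e \<in> occurrences p t" "y = int (?n - e)"
        unfolding occ using e(2) by auto
      then show ?thesis by blast
    qed
  qed
qed

section \<open>Correctness and resource bounds of the complete program\<close>

lemma swap_match_com_run:
  assumes p: "distinct p" "length p = m" "1 \<le> m" and t: "distinct t" "length t = n"
  shows "\<exists>T S out. run swap_match_com p t (int ((m + n + 1) ^ 10)) T S out \<and>
     set out = int ` occurrences p t \<and> T \<le> 10000 * (m ^ 2 + n) \<and>
     S = 12 * (Suc m * Suc m) + card (regs swap_match_com)"
proof -
  define W where "W = int ((m + n + 1) ^ 10)"
  define M where "M = \<lparr>pat_in = p, txt_in = t, word_max = W, cells = 12 * (Suc m * Suc m)\<rparr>"
  let ?a = "m + n + 1"
  \<comment> \<open>Since \<open>?a\<close> is at least 2, eight of the ten factors supply the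
    constant 256; the remaining square dominates \<open>Suc m * Suc m\<close>, \<open>m\<close> and
    \<open>n\<close>.\<close>
  have "(2::nat) ^ 8 \<le> ?a ^ 8" using p by (intro power_mono) auto
  then have "256 * (?a * ?a) \<le> ?a ^ 8 * (?a * ?a)" by (intro mult_le_mono1) simp
  also have "?a ^ 8 * (?a * ?a) = ?a ^ 10" by (simp add: power_add[symmetric] power2_eq_square[symmetric])
  finally have "256 * (?a * ?a) \<le> ?a ^ 10" .
  moreover have "Suc m * Suc m \<le> ?a * ?a" by (intro mult_le_mono) auto
  moreover have "?a \<le> ?a * ?a" by simp
  ultimately have big: "12 * (Suc m * Suc m) + 3 * m + 3 + n \<le> ?a ^ 10" by linarith
  then have W: "int (12 * (Suc m * Suc m)) + 3 * int m + 3 + int n \<le> W" unfolding W_def by linarith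
  have "int m \<le> W" "int n \<le> W"
    using W of_nat_0_le_iff[of "12 * (Suc m * Suc m)"] by linarith+
  then have W': "int (length (pat_in M)) \<le> word_max M" "int (length (txt_in M)) \<le> word_max M"
    using p t by (simp_all add: M_def)
  interpret m1: mach M m 0
    using W p t by unfold_locales (simp_all add: M_def)
  \<comment> \<open>The second pass works right behind the six blocks of the first one, in cells
    that are still 0.\<close>
  interpret m2: mach M m "6 * (m1.N * m1.N)"
    using W p t by unfold_locales (simp_all add: M_def m1.N_def)
  have bud: "m2.budget = m1.budget" by (simp add: m1.budget_def m2.budget_def m1.N_def m2.N_def)
  let ?pos1 = "\<lambda>e. int e + 2 - int m" and ?pos2 = "\<lambda>e. int n - int e"
  have out1: "ev M s (Reg xe \<oplus> Const 2 \<ominus> PatLen) P = P (?pos1 e)"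
    if "reg s xe = int e" "m \<le> Suc e" "e < n" for s e P
  proof -
    have "\<bar>int e + 2\<bar> \<le> W" "\<bar>int e + 2 - int m\<bar> \<le> W" using that W by linarith+
    then show ?thesis using that p by (simp add: M_def)
  qed
  have out2: "ev M s (TxtLen \<ominus> Reg xe) P = P (?pos2 e)"
    if "reg s xe = int e" "m \<le> Suc e" "e < n" for s e P
  proof -
    have "\<bar>int n - int e\<bar> \<le> W" using that W by linarith
    then show ?thesis using that t by (simp add: M_def)
  qed
  have p0: "0 < length p" using p by simp
  have budget_pos: "0 \<le> m1.budget" by (simp add: m1.budget_def)
  have "wp M swap_match_com (\<lambda>s F. 0 \<le> F \<and> set (outp s) = int ` occurrences p t)
    start (m1.budget + m1.budget)"
    unfolding swap_match_com_def wp_Seq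
  proof (rule m1.pass_com_wp[where R = "m1.budget" and xs = p and ys = t and pos = ?pos1])
    show "source M (\<lambda>e. Pat (e \<oplus> Const 1)) p" "source M (\<lambda>e. Txt (e \<oplus> Const 1)) t"
      using source_forward[OF W'(1)] source_forward_txt[OF W'(2)] by (simp_all add: M_def)
    show "ev M s (Reg xe \<oplus> Const 2 \<ominus> PatLen) P = P (?pos1 e)"
      if "reg s xe = int e" "m \<le> Suc e" "e < length t" for s e P
      by (rule out1) (use that t in simp_all)
    fix s' :: "nat state" and F'
    assume s': "\<And>a. 0 + 6 * (m1.N * m1.N) \<le> a \<Longrightarrow> mem s' a = mem start a"
      "set (outp s') = set (outp start) \<union> ?pos1 ` {e. e < length t \<and> m \<le> Suc e \<and>
        (code (take m (drop (Suc e - m) t)) = code p \<or> asc_nbr (code p) (code (take m (drop (Suc e - m) t))))}"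
      "m1.budget \<le> F'"
    show "wp M (pass_com 6 (\<lambda>e. Pat (PatLen \<ominus> e)) (\<lambda>e. Txt (TxtLen \<ominus> e)) (TxtLen \<ominus> Reg xe))
      (\<lambda>s F. 0 \<le> F \<and> set (outp s) = int ` occurrences p t) s' F'"
    proof (rule m2.pass_com_wp[where R = 0 and xs = "rev p" and ys = "rev t" and pos = ?pos2])
      show "6 * (m1.N * m1.N) = 6 * (m2.N * m2.N)" by (simp add: m1.N_def m2.N_def)
      show "source M (\<lambda>e. Pat (PatLen \<ominus> e)) (rev p)" "source M (\<lambda>e. Txt (TxtLen \<ominus> e)) (rev t)"
        using source_backward[OF W'(1)] source_backward_txt[OF W'(2)] by (simp_all add: M_def)
      show "ev M s (TxtLen \<ominus> Reg xe) P = P (?pos2 e)"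
        if "reg s xe = int e" "m \<le> Suc e" "e < length (rev t)" for s e P
        by (rule out2) (use that t in simp_all)
      show "mem s' a = 0" if "6 * (m1.N * m1.N) \<le> a" for a
        using s'(1)[of a] that by (simp add: start_def)
      fix s'' :: "nat state" and F''
      assume "set (outp s'') = set (outp s') \<union> ?pos2 ` {e. e < length (rev t) \<and> m \<le> Suc e \<and>
        (code (take m (drop (Suc e - m) (rev t))) = code (rev p) \<or>
         asc_nbr (code (rev p)) (code (take m (drop (Suc e - m) (rev t)))))}" "0 \<le> F''"
      then show "0 \<le> F'' \<and> set (outp s'') = int ` occurrences p t"
        unfolding occurrences_code[OF p(1) p0 t(1)] using s'(2) p(2) t(2) by (simp add: start_def)
    next
      show "length (rev p) = m" "length (rev t) = length (txt_in M)" using p(2) t(2) by (simp_all add: M_def)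
      show "0 + m2.budget \<le> F'" using s'(3) bud by simp
      show "ops (TxtLen \<ominus> Reg xe) \<le> 5" by simp
    qed simp_all
  next
    show "length p = m" "length t = length (txt_in M)" using p(2) t(2) by (simp_all add: M_def)
    show "ops (Reg xe \<oplus> Const 2 \<ominus> PatLen) \<le> 5" by simp
    show "mem start a = 0" for a by (simp add: start_def)
    show "0 \<le> m1.budget" by (rule budget_pos)
  qed simp_all
  then obtain T s where "exec M swap_match_com start T s \<and>
      (0 \<le> m1.budget + m1.budget - int T \<and> set (outp s) = int ` occurrences p t)"
    unfolding wp_def by (elim exE)
  then have T: "exec M swap_match_com start T s" "int T \<le> m1.budget + m1.budget"
    "set (outp s) = int ` occurrences p t"
    by simp_all
  have "m1.budget + m1.budget \<le> 10000 * (int m * int m + int n)"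
  proof -
    \<comment> \<open>With \<open>x\<close>, \<open>y\<close> and \<open>z\<close> for
      \<open>m * m\<close>, \<open>n\<close> and \<open>m\<close> the estimate is linear; the lower
      order terms are absorbed because \<open>m\<close> is at least 1.\<close>
    have arith: "B + B \<le> 10000 * (x + y)"
      if "B = 250 * y + 340 * x + 720 * z + 290" "z * 1 \<le> x" "1 \<le> z" "0 \<le> y" for B x y z :: int
    proof -
      have "1 \<le> x" using that by simp
      have "B + B = 500 * y + 680 * x + 1440 * z + 580" using that(1) by simp
      also have "\<dots> \<le> 500 * y + 680 * x + 1440 * x + 580 * x"
        using that(2) \<open>1 \<le> x\<close> by (intro add_mono) simp_all
      also have "\<dots> \<le> 10000 * y + 10000 * x" using that(4) \<open>1 \<le> x\<close> by simp
      finally show ?thesis by simp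
    qed
    have "m1.budget = 250 * int n + 340 * (int m * int m) + 720 * int m + 290"
      unfolding m1.budget_def m1.N_def using t by (simp add: M_def algebra_simps)
    then show ?thesis
    proof (rule arith)
      show "int m * 1 \<le> int m * int m" using p by (intro mult_left_mono) simp_all
    qed (use p in simp_all)
  qed
  with T(2) have "int T \<le> int (10000 * (m ^ 2 + n))" by (simp add: power2_eq_square)
  then have "T \<le> 10000 * (m ^ 2 + n)" by (simp only: of_nat_le_iff)
  moreover have "run swap_match_com p t W T (12 * (Suc m * Suc m) + card (regs swap_match_com)) (outp s)"
    unfolding run_def
    by (intro exI[of _ "12 * (Suc m * Suc m)"] exI[of _ s] conjI refl) (rule T(1)[unfolded M_def])
  ultimately show ?thesis using T(3) unfolding W_def
    by (intro exI[of _ T] exI[of _ "12 * (Suc m * Suc m) + card (regs swap_match_com)"] exI[of _ "outp s"] conjI) simp_all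
qed

theorem theorem2:
  shows "\<exists>(P :: nat com) (k :: nat) (c :: real).
    \<forall>(p :: int list) (t :: int list) (m :: nat) (n :: nat).
      distinct p \<and> distinct t \<and> length p = m \<and> length t = n \<and> m \<ge> 1 \<longrightarrow>
      (\<exists>T S out. run P p t (int ((m + n + 1) ^ k)) T S out \<and>
         set out = int ` occurrences p t \<and>
         real T \<le> c * ((real m ^ 2 + real n) * max 1 (log 2 (real m))) \<and>
         real S \<le> c * real m ^ 2)"
proof -
  define r where "r = card (regs swap_match_com)"
  \<comment> \<open>One constant for both bounds: 10000 comes from the time and also exceeds the 48
    that results from \<open>12 * (Suc m * Suc m)\<close> when \<open>Suc m\<close> is at most
    \<open>2 * m\<close>; \<open>r\<close> accounts for the registers, counted as work
    space.\<close>
  define c :: real where "c = 10000 + real r"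
  have main: "\<exists>T S out. run swap_match_com p t (int ((m + n + 1) ^ 10)) T S out \<and>
         set out = int ` occurrences p t \<and>
         real T \<le> c * ((real m ^ 2 + real n) * max 1 (log 2 (real m))) \<and>
         real S \<le> c * real m ^ 2"
    if "distinct p" "distinct t" "length p = m" "length t = n" "m \<ge> 1" for p t m n
  proof -
    obtain T S out where R: "run swap_match_com p t (int ((m + n + 1) ^ 10)) T S out"
      "set out = int ` occurrences p t" and T: "T \<le> 10000 * (m ^ 2 + n)"
      and S: "S = 12 * (Suc m * Suc m) + r"
      using swap_match_com_run[OF \<open>distinct p\<close> \<open>length p = m\<close> \<open>m \<ge> 1\<close> \<open>distinct t\<close> \<open>length t = n\<close>, folded r_def]
      by (elim exE conjE) (rule that)
    have "real T \<le> real (10000 * (m ^ 2 + n))" using T by (simp only: of_nat_le_iff)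
    also have "\<dots> = 10000 * (real m ^ 2 + real n)" by simp
    also have "\<dots> \<le> c * ((real m ^ 2 + real n) * max 1 (log 2 (real m)))"
    proof -
      have "(real m ^ 2 + real n) * 1 \<le> (real m ^ 2 + real n) * max 1 (log 2 (real m))"
        by (intro mult_left_mono) simp_all
      then show ?thesis unfolding c_def by (intro mult_mono) simp_all
    qed
    finally have 1: "real T \<le> c * ((real m ^ 2 + real n) * max 1 (log 2 (real m)))" .
    have m2: "1 \<le> real m ^ 2" using \<open>m \<ge> 1\<close> by simp
    have "Suc m * Suc m \<le> (2 * m) * (2 * m)" using \<open>m \<ge> 1\<close> by (intro mult_le_mono) simp_all
    then have "S \<le> 48 * m ^ 2 + r" unfolding S by (simp add: power2_eq_square)
    then have "real S \<le> real (48 * m ^ 2 + r)" by (simp only: of_nat_le_iff)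
    also have "\<dots> \<le> 48 * real m ^ 2 + real r * real m ^ 2"
      using m2 mult_left_mono[OF m2, of "real r"] by simp
    also have "\<dots> \<le> c * real m ^ 2" by (simp add: c_def algebra_simps)
    finally have "real S \<le> c * real m ^ 2" .
    with R 1 show ?thesis by (intro exI[of _ T] exI[of _ S] exI[of _ out] conjI)
  qed
  show ?thesis
  proof (rule exI[of _ swap_match_com], rule exI[of _ 10], rule exI[of _ c], intro allI impI)
    fix p t :: "int list" and m n :: nat
    assume "distinct p \<and> distinct t \<and> length p = m \<and> length t = n \<and> m \<ge> 1"
    then have "distinct p" "distinct t" "length p = m" "length t = n" "m \<ge> 1" by simp_all
    then show "\<exists>T S out. run swap_match_com p t (int ((m + n + 1) ^ 10)) T S out \<and>
         set out = int ` occurrences p t \<and>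
         real T \<le> c * ((real m ^ 2 + real n) * max 1 (log 2 (real m))) \<and>
         real S \<le> c * real m ^ 2"
      by (rule main)
  qed
qed

end
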